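(* Let $\Gamma=\mathbb{Z}_2*\mathbb{Z}_2*\mathbb{Z}_2*\mathbb{Z}_2$ be the free product of four copies of the group of order two. There exist a compact metric space $Z$ and a faithful minimal topological action $\widetilde{\Phi}:\Gamma\to \mathrm{Homeo}(Z)$ for which there exist ergodic $\widetilde{\Phi}$-invariant Borel probability measures $\mu_1$ and $\mu_2$ on $Z$ such that the measurable equivalence relations given by the systems $(\widetilde{\Phi},Z,\mu_1)$ and $(\widetilde{\Phi},Z,\mu_2)$ are not orbit equivalent.
   Context: A topological action of a countable group $\Gamma$ on a compact metric space $Z$ is a homomorphism $\widetilde{\Phi}:\Gamma\to\mathrm{Homeo}(Z)$; it is faithful if this homomorphism is injective, and minimal if the orbit of every $z\in Z$ is dense in $Z$. The orbit equivalence relation $E$ of the action is the countable Borel equivalence relation on $Z$ in which $x\equiv_E y$ if and only if $y=\widetilde{\Phi}(\gamma)(x)$ for some $\gamma\in\Gamma$. If $\mu$ is a $\widetilde{\Phi}$-invariant Borel probability measure on $Z$, the measurable equivalence relation given by $(\widetilde{\Phi},Z,\mu)$ is the triple $(Z,E,\mu)$. Two measurable equivalence relations $(Z_1,E_1,\mu_1)$ and $(Z_2,E_2,\mu_2)$ (standard Borel spaces with countable Borel equivalence relations and invariant probability measures) are orbit equivalent if there is a measure-preserving isomorphism $T:Z_1\to Z_2$ (a Borel isomorphism between conull Borel subsets carrying $\mu_1$ to $\mu_2$) such that for $\mu_1$-almost all $z\in Z_1$ the image under $T$ of the $E_1$-class of $z$ is the $E_2$-class of $T(z)$ (up to null sets).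 *)

theory Defs
  imports
    "HOL-Probability.Probability"
    "HOL-Algebra.Group_Action"
    "HOL-Algebra.Elementary_Groups"
begin

section \<open>Free products of groups\<close>

definition free_product_words ::
    "'i set \<Rightarrow> ('i \<Rightarrow> ('a, 'm) monoid_scheme) \<Rightarrow> ('i \<times> 'a) list set"
  where "free_product_words I G = lists (SIGMA i:I. carrier (G i))"

text \<open>The least congruence on the free monoid of words that is compatible with the units and
  the multiplications of the factors.\<close>

inductive free_product_cong ::
    "'i set \<Rightarrow> ('i \<Rightarrow> ('a, 'm) monoid_scheme) \<Rightarrow> ('i \<times> 'a) list \<Rightarrow> ('i \<times> 'a) list \<Rightarrow> bool"
  for I :: "'i set" and G :: "'i \<Rightarrow> ('a, 'm) monoid_scheme"
  where
    refl: "u \<in> free_product_words I G \<Longrightarrow> free_product_cong I G u u"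
  | sym: "free_product_cong I G u v \<Longrightarrow> free_product_cong I G v u"
  | trans: "free_product_cong I G u v \<Longrightarrow> free_product_cong I G v w \<Longrightarrow> free_product_cong I G u w"
  | append: "free_product_cong I G u u' \<Longrightarrow> free_product_cong I G v v'
      \<Longrightarrow> free_product_cong I G (u @ v) (u' @ v')"
  | unit: "i \<in> I \<Longrightarrow> free_product_cong I G [(i, \<one>\<^bsub>G i\<^esub>)] []"
  | mult: "i \<in> I \<Longrightarrow> x \<in> carrier (G i) \<Longrightarrow> y \<in> carrier (G i)
      \<Longrightarrow> free_product_cong I G [(i, x), (i, y)] [(i, x \<otimes>\<^bsub>G i\<^esub> y)]"

definition free_product_rel ::
    "'i set \<Rightarrow> ('i \<Rightarrow> ('a, 'm) monoid_scheme) \<Rightarrow> ('i \<times> 'a) list rel"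
  where "free_product_rel I G = {(u, v). free_product_cong I G u v}"

definition free_product ::
    "'i set \<Rightarrow> ('i \<Rightarrow> ('a, 'm) monoid_scheme) \<Rightarrow> ('i \<times> 'a) list set monoid"
  where "free_product I G =
    \<lparr>carrier = free_product_words I G // free_product_rel I G,
     mult = \<lambda>A B. \<Union>u\<in>A. \<Union>v\<in>B. free_product_rel I G `` {u @ v},
     one = free_product_rel I G `` {[]}\<rparr>"

lemma free_product_cong_words:
  assumes "\<And>i. i \<in> I \<Longrightarrow> group (G i)" "free_product_cong I G u v"
  shows "u \<in> free_product_words I G \<and> v \<in> free_product_words I G"
  using assms(2)
proof (induction rule: free_product_cong.induct)
  case (unit i)
  then show ?case
    using group.is_monoid[OF assms(1), OF unit]
    by (auto simp: free_product_words_def monoid.one_closed)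
next
  case (mult i x y)
  then show ?case
    using group.is_monoid[OF assms(1), OF mult(1)]
    by (auto simp: free_product_words_def monoid.m_closed)
qed (auto simp: free_product_words_def)

lemma equiv_free_product_rel:
  assumes "\<And>i. i \<in> I \<Longrightarrow> group (G i)"
  shows "equiv (free_product_words I G) (free_product_rel I G)"
  using free_product_cong_words[of I G] assms
  by (intro equivI)
     (auto simp: refl_on_def sym_def trans_def free_product_rel_def
       intro: free_product_cong.refl free_product_cong.sym free_product_cong.trans)

lemma free_product_mult_class:
  assumes "\<And>i. i \<in> I \<Longrightarrow> group (G i)"
    and "u \<in> free_product_words I G" "v \<in> free_product_words I G"
  shows "free_product_rel I G `` {u} \<otimes>\<^bsub>free_product I G\<^esub> free_product_rel I G `` {v}
    = free_product_rel I G `` {u @ v}"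
proof -
  have "free_product_rel I G `` {u' @ v'} = free_product_rel I G `` {u @ v}"
    if "u' \<in> free_product_rel I G `` {u}" "v' \<in> free_product_rel I G `` {v}" for u' v'
  proof (rule equiv_class_eq[OF equiv_free_product_rel, symmetric])
    show "(u @ v, u' @ v') \<in> free_product_rel I G"
      using that by (simp add: free_product_rel_def free_product_cong.append)
  qed (rule assms(1))
  then have *: "(\<Union>v'\<in>free_product_rel I G `` {v}. free_product_rel I G `` {u' @ v'})
      = free_product_rel I G `` {u @ v}" if "u' \<in> free_product_rel I G `` {u}" for u'
    using that equiv_class_self[OF equiv_free_product_rel[OF assms(1)] assms(3)]
    by (intro UN_constant_eq) blast+
  have "(\<Union>u'\<in>free_product_rel I G `` {u}. \<Union>v'\<in>free_product_rel I G `` {v}.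
      free_product_rel I G `` {u' @ v'}) = free_product_rel I G `` {u @ v}"
    using equiv_class_self[OF equiv_free_product_rel[OF assms(1)] assms(2)] *
    by (intro UN_constant_eq) blast+
  then show ?thesis
    by (simp only: free_product_def monoid.simps)
qed

lemma group_free_product:
  assumes G: "\<And>i. i \<in> I \<Longrightarrow> group (G i)"
  shows "group (free_product I G)"
proof -
  let ?W = "free_product_words I G" and ?R = "free_product_rel I G" and ?F = "free_product I G"
  have carr: "carrier ?F = ?W // ?R" and one: "\<one>\<^bsub>?F\<^esub> = ?R `` {[]}"
    by (simp_all add: free_product_def)
  have app: "u @ v \<in> ?W" if "u \<in> ?W" "v \<in> ?W" for u v
    using that by (auto simp: free_product_words_def)
  have nil: "[] \<in> ?W" by (simp add: free_product_words_def)
  note mc = free_product_mult_class[of I G, OF G]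
  have inv: "\<exists>v\<in>?W. free_product_cong I G (v @ u) []" if "u \<in> ?W" for u
    using that
  proof (induction u)
    case Nil
    then show ?case using nil by (force intro: free_product_cong.refl)
  next
    case (Cons a u)
    then obtain i x where a: "a = (i, x)" "i \<in> I" "x \<in> carrier (G i)" and u: "u \<in> ?W"
      by (auto simp: free_product_words_def)
    interpret Gi: group "G i" by (rule G[OF a(2)])
    from Cons.IH[OF u] obtain v where v: "v \<in> ?W" "free_product_cong I G (v @ u) []" by blast
    let ?b = "(i, inv\<^bsub>G i\<^esub> x)"
    have "free_product_cong I G [?b, a] [(i, \<one>\<^bsub>G i\<^esub>)]"
      using free_product_cong.mult[of i I "inv\<^bsub>G i\<^esub> x" G x] a by simp
    then have "free_product_cong I G [?b, a] []"
      using free_product_cong.unit[OF a(2), of G] free_product_cong.trans by metis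
    then have "free_product_cong I G (v @ [?b, a] @ u) (v @ [] @ u)"
      using u v(1) by (intro free_product_cong.append free_product_cong.refl)
    then have "free_product_cong I G ((v @ [?b]) @ a # u) []"
      using free_product_cong.trans[OF _ v(2)] by simp
    moreover have "v @ [?b] \<in> ?W"
      using v(1) a by (auto simp: free_product_words_def)
    ultimately show ?case by blast
  qed
  show ?thesis
  proof (rule groupI)
    fix x y assume "x \<in> carrier ?F" "y \<in> carrier ?F"
    then show "x \<otimes>\<^bsub>?F\<^esub> y \<in> carrier ?F"
      unfolding carr by (auto elim!: quotientE simp: mc app intro!: quotientI)
  next
    show "\<one>\<^bsub>?F\<^esub> \<in> carrier ?F"
      unfolding carr one by (rule quotientI[OF nil])
  next
    fix x y z assume "x \<in> carrier ?F" "y \<in> carrier ?F" "z \<in> carrier ?F"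
    then show "x \<otimes>\<^bsub>?F\<^esub> y \<otimes>\<^bsub>?F\<^esub> z = x \<otimes>\<^bsub>?F\<^esub> (y \<otimes>\<^bsub>?F\<^esub> z)"
      unfolding carr by (auto elim!: quotientE simp: mc app)
  next
    fix x assume "x \<in> carrier ?F"
    then show "\<one>\<^bsub>?F\<^esub> \<otimes>\<^bsub>?F\<^esub> x = x"
      unfolding carr one by (auto elim!: quotientE simp: mc nil)
  next
    fix x assume "x \<in> carrier ?F"
    then obtain u where u: "u \<in> ?W" "x = ?R `` {u}"
      unfolding carr by (auto elim!: quotientE)
    from inv[OF u(1)] obtain v where v: "v \<in> ?W" "free_product_cong I G (v @ u) []" by blast
    have "?R `` {v @ u} = ?R `` {[]}"
      using v(2) by (intro equiv_class_eq[OF equiv_free_product_rel[OF G]])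
        (auto simp: free_product_rel_def)
    then show "\<exists>y\<in>carrier ?F. y \<otimes>\<^bsub>?F\<^esub> x = \<one>\<^bsub>?F\<^esub>"
      unfolding carr one u(2) using v(1) u(1) by (intro bexI[of _ "?R `` {v}"]) (auto simp: mc quotientI)
  qed
qed

definition free_product_four_Z2 :: "(nat \<times> int) list set monoid"
  where "free_product_four_Z2 = free_product {..<4} (\<lambda>_. integer_mod_group 2)"


section \<open>Topological actions\<close>

text \<open>Types cannot be quantified existentially, so an existential statement about compact metric
  spaces has to fix an ambient type.  Any type of the cardinality of the continuum loses no
  generality: a compact metric space has at most that cardinality, hence is isometric to an element
  of \<open>(nat \<Rightarrow> real) metric\<close>, a subset of the type with an arbitrary metric on it.\<close>

definition homeo_group :: "'z topology \<Rightarrow> ('z \<Rightarrow> 'z) monoid"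
  where "homeo_group X =
    (BijGroup (topspace X)) \<lparr>carrier := {f \<in> Bij (topspace X). homeomorphic_map X X f}\<rparr>"

lemma group_homeo_group: "group (homeo_group X)"
proof -
  let ?Z = "topspace X"
  let ?H = "{f \<in> Bij ?Z. homeomorphic_map X X f}"
  interpret B: group "BijGroup ?Z" by (rule group_BijGroup)
  have "subgroup ?H (BijGroup ?Z)"
  proof (rule B.subgroupI)
    show "?H \<subseteq> carrier (BijGroup ?Z)"
      by (auto simp: BijGroup_def)
    have "homeomorphic_map X X (\<lambda>x\<in>?Z. x)"
      by (rule homeomorphic_map_eq[where f = id]) simp_all
    then show "?H \<noteq> {}"
      using id_Bij by blast
  next
    fix f assume f: "f \<in> ?H"
    then obtain g where g: "homeomorphic_maps X X f g"
      unfolding homeomorphic_map_maps by blast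
    have inj: "inj_on f ?Z"
      using f by (simp add: Bij_def bij_betw_def)
    have "homeomorphic_map X X g"
      using g homeomorphic_maps_sym homeomorphic_map_maps by blast
    then have "homeomorphic_map X X (restrict (inv_into ?Z f) ?Z)"
    proof (rule homeomorphic_map_eq)
      fix x assume x: "x \<in> ?Z"
      then have "g x \<in> ?Z" "f (g x) = x"
        using g unfolding homeomorphic_maps_def continuous_map_def by blast+
      then have "inv_into ?Z f x = g x"
        using inv_into_f_eq[OF inj] by simp
      then show "g x = restrict (inv_into ?Z f) ?Z x"
        using x by simp
    qed
    then show "inv\<^bsub>BijGroup ?Z\<^esub> f \<in> ?H"
      using f by (simp add: inv_BijGroup restrict_inv_into_Bij)
  next
    fix f g assume f: "f \<in> ?H" and g: "g \<in> ?H"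
    have "homeomorphic_map X X (f \<circ> g)"
      using f g homeomorphic_map_compose by blast
    then have "homeomorphic_map X X (compose ?Z f g)"
      by (rule homeomorphic_map_eq) (simp add: compose_def)
    then show "f \<otimes>\<^bsub>BijGroup ?Z\<^esub> g \<in> ?H"
      using f g by (simp add: BijGroup_def compose_Bij)
  qed
  from B.subgroup_imp_group[OF this] show ?thesis
    by (simp add: homeo_group_def)
qed

definition topological_action ::
    "('g, 'm) monoid_scheme \<Rightarrow> 'z topology \<Rightarrow> ('g \<Rightarrow> 'z \<Rightarrow> 'z) \<Rightarrow> bool"
  where "topological_action G X \<Phi> \<longleftrightarrow> group_hom G (homeo_group X) \<Phi>"

definition minimal_action ::
    "('g, 'm) monoid_scheme \<Rightarrow> 'z topology \<Rightarrow> ('g \<Rightarrow> 'z \<Rightarrow> 'z) \<Rightarrow> bool"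
  where "minimal_action G X \<Phi> \<longleftrightarrow>
    (\<forall>z\<in>topspace X. X closure_of (orbit G \<Phi> z) = topspace X)"


section \<open>Invariant measures\<close>

definition borel_of :: "'z topology \<Rightarrow> 'z measure"
  where "borel_of X = sigma (topspace X) {U. openin X U}"

definition invariant_borel_prob ::
    "('g, 'm) monoid_scheme \<Rightarrow> 'z topology \<Rightarrow> ('g \<Rightarrow> 'z \<Rightarrow> 'z) \<Rightarrow> 'z measure \<Rightarrow> bool"
  where "invariant_borel_prob G X \<Phi> \<mu> \<longleftrightarrow>
    sets \<mu> = sets (borel_of X) \<and> prob_space \<mu> \<and> (\<forall>g\<in>carrier G. distr \<mu> \<mu> (\<Phi> g) = \<mu>)"

definition ergodic_action ::
    "('g, 'm) monoid_scheme \<Rightarrow> ('g \<Rightarrow> 'z \<Rightarrow> 'z) \<Rightarrow> 'z measure \<Rightarrow> bool"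
  where "ergodic_action G \<Phi> \<mu> \<longleftrightarrow>
    (\<forall>A\<in>sets \<mu>. (\<forall>g\<in>carrier G. \<Phi> g ` A = A) \<longrightarrow> measure \<mu> A = 0 \<or> measure \<mu> A = 1)"


section \<open>Orbit equivalence\<close>

definition orbit_rel ::
    "('g, 'm) monoid_scheme \<Rightarrow> 'z set \<Rightarrow> ('g \<Rightarrow> 'z \<Rightarrow> 'z) \<Rightarrow> 'z rel"
  where "orbit_rel G Z \<Phi> = {(x, y). x \<in> Z \<and> y \<in> orbit G \<Phi> x}"

text \<open>An isomorphism of measure spaces between the measurable subsets \<open>A\<close> and \<open>B\<close>.\<close>

definition measure_iso_on ::
    "'x measure \<Rightarrow> 'x set \<Rightarrow> 'y measure \<Rightarrow> 'y set \<Rightarrow> ('x \<Rightarrow> 'y) \<Rightarrow> bool"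
  where "measure_iso_on M A N B T \<longleftrightarrow>
    bij_betw T A B \<and>
    T \<in> restrict_space M A \<rightarrow>\<^sub>M restrict_space N B \<and>
    inv_into A T \<in> restrict_space N B \<rightarrow>\<^sub>M restrict_space M A \<and>
    distr (restrict_space M A) (restrict_space N B) T = restrict_space N B"

text \<open>The triples \<open>(space M, E, M)\<close> and \<open>(space N, F, N)\<close> are orbit equivalent.  The classes are
  countable, so a single class is typically a null set, and comparing classes modulo null sets
  would be vacuous.  The null sets to be neglected are instead the complements of the domain
  \<open>A\<close> and of the range \<open>B\<close> of the isomorphism \<open>T\<close>: classes are compared exactly after
  intersecting them with \<open>A\<close> and \<open>B\<close>.\<close>

definition orbit_equivalent ::
    "'x measure \<Rightarrow> 'x rel \<Rightarrow> 'y measure \<Rightarrow> 'y rel \<Rightarrow> bool"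
  where "orbit_equivalent M E N F \<longleftrightarrow>
    (\<exists>A B T. A \<in> sets M \<and> space M - A \<in> null_sets M \<and>
             B \<in> sets N \<and> space N - B \<in> null_sets N \<and>
             measure_iso_on M A N B T \<and>
             (AE z in M. z \<in> A \<longrightarrow> T ` (E `` {z} \<inter> A) = F `` {T z} \<inter> B))"

end

theory Submission
  imports Defs
begin

text \<open>
  Orbit equivalence preserves hyperfiniteness, so it suffices to put on one minimal system an ergodic
  measure whose orbit relation is hyperfinite and another one for which the group acts freely almost
  everywhere.

  The space is the path space of a Bratteli diagram with two vertices, called types, on every level:
  from level \<open>j\<close> to the next there are \<open>k j\<close> edges that keep the type and a single edge, called a
  switch, that changes it. Because \<open>k j\<close> grows exponentially, a path that chooses its edges uniformly
  and independently switches only finitely often. So tail equivalence of paths carries exactly two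
  ergodic measures, one for each type on which the path may settle, while the presence of switches on
  every level makes each tail class dense. The difference between the two types is introduced by the
  action. The \<open>k j\<close> ordinary edges are identified with a finite quotient of the group, and the
  generators act by left multiplication on those edges that issue from a vertex of type \<open>True\<close>; edges
  at type \<open>False\<close> are left alone. A path settling on \<open>True\<close> sees infinitely many left
  multiplications, which makes the action free there because the quotients separate the elements of
  the group. For a path settling on \<open>False\<close> an orbit is contained in a tail class.

  So far prefixes are hardly mixed. To obtain dense orbits, an additional root coordinate is moved
  along a path graph by two of the generators, and the fourth generator is spinal: it looks for the
  first nonzero coordinate after the initial type and uses the value there as an instruction for
  changing at most two coordinates next to it, without affecting the type afterwards; only beyond them
  it acts by left multiplication. Instructions move a switch to an earlier level, or multiply an
  ordinary edge by a generator from the right. Right multiplications commute with the left multiplications, and this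
  makes it possible to argue by induction on the level that all prefixes ending at the same vertex
  are connected by group elements acting uniformly on cylinders (\<open>reach_ray_point\<close>). The result gives
  minimality (\<open>act_dense\<close>), and together with the fact that the measure of a cylinder depends only on
  its level and final type it gives invariance (\<open>gen_preserves\<close>) and ergodicity (\<open>gen_ergodic\<close>) of
  both measures.

  Finally, suppose a measure isomorphism took the orbits of the free system into orbits of the other
  one. It would be an orbitwise injective map of the free system into tail equivalence on sequences,
  an increasing union of relations with a measurable well-ordering of the classes. Within each of these
  relations the Schreier graph, a tree of degree 4, can be directed towards a measurable root, so at
  most one edge per vertex, hence an average degree of at most 2, can stay within classes; but in the
  limit all four edges do (\<open>no_tail_embedding\<close>).
\<close>

section \<open>Finite quotients of the free product\<close>

definition reduced_ball :: "nat \<Rightarrow> nat list set"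
  where "reduced_ball r = {u. distinct_adj u \<and> length u \<le> r \<and> set u \<subseteq> {..<4}}"

text \<open>
  The ball of radius \<open>r\<close> in the Cayley tree of the free product, with each generator acting by
  left multiplication wherever the result stays in the ball and trivially elsewhere.
\<close>

definition push :: "nat \<Rightarrow> nat \<Rightarrow> nat list \<Rightarrow> nat list"
  where "push r s u =
    (if u \<in> reduced_ball r \<and> s < 4
     then if u \<noteq> [] \<and> hd u = s then tl u else if length u < r then s # u else u
     else u)"

lemma push_invol: "push r s (push r s u) = u"
proof (cases u)
  case Nil
  then show ?thesis by (auto simp: push_def reduced_ball_def)
next
  case (Cons a v)
  then show ?thesis
    by (cases v) (auto simp: push_def reduced_ball_def distinct_adj_Cons)
qed

lemma push_in_ball: "u \<in> reduced_ball r \<Longrightarrow> push r s u \<in> reduced_ball r"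
  by (cases u; cases "tl u") (auto simp: push_def reduced_ball_def distinct_adj_Cons)

lemma finite_reduced_ball: "finite (reduced_ball r)"
proof (rule finite_subset)
  show "reduced_ball r \<subseteq> {u. set u \<subseteq> {..<4} \<and> length u \<le> r}"
    by (auto simp: reduced_ball_def)
qed (rule finite_lists_length_le, simp)

lemma push_permutes: "push r s permutes reduced_ball r"
proof (rule bij_imp_permutes)
  show "bij_betw (push r s) (reduced_ball r) (reduced_ball r)"
    by (rule bij_betw_byWitness[where f' = "push r s"]) (auto simp: push_invol push_in_ball)
qed (auto simp: push_def)

lemma fold_push_permutes: "fold (push r) w permutes reduced_ball r"
  proof (induction w)
  case (Cons s w)
  show ?case
    using permutes_compose[OF push_permutes Cons.IH] by (simp add: comp_def)
qed (simp add: permutes_def)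

text \<open>
  A reduced word, started at the centre, never meets the boundary of the ball and never cancels.
  So different reduced words of length at most \<open>r\<close> act differently.
\<close>

lemma fold_push_Nil:
  assumes "distinct_adj w" "set w \<subseteq> {..<4}" "length w \<le> r"
  shows "fold (push r) w [] = rev w"
  using assms
proof (induction w rule: rev_induct)
  case (snoc s w)
  have 1: "rev w \<in> reduced_ball r"
    using snoc.prems by (auto simp: reduced_ball_def distinct_adj_append_iff)
  have "rev w \<noteq> [] \<Longrightarrow> hd (rev w) \<noteq> s"
    using snoc.prems by (auto simp: hd_rev distinct_adj_append_iff)
  then show ?case
    using snoc 1 by (auto simp: push_def distinct_adj_append_iff)
qed simp

lemma fold_invol_rev:
  assumes "\<And>s y. f s (f s y) = y"
  shows "fold f (rev w) (fold f w x) = x" "fold f w (fold f (rev w) x) = x"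
  using assms by (induction w arbitrary: x) auto

text \<open>
  The finite group of permutations generated by the four involutions of a ball, its elements numbered by
  \<open>{..<k}\<close> with the identity as \<open>0\<close>. \<open>L\<close> and \<open>R\<close> are the left and the right multiplications by the
  generators. Left multiplication by a nontrivial element has no fixed point, which turns the
  nontriviality of short reduced words into freeness.
\<close>

lemma ex_finite_quotient:
  "\<exists>(k :: nat) (L :: nat \<Rightarrow> nat \<Rightarrow> nat) (R :: nat \<Rightarrow> nat \<Rightarrow> nat). r < k \<and>
     (\<forall>s v. L s (L s v) = v \<and> R s (R s v) = v) \<and>
     (\<forall>s v. k \<le> v \<longrightarrow> L s v = v \<and> R s v = v) \<and>
     (\<forall>s s' v. L s (R s' v) = R s' (L s v)) \<and>
     (\<forall>v<k. \<exists>w. set w \<subseteq> {..<4} \<and> fold R w 0 = v) \<and>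
     (\<forall>w. distinct_adj w \<longrightarrow> set w \<subseteq> {..<4} \<longrightarrow> w \<noteq> [] \<longrightarrow> length w \<le> r \<longrightarrow>
        (\<forall>v<k. fold L w v \<noteq> v))"
  for r :: nat
proof -
  let ?p = "push r"
  define Q where "Q = {fold ?p w | w. set w \<subseteq> {..<4}}"
  define k where "k = card Q"
  have Q_perm: "q permutes reduced_ball r" if "q \<in> Q" for q
    using that fold_push_permutes by (auto simp: Q_def)
  have finQ: "finite Q"
    by (rule finite_subset[OF _ finite_permutations[OF finite_reduced_ball[of r]]]) (auto dest: Q_perm)
  have idQ: "id \<in> Q"
    unfolding Q_def by (intro CollectI exI[of _ "[]"]) auto
  have ge4: "?p s = id" if "\<not> s < 4" for s
    using that by (auto simp: push_def)
  have QL: "?p s \<circ> q \<in> Q" if qQ: "q \<in> Q" for s q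
  proof -
    obtain w where w: "set w \<subseteq> {..<4}" "q = fold ?p w"
      using qQ by (auto simp: Q_def)
    show ?thesis
    proof (cases "s < 4")
      case True
      have "?p s \<circ> q = fold ?p (w @ [s])"
        by (auto simp: w)
      then show ?thesis using w True unfolding Q_def by (intro CollectI exI[of _ "w @ [s]"]) auto
    qed (use that ge4 in simp)
  qed
  have QR: "q \<circ> ?p s \<in> Q" if qQ: "q \<in> Q" for s q
  proof -
    obtain w where w: "set w \<subseteq> {..<4}" "q = fold ?p w"
      using qQ by (auto simp: Q_def)
    show ?thesis
    proof (cases "s < 4")
      case True
      have "q \<circ> ?p s = fold ?p (s # w)"
        by (auto simp: w)
      then show ?thesis using w True unfolding Q_def by (intro CollectI exI[of _ "s # w"]) auto
    qed (use that ge4 in simp)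
  qed
  obtain e0 where e0: "bij_betw e0 Q {0..<k}"
    using ex_bij_betw_finite_nat[OF finQ] k_def by auto
  have k0: "0 < k"
    using idQ finQ by (auto simp: k_def card_gt_0_iff)
  \<comment> \<open>Number the group elements so that the identity becomes 0.\<close>
  define e where "e = Transposition.transpose 0 (e0 id) \<circ> e0"
  have "e0 id \<in> {0..<k}"
    using e0 idQ by (auto simp: bij_betw_def)
  then have e: "bij_betw e Q {0..<k}"
    unfolding e_def by (intro bij_betw_trans[OF e0]) (simp add: k0)
  have e_id: "e id = 0"
    by (simp add: e_def)
  define c where "c = inv_into Q e"
  have ec: "e (c v) = v" "c v \<in> Q" if "v < k" for v
    using e that by (auto simp: c_def bij_betw_inv_into_right bij_betw_def f_inv_into_f inv_into_into)
  have ce: "c (e q) = q" "e q < k" if "q \<in> Q" for q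
    using e that by (auto simp: c_def bij_betw_inv_into_left bij_betw_def)
  define L where "L s v = (if v < k then e (?p s \<circ> c v) else v)" for s v
  define R where "R s v = (if v < k then e (c v \<circ> ?p s) else v)" for s v
  have pp: "?p s \<circ> (?p s \<circ> q) = q" "(q \<circ> ?p s) \<circ> ?p s = q" for s q
    by (auto simp: push_invol fun_eq_iff)
  have foldL: "fold L w (e q) = e (fold ?p w \<circ> q) \<and> fold ?p w \<circ> q \<in> Q" if "q \<in> Q" for w q
    using that
  proof (induction w arbitrary: q)
    case (Cons s w)
    show ?case using Cons.IH[OF QL[OF Cons.prems, of s]] Cons.prems
      by (simp add: L_def ce comp_def)
  qed simp
  have foldR: "fold R w (e q) = e (q \<circ> fold ?p (rev w))" if "q \<in> Q" for w q
    using that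
  proof (induction w arbitrary: q)
    case (Cons s w)
    show ?case using Cons.IH[OF QR[OF Cons.prems, of s]] Cons.prems
      by (simp add: R_def ce comp_def)
  qed simp
  have trans: "\<exists>w. set w \<subseteq> {..<4} \<and> fold R w 0 = v" if v: "v < k" for v
  proof -
    obtain w where w: "set w \<subseteq> {..<4}" "c v = fold ?p w"
      using ec(2)[OF v] by (auto simp: Q_def)
    have "fold R (rev w) (e id) = v"
      using foldR[OF idQ, of "rev w"] w ec(1)[OF v] by simp
    then show ?thesis using w e_id by (intro exI[of _ "rev w"]) auto
  qed
  have free: "fold L w v \<noteq> v"
    if w: "distinct_adj w" "set w \<subseteq> {..<4}" "w \<noteq> []" "length w \<le> r" and v: "v < k" for w v
  proof
    assume "fold L w v = v"
    then have "e (fold ?p w \<circ> c v) = e (c v)"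
      using foldL[OF ec(2)[OF v], of w] ec(1)[OF v] by simp
    then have "fold ?p w \<circ> c v = c v"
      by (metis ce(1) foldL[OF ec(2)[OF v]] ec(2)[OF v])
    moreover have "surj (c v)"
      using Q_perm[OF ec(2)[OF v]] permutes_surj by blast
    ultimately have "fold ?p w [] = []"
      by (metis comp_apply surjD)
    then show False
      using fold_push_Nil[OF w(1,2,4)] w(3) by simp
  qed
  have "r < k"
  proof -
    \<comment> \<open>Alternating words of all lengths up to r already give r + 1 different elements.\<close>
    define alt where "alt n = map (\<lambda>i. i mod 2) [0..<n]" for n :: nat
    have "distinct_adj (alt n)" for n
      by (auto simp: distinct_adj_conv_nth alt_def) presburger
    moreover have set_alt: "set (alt n) \<subseteq> {..<4}" for n
      by (auto simp: alt_def)
    ultimately have alt: "fold ?p (alt n) [] = rev (alt n)" if "n \<le> r" for n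
      using fold_push_Nil[of "alt n" r] that by (auto simp: alt_def)
    have "inj_on (\<lambda>n. fold ?p (alt n)) {..r}"
    proof (rule inj_onI)
      fix m n assume "m \<in> {..r}" "n \<in> {..r}" "fold ?p (alt m) = fold ?p (alt n)"
      then have "length (rev (alt m)) = length (rev (alt n))"
        using alt by (metis atMost_iff)
      then show "m = n" by (simp add: alt_def)
    qed
    moreover have "(\<lambda>n. fold ?p (alt n)) ` {..r} \<subseteq> Q"
    proof (rule image_subsetI)
      fix n
      show "fold ?p (alt n) \<in> Q"
        unfolding Q_def by (rule CollectI, rule exI[of _ "alt n"]) (simp add: set_alt)
    qed
    ultimately have "card {..r} \<le> k"
      unfolding k_def by (rule card_inj_on_le[OF _ _ finQ])
    then show ?thesis by simp
  qed
  moreover have "\<forall>s v. L s (L s v) = v \<and> R s (R s v) = v"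
    by (auto simp: L_def R_def ce QL QR ec pp)
  moreover have "\<forall>s v. k \<le> v \<longrightarrow> L s v = v \<and> R s v = v"
    by (auto simp: L_def R_def)
  moreover have "\<forall>s s' v. L s (R s' v) = R s' (L s v)"
    by (auto simp: L_def R_def ce QL QR ec o_assoc)
  ultimately show ?thesis
    using trans free by (intro exI[of _ k] exI[of _ L] exI[of _ R] conjI) simp_all
qed

section \<open>Paths with two types and the four involutions\<close>

text \<open>
  The multiplications are indexed by the level \<open>j\<close>; the value \<open>k j\<close>, which they fix, encodes the
  switch. Level 0 holds the initial type and level 1 the root coordinate, with seven values; neither
  admits a switch, so the values of \<open>k\<close> at these levels are bounds that are never attained.
\<close>

locale switching_system =
  fixes k :: "nat \<Rightarrow> nat" and L R :: "nat \<Rightarrow> nat \<Rightarrow> nat \<Rightarrow> nat"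
  assumes k0: "k 0 = 2" and k1: "k 1 = 7"
    and k_large: "2 \<le> j \<Longrightarrow> 2 ^ j + 7 \<le> k j"
    and L_invol: "L j s (L j s v) = v" and R_invol: "R j s (R j s v) = v"
    and L_outside: "k j \<le> v \<Longrightarrow> L j s v = v" and R_outside: "k j \<le> v \<Longrightarrow> R j s v = v"
    and LR_commute: "L j s (R j s' v) = R j s' (L j s v)"
    and R_transitive: "2 \<le> j \<Longrightarrow> v < k j \<Longrightarrow> \<exists>w. set w \<subseteq> {..<4} \<and> fold (R j) w 0 = v"
    and L_free: "2 \<le> j \<Longrightarrow> distinct_adj w \<Longrightarrow> set w \<subseteq> {..<4} \<Longrightarrow> w \<noteq> [] \<Longrightarrow> length w \<le> j \<Longrightarrow> v < k j
      \<Longrightarrow> fold (L j) w v \<noteq> v"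
begin

lemma k_ge7: "1 \<le> j \<Longrightarrow> 7 \<le> k j"
  using k1 k_large[of j] by (cases "j = 1") auto

lemma k_pos [simp]: "0 < k j"
  using k0 k1 k_large[of j] by (cases "j = 0"; cases "j = 1") auto

lemma k_Suc_0 [simp]: "k (Suc 0) = 7"
  using k1 by simp

lemma k_neq0 [simp]: "k j \<noteq> 0" "0 \<noteq> k j"
  using k_pos[of j] by linarith+

lemma L_less [simp]: "L j s v < k j \<longleftrightarrow> v < k j"
  by (metis L_invol L_outside not_le)

lemma R_less [simp]: "R j s v < k j \<longleftrightarrow> v < k j"
  by (metis R_invol R_outside not_le)

lemma L_switch [simp]: "L j s v = k j \<longleftrightarrow> v = k j"
  by (metis L_invol L_outside le_refl)

lemma R_switch [simp]: "R j s v = k j \<longleftrightarrow> v = k j"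
  by (metis R_invol R_outside le_refl)

lemma fold_L_less [simp]: "fold (L j) w v < k j \<longleftrightarrow> v < k j"
  by (induction w arbitrary: v) auto

lemma fold_L_switch [simp]: "fold (L j) w v = k j \<longleftrightarrow> v = k j"
  by (induction w arbitrary: v) auto

lemma fold_L_R: "fold (L j) w (R j s v) = R j s (fold (L j) w v)"
  by (induction w arbitrary: v) (auto simp: LR_commute)

text \<open>
  The type of the vertex at which the edge \<open>x j\<close> begins.
\<close>

primrec ptype :: "(nat \<Rightarrow> nat) \<Rightarrow> nat \<Rightarrow> bool"
  where "ptype x 0 = (x 0 = 0)"
  | "ptype x (Suc j) = (ptype x j \<noteq> (x j = k j))"

definition agree :: "nat \<Rightarrow> (nat \<Rightarrow> nat) \<Rightarrow> (nat \<Rightarrow> nat) \<Rightarrow> bool"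
  where "agree N x y \<longleftrightarrow> (\<forall>j<N. x j = y j)"

definition admissible :: "nat \<Rightarrow> nat \<Rightarrow> bool"
  where "admissible j v \<longleftrightarrow> (if j < 2 then v < k j else v \<le> k j)"

definition paths :: "(nat \<Rightarrow> nat) set"
  where "paths = {x. \<forall>j. admissible j (x j)}"

text \<open>
  The sequences on which the spinal generator finds no instruction. Two of them are paths, one for each
  initial type.
\<close>

definition ray :: "(nat \<Rightarrow> nat) \<Rightarrow> bool"
  where "ray x \<longleftrightarrow> (\<forall>j\<ge>1. x j = 0)"

definition control :: "(nat \<Rightarrow> nat) \<Rightarrow> nat"
  where "control x = (LEAST j. 1 \<le> j \<and> x j \<noteq> 0)"

text \<open>
  The path graph \<open>0 - 1 - \<dots> - 6\<close> with edges alternately coloured by the generators 0 and 1.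
\<close>

definition root_move :: "nat \<Rightarrow> nat \<Rightarrow> nat"
  where "root_move s v =
    (if s < 2 \<and> v < 7 then
       if even (v + s) then (if v < 6 then Suc v else v) else v - 1
     else v)"

text \<open>
  The instruction given by the value at the control position \<open>m\<close>. The values 1 to 4 stand for
  right multiplication by a generator on the next coordinate; 5 exchanges a switch with a
  neighbouring \<open>0\<close>; 6, available at the root only, exchanges a switch on level 2 with a change of the
  initial type. All of them preserve the type from level \<open>m + 3\<close> on.
\<close>

definition local_move :: "nat \<Rightarrow> (nat \<Rightarrow> nat) \<Rightarrow> nat \<Rightarrow> nat"
  where "local_move m x =
    (let c = x m in
     if 1 \<le> c \<and> c \<le> 4 then x(Suc m := R (Suc m) (c - 1) (x (Suc m)))
     else if c = 5 then
       (if x (Suc m) = 0 \<and> x (m + 2) = k (m + 2) then x(Suc m := k (Suc m), m + 2 := 0)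
        else if x (Suc m) = k (Suc m) \<and> x (m + 2) = 0 then x(Suc m := 0, m + 2 := k (m + 2))
        else x)
     else if c = 6 \<and> m = 1 \<and> x 0 \<le> 1 then
       (if x 2 = 0 then x(0 := 1 - x 0, 2 := k 2)
        else if x 2 = k 2 then x(0 := 1 - x 0, 2 := 0)
        else x)
     else x)"

text \<open>
  Beyond the coordinates involved in its instruction the spinal generator acts by left
  multiplication like the other three. Without that it would act trivially far out, and words
  containing it could not be seen to act freely.
\<close>

definition gen :: "nat \<Rightarrow> (nat \<Rightarrow> nat) \<Rightarrow> nat \<Rightarrow> nat"
  where "gen s x =
    (if s < 3 then
       (\<lambda>j. if j = 0 then x 0 else if j = 1 then root_move s (x 1)
            else if ptype x j then L j s (x j) else x j)
     else if ray x then x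
     else (\<lambda>j. if control x + 3 \<le> j then (if ptype x j then L j s (x j) else x j) else local_move (control x) x j))"

definition act :: "nat list \<Rightarrow> (nat \<Rightarrow> nat) \<Rightarrow> nat \<Rightarrow> nat"
  where "act = fold gen"

lemma ptype_agree: "agree N x y \<Longrightarrow> 1 \<le> N \<Longrightarrow> j \<le> N \<Longrightarrow> ptype x j = ptype y j"
  by (induction j) (auto simp: agree_def)

lemma ptype_cong:
  assumes "M \<le> j" "ptype x M = ptype y M" "\<And>i. M \<le> i \<Longrightarrow> i < j \<Longrightarrow> x i = k i \<longleftrightarrow> y i = k i"
  shows "ptype x j = ptype y j"
  using assms by (induction j rule: dec_induct) auto

lemma agree_refl [simp]: "agree N x x"
  by (simp add: agree_def)

lemma agree_trans: "agree N x y \<Longrightarrow> agree N y z \<Longrightarrow> agree N x z"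
  by (simp add: agree_def)

lemma agree_mono: "agree N x y \<Longrightarrow> M \<le> N \<Longrightarrow> agree M x y"
  by (simp add: agree_def)

lemma root_move_invol: "root_move s (root_move s v) = v"
proof -
  consider "s = 0 \<and> v < 7" | "s = 1 \<and> v < 7" | "\<not> (s < 2 \<and> v < 7)" by linarith
  then show ?thesis
  proof cases
    case 1
    then have "v = 0 \<or> v = 1 \<or> v = 2 \<or> v = 3 \<or> v = 4 \<or> v = 5 \<or> v = 6" by linarith
    with 1 show ?thesis by (elim disjE) (auto simp: root_move_def)
  next
    case 2
    then have "v = 0 \<or> v = 1 \<or> v = 2 \<or> v = 3 \<or> v = 4 \<or> v = 5 \<or> v = 6" by linarith
    with 2 show ?thesis by (elim disjE) (auto simp: root_move_def)
  next
    case 3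
    then have "root_move s v = v"
      unfolding root_move_def by (simp only: if_False)
    then show ?thesis by simp
  qed
qed

lemma root_move_less [simp]: "root_move s v < 7 \<longleftrightarrow> v < 7"
  by (auto simp: root_move_def)

lemma root_move_eq7 [simp]: "root_move s v = 7 \<longleftrightarrow> v = 7"
  by (auto simp: root_move_def)

lemma gen_rot_switch:
  assumes "s < 3"
  shows "gen s x j = k j \<longleftrightarrow> x j = k j"
  using assms by (auto simp: gen_def k1)

lemma ptype_gen_rot:
  assumes "s < 3"
  shows "ptype (gen s x) j = ptype x j"
proof (rule ptype_cong[of 0])
  show "ptype (gen s x) 0 = ptype x 0"
    using assms by (simp add: gen_def)
qed (use assms gen_rot_switch in auto)

lemma gen_rot_invol:
  assumes "s < 3"
  shows "gen s (gen s x) = x"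
proof
  fix j
  show "gen s (gen s x) j = x j"
    using assms ptype_gen_rot[OF assms, of x j]
    by (subst gen_def) (auto simp: gen_def root_move_invol L_invol)
qed

lemma control:
  assumes "\<not> ray x"
  shows "1 \<le> control x" "x (control x) \<noteq> 0" "\<And>j. 1 \<le> j \<Longrightarrow> j < control x \<Longrightarrow> x j = 0"
proof -
  obtain j where "1 \<le> j \<and> x j \<noteq> 0"
    using assms by (auto simp: ray_def)
  then have "1 \<le> control x \<and> x (control x) \<noteq> 0"
    unfolding control_def by (rule LeastI)
  then show "1 \<le> control x" "x (control x) \<noteq> 0" by auto
  show "x j = 0" if "1 \<le> j" "j < control x" for j
    using not_less_Least[of j "\<lambda>j. 1 \<le> j \<and> x j \<noteq> 0"] that by (auto simp: control_def)
qed

lemma control_eqI: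
  assumes "1 \<le> m" "x m \<noteq> 0" "\<And>j. 1 \<le> j \<Longrightarrow> j < m \<Longrightarrow> x j = 0"
  shows "control x = m" "\<not> ray x"
proof -
  show "control x = m"
    unfolding control_def
  proof (rule Least_equality)
    show "m \<le> j" if "1 \<le> j \<and> x j \<noteq> 0" for j
      using assms(3)[of j] that by (cases "j < m") auto
  qed (use assms in auto)
  show "\<not> ray x"
    using assms by (auto simp: ray_def)
qed

lemma local_move_other: "1 \<le> m \<Longrightarrow> 1 \<le> j \<Longrightarrow> j \<le> m \<or> m + 3 \<le> j \<Longrightarrow> local_move m x j = x j"
  by (auto simp: local_move_def Let_def)

lemma local_move_0: "m \<noteq> 1 \<Longrightarrow> local_move m x 0 = x 0"
  by (auto simp: local_move_def Let_def)

text \<open>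
  An instruction reads and changes only coordinates below \<open>m + 3\<close>.
\<close>

lemma local_move_cong:
  assumes "1 \<le> m" "agree (m + 3) x y" "j < m + 3"
  shows "local_move m x j = local_move m y j"
proof -
  have eq: "x i = y i" if "i < m + 3" for i
    using assms that by (auto simp: agree_def)
  have app: "(if b then f else g) j = (if b then f j else g j)" for b and f g :: "nat \<Rightarrow> nat"
    by simp
  show ?thesis
  proof (cases "m = 1")
    case True
    have "x j = y j" "x 0 = y 0" "x 1 = y 1" "x (Suc 1) = y (Suc 1)" "x (1 + 2) = y (1 + 2)" "x 2 = y 2"
      using True assms(3) by (auto intro!: eq)
    then show ?thesis
      unfolding local_move_def Let_def True fun_upd_def app by (simp only:)
  next
    case False
    have "x j = y j" "x m = y m" "x (Suc m) = y (Suc m)" "x (m + 2) = y (m + 2)"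
      using assms(3) by (auto intro!: eq)
    then show ?thesis
      unfolding local_move_def Let_def fun_upd_def app by (simp only: False simp_thms if_False)
  qed
qed

lemma local_move_5:
  assumes "x m = 5"
  shows "local_move m x =
    (if x (Suc m) = 0 \<and> x (m + 2) = k (m + 2) then x(Suc m := k (Suc m), m + 2 := 0)
     else if x (Suc m) = k (Suc m) \<and> x (m + 2) = 0 then x(Suc m := 0, m + 2 := k (m + 2))
     else x)"
  unfolding local_move_def Let_def assms by simp

lemma local_move_invol:
  assumes "1 \<le> m"
  shows "local_move m (local_move m x) = x"
proof -
  have m: "m \<noteq> 0" "m \<noteq> Suc m" "m + 2 \<noteq> 0" "m + 2 \<noteq> Suc m" "m \<noteq> m + 2" using assms by auto
  consider "1 \<le> x m \<and> x m \<le> 4" | "x m = 5" | "x m = 6" "m = 1" "x 0 = 0" | "x m = 6" "m = 1" "x 0 = 1"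
    | "\<not> (1 \<le> x m \<and> x m \<le> 4)" "x m \<noteq> 5" "\<not> (x m = 6 \<and> m = 1 \<and> x 0 \<le> 1)"
    by (cases "x 0 \<le> 1") linarith+
  then show ?thesis
  proof cases
    case 1
    then show ?thesis by (auto simp: local_move_def Let_def R_invol fun_eq_iff)
  next
    case 2
    consider "x (Suc m) = 0" "x (m + 2) = k (m + 2)" | "x (Suc m) = k (Suc m)" "x (m + 2) = 0"
      | "local_move m x = x"
      using local_move_5[of x m] 2 by presburger
    then show ?thesis
    proof cases
      case 1
      then have "local_move m x = x(Suc m := k (Suc m), m + 2 := 0)"
        using 2 by (simp add: local_move_def)
      then show ?thesis using 1 2 m by (simp add: local_move_def fun_eq_iff)
    next
      case 2
      then have "local_move m x = x(Suc m := 0, m + 2 := k (m + 2))"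
        using \<open>x m = 5\<close> by (simp add: local_move_def)
      then show ?thesis using 2 \<open>x m = 5\<close> m by (simp add: local_move_def fun_eq_iff)
    qed simp
  next
    case 3
    then show ?thesis by (auto simp: local_move_def Let_def fun_eq_iff)
  next
    case 4
    then show ?thesis by (auto simp: local_move_def Let_def fun_eq_iff)
  next
    case 5
    then have "local_move m x = x"
      unfolding local_move_def Let_def by (simp only: if_False)
    then show ?thesis by simp
  qed
qed

lemma ptype_local_move:
  assumes "1 \<le> m"
  shows "ptype (local_move m x) (m + 3) = ptype x (m + 3)"
proof -
  have 3: "m + 3 = Suc (Suc (Suc m))" by simp
  consider "1 \<le> x m \<and> x m \<le> 4" | "x m = 5" | "x m = 6" "m = 1" "x 0 = 0" | "x m = 6" "m = 1" "x 0 = 1"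
    | "\<not> (1 \<le> x m \<and> x m \<le> 4)" "x m \<noteq> 5" "\<not> (x m = 6 \<and> m = 1 \<and> x 0 \<le> 1)"
    by (cases "x 0 \<le> 1") linarith+
  then show ?thesis
  proof cases
    case 1
    have "ptype (local_move m x) 0 = ptype x 0"
      using 1 by (auto simp: local_move_def Let_def)
    then show ?thesis
      by (rule ptype_cong[rotated]) (use 1 in \<open>auto simp: local_move_def Let_def\<close>)
  next
    case 2
    have "ptype (local_move m x) m = ptype x m"
      by (rule ptype_agree[of m]) (use assms 2 in \<open>auto simp: local_move_def Let_def agree_def\<close>)
    then show ?thesis
      using 2 unfolding 3 ptype.simps by (cases "x (Suc m) = 0"; cases "x (Suc (Suc m)) = 0") (simp_all add: local_move_def)
  next
    case 3
    then show ?thesis by (auto simp: local_move_def Let_def numeral_eq_Suc k1 k0)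
  next
    case 4
    then show ?thesis by (auto simp: local_move_def Let_def numeral_eq_Suc k1 k0)
  next
    case 5
    then have "local_move m x = x"
      unfolding local_move_def Let_def by (simp only: if_False)
    then show ?thesis by simp
  qed
qed

lemma gen_spinal_ray: "\<not> s < 3 \<Longrightarrow> ray x \<Longrightarrow> gen s x = x"
  by (simp add: gen_def)

lemma gen_spinal:
  assumes "\<not> s < 3" "\<not> ray x"
  shows "j < control x + 3 \<Longrightarrow> gen s x j = local_move (control x) x j"
    "control x + 3 \<le> j \<Longrightarrow> gen s x j = (if ptype x j then L j s (x j) else x j)"
    "1 \<le> j \<Longrightarrow> j \<le> control x \<Longrightarrow> gen s x j = x j"
  using assms local_move_other[OF control(1)[OF assms(2)]] by (auto simp: gen_def)

lemma control_gen_spinal: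
  assumes "\<not> s < 3" "\<not> ray x"
  shows "control (gen s x) = control x" "\<not> ray (gen s x)"
proof -
  have "1 \<le> control x" "gen s x (control x) \<noteq> 0" "\<And>j. 1 \<le> j \<Longrightarrow> j < control x \<Longrightarrow> gen s x j = 0"
    using control[OF assms(2)] gen_spinal(3)[OF assms] by auto
  from control_eqI[of "control x" "gen s x", OF this] show "control (gen s x) = control x" "\<not> ray (gen s x)" by auto
qed

lemma ptype_gen_spinal:
  assumes "\<not> s < 3" "\<not> ray x" "control x + 3 \<le> j"
  shows "ptype (gen s x) j = ptype x j"
proof (rule ptype_cong[OF assms(3)])
  have "ptype (gen s x) (control x + 3) = ptype (local_move (control x) x) (control x + 3)"
    by (rule ptype_agree[of "control x + 3"]) (use gen_spinal[OF assms(1,2)] in \<open>auto simp: agree_def\<close>)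
  then show "ptype (gen s x) (control x + 3) = ptype x (control x + 3)"
    using ptype_local_move control(1)[OF assms(2)] by simp
next
  fix i assume "control x + 3 \<le> i"
  then show "gen s x i = k i \<longleftrightarrow> x i = k i"
    using gen_spinal[OF assms(1,2)] by auto
qed

lemma gen_invol: "gen s (gen s x) = x"
proof (cases "s < 3")
  case s: False
  show ?thesis
  proof (cases "ray x")
    case False
    let ?y = "gen s x" and ?m = "control x"
    note g = gen_spinal[OF s False] and c = control_gen_spinal[OF s False]
    note g' = gen_spinal[OF s c(2), unfolded c(1)]
    show ?thesis
    proof
      fix j
      show "gen s ?y j = x j"
      proof (cases "j < ?m + 3")
        case True
        have "gen s ?y j = local_move ?m ?y j"
          using g'(1) True by simp
        also have "\<dots> = local_move ?m (local_move ?m x) j"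
          by (rule local_move_cong) (use control(1)[OF False] True g(1) in \<open>auto simp: agree_def\<close>)
        also have "\<dots> = x j"
          using local_move_invol control(1)[OF False] by simp
        finally show ?thesis .
      next
        case j: False
        then show ?thesis
          using g'(2) g(2) ptype_gen_spinal[OF s False] by (auto simp: L_invol)
      qed
    qed
  qed (use s in \<open>simp add: gen_spinal_ray\<close>)
qed (rule gen_rot_invol)

lemma admissible_zero [simp]: "admissible j 0"
  by (simp add: admissible_def)

lemma admissible_switch [simp]: "admissible j (k j) \<longleftrightarrow> 2 \<le> j"
  by (simp add: admissible_def)

lemma admissible_local_move:
  assumes "1 \<le> m" "admissible j (x j)"
  shows "admissible j (local_move m x j)"
proof -
  consider "1 \<le> x m \<and> x m \<le> 4" | "x m = 5" | "x m = 6" "m = 1" "x 0 = 0" | "x m = 6" "m = 1" "x 0 = 1"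
    | "\<not> (1 \<le> x m \<and> x m \<le> 4)" "x m \<noteq> 5" "\<not> (x m = 6 \<and> m = 1 \<and> x 0 \<le> 1)"
    by (cases "x 0 \<le> 1") linarith+
  then show ?thesis
  proof cases
    case 1
    then have "local_move m x = x(Suc m := R (Suc m) (x m - 1) (x (Suc m)))"
      by (simp add: local_move_def)
    moreover have "admissible j (R j s v) \<longleftrightarrow> admissible j v" for s v
      by (simp add: admissible_def le_less)
    ultimately show ?thesis using assms by (cases "j = Suc m") auto
  next
    case 2
    have "m + 2 \<noteq> 1" by simp
    with 2 show ?thesis
      using assms by (auto simp: local_move_5)
  next
    case 3
    then show ?thesis using assms by (simp add: local_move_def Let_def) (simp add: admissible_def k0)
  next
    case 4
    then show ?thesis using assms by (simp add: local_move_def Let_def)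
  next
    case 5
    then have "local_move m x = x"
      unfolding local_move_def Let_def by (simp only: if_False)
    then show ?thesis using assms by simp
  qed
qed

lemma admissible_gen: "admissible j (gen s x j) \<longleftrightarrow> admissible j (x j)"
proof -
  have imp: "admissible j (gen s x j)" if "admissible j (x j)" for x
  proof (cases "s < 3")
    case True
    then show ?thesis
      using that by (cases "j = 0"; cases "j = 1") (auto simp: gen_def admissible_def k1 le_less)
  next
    case s: False
    show ?thesis
    proof (cases "ray x \<or> control x + 3 \<le> j")
      case True
      then show ?thesis using that s
        by (auto simp: gen_def admissible_def le_less)
    next
      case False
      then have "admissible j (local_move (control x) x j)"
        using that control(1)[of x] by (intro admissible_local_move) auto
      then show ?thesis using s False by (simp add: gen_def)
    qed
  qed
  from imp[of x] imp[of "gen s x"] show ?thesis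
    by (auto simp: gen_invol)
qed

lemma act_Nil [simp]: "act [] x = x"
  and act_Cons [simp]: "act (s # w) x = act w (gen s x)"
  and act_append [simp]: "act (v @ w) x = act w (act v x)"
  by (auto simp: act_def)

lemma act_rev [simp]: "act (rev w) (act w x) = x" "act w (act (rev w) x) = x"
  unfolding act_def by (rule fold_invol_rev, rule gen_invol)+

lemma admissible_act: "admissible j (act w x j) \<longleftrightarrow> admissible j (x j)"
  by (induction w arbitrary: x) (auto simp: admissible_gen)

lemma act_paths: "act w x \<in> paths \<longleftrightarrow> x \<in> paths"
  by (auto simp: paths_def admissible_act)

text \<open>
  At every path a generator maps all sufficiently small cylinders onto cylinders with the same final
  type. For the spinal generator this includes the two rays, which it fixes together with all
  their cylinders of length at least 2.
\<close>

lemma gen_local: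
  "\<exists>N0. \<forall>N\<ge>N0. (\<forall>y. agree N y x \<longleftrightarrow> agree N (gen s y) (gen s x)) \<and> ptype (gen s x) N = ptype x N"
proof -
  have "\<exists>N0. \<forall>N\<ge>N0. (\<forall>y. agree N y x \<longrightarrow> agree N (gen s y) (gen s x)) \<and> ptype (gen s x) N = ptype x N" for x
  proof (cases "s < 3")
    case True
    have "agree N (gen s y) (gen s x)" if N: "2 \<le> N" and a: "agree N y x" for N y
      using a ptype_agree[OF a] N True by (auto simp: agree_def gen_def)
    then show ?thesis
      using ptype_gen_rot[OF True] by (intro exI[of _ 2]) auto
  next
    case s: False
    show ?thesis
    proof (cases "ray x")
      case True
      have "agree N (gen s y) x" if N: "2 \<le> N" and a: "agree N y x" for N y
      proof (cases "ray y")
        case False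
        have "N \<le> control y"
          using control(2)[OF False] control(1)[OF False] True a by (intro leI notI) (auto simp: agree_def ray_def)
        have "gen s y j = y j" if "j < N" for j
        proof (cases "j = 0")
          case True
          then show ?thesis using gen_spinal(1)[OF s False, of 0] local_move_0[of "control y" y] \<open>N \<le> control y\<close> N by simp
        next
          case j: False
          then show ?thesis using gen_spinal(3)[OF s False, of j] \<open>N \<le> control y\<close> that by simp
        qed
        then have "agree N (gen s y) y"
          by (simp add: agree_def)
        then show ?thesis using a agree_trans by blast
      qed (use a s in \<open>simp add: gen_spinal_ray\<close>)
      then show ?thesis
        using gen_spinal_ray[OF s True] by (intro exI[of _ 2]) auto
    next
      case False
      have "agree N (gen s y) (gen s x)" if N: "control x + 3 \<le> N" and a: "agree N y x" for N y
      proof -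
        have "y j = x j" if "j \<le> control x" for j
          using a N that by (auto simp: agree_def)
        then have y: "control y = control x" "\<not> ray y"
          using control_eqI[of "control x" y] control[OF False] by auto
        have "local_move (control x) y j = local_move (control x) x j" if "j < control x + 3" for j
          by (rule local_move_cong[OF control(1)[OF False] agree_mono[OF a N] that])
        moreover have "ptype y j = ptype x j" "y j = x j" if "j < N" for j
          using ptype_agree[OF a, of j] a N that by (auto simp: agree_def)
        ultimately show ?thesis
          unfolding agree_def
          using gen_spinal(1,2)[OF s False] gen_spinal(1,2)[OF s y(2)] y(1) by (metis not_less)
      qed
      then show ?thesis
        using ptype_gen_spinal[OF s False] by (intro exI[of _ "control x + 3"]) auto
    qed
  qed
  from this[of x] this[of "gen s x"] obtain M N where
    M: "\<And>K. M \<le> K \<Longrightarrow> (\<forall>y. agree K y x \<longrightarrow> agree K (gen s y) (gen s x)) \<and> ptype (gen s x) K = ptype x K" and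
    N: "\<And>K. N \<le> K \<Longrightarrow> (\<forall>y. agree K y (gen s x) \<longrightarrow> agree K (gen s y) (gen s (gen s x)))"
    by blast
  show ?thesis
  proof (intro exI[of _ "max M N"] allI impI)
    fix K assume K: "max M N \<le> K"
    have "ptype (gen s x) K = ptype x K" using M K by simp
    moreover have "agree K (gen s y) (gen s x)" if "agree K y x" for y using M K that by simp
    moreover have "agree K y x" if "agree K (gen s y) (gen s x)" for y
      using N[of K] K that by (auto simp: gen_invol dest!: spec[of _ "gen s y"])
    ultimately show "(\<forall>y. agree K y x \<longleftrightarrow> agree K (gen s y) (gen s x)) \<and> ptype (gen s x) K = ptype x K"
      by blast
  qed
qed

lemma gen_asymptotic:
  assumes "\<not> ray x"
  shows "\<exists>N. \<forall>j\<ge>N. ptype (gen s x) j = ptype x j \<and> gen s x j = (if ptype x j then L j s (x j) else x j)"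
proof (cases "s < 3")
  case True
  then show ?thesis
    by (intro exI[of _ 2]) (auto simp: ptype_gen_rot, auto simp: gen_def)
next
  case False
  then show ?thesis
    using ptype_gen_spinal[OF False assms] gen_spinal(2)[OF False assms] by (intro exI[of _ "control x + 3"]) auto
qed

text \<open>
  Far out, each spinal generator in a word has already passed its control position, so the word acts
  by its image in the finite quotients, at the levels of type \<open>True\<close> only.
\<close>

lemma act_asymptotic:
  assumes "\<And>v. set v \<subseteq> {..<4} \<Longrightarrow> \<not> ray (act v x)" "set w \<subseteq> {..<4}"
  shows "\<exists>N. \<forall>j\<ge>N. ptype (act w x) j = ptype x j \<and> act w x j = (if ptype x j then fold (L j) w (x j) else x j)"
  using assms(2)
proof (induction w rule: rev_induct)
  case (snoc s w)
  then obtain N where N: "\<And>j. N \<le> j \<Longrightarrow> ptype (act w x) j = ptype x j \<and>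
      act w x j = (if ptype x j then fold (L j) w (x j) else x j)"
    by auto
  obtain M where M: "\<And>j. M \<le> j \<Longrightarrow> ptype (gen s (act w x)) j = ptype (act w x) j \<and>
      gen s (act w x) j = (if ptype (act w x) j then L j s (act w x j) else act w x j)"
    using gen_asymptotic[OF assms(1)[of w], of s] snoc.prems by auto
  show ?case
    by (rule exI[of _ "max M N"]) (use M N in auto)
qed auto

section \<open>Connecting prefixes\<close>

text \<open>
  Some word maps the cylinder of \<open>p\<close> of length \<open>N\<close> onto that of \<open>q\<close>, and acts on all further
  coordinates by left multiplications that depend on the level and its type only. The second part is
  needed to pass from \<open>N\<close> to \<open>Suc N\<close>: it makes the effect of the word on the next coordinate independent
  of the path in the cylinder.
\<close>

definition reach :: "nat \<Rightarrow> (nat \<Rightarrow> nat) \<Rightarrow> (nat \<Rightarrow> nat) \<Rightarrow> bool"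
  where "reach N p q \<longleftrightarrow> (\<exists>w u. set w \<subseteq> {..<4} \<and>
    (\<forall>x. agree N x p \<longleftrightarrow> agree N (act w x) q) \<and>
    (\<forall>x j. agree N x p \<longrightarrow> N \<le> j \<longrightarrow> ptype (act w x) j = ptype x j \<and>
       act w x j = (if ptype x j then fold (L j) (u j) (x j) else x j)))"

lemma reach_refl: "reach N p p"
  unfolding reach_def by (rule exI[of _ "[]"], rule exI[of _ "\<lambda>_. []"]) auto

lemma reach_trans:
  assumes "reach N p q" "reach N q r"
  shows "reach N p r"
proof -
  obtain w u where w: "set w \<subseteq> {..<4}" "\<And>x. agree N x p \<longleftrightarrow> agree N (act w x) q"
    "\<And>x j. agree N x p \<Longrightarrow> N \<le> j \<Longrightarrow> ptype (act w x) j = ptype x j \<and>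
       act w x j = (if ptype x j then fold (L j) (u j) (x j) else x j)"
    using assms(1) unfolding reach_def by blast
  obtain w' u' where w': "set w' \<subseteq> {..<4}" "\<And>x. agree N x q \<longleftrightarrow> agree N (act w' x) r"
    "\<And>x j. agree N x q \<Longrightarrow> N \<le> j \<Longrightarrow> ptype (act w' x) j = ptype x j \<and>
       act w' x j = (if ptype x j then fold (L j) (u' j) (x j) else x j)"
    using assms(2) unfolding reach_def by blast
  show ?thesis
    unfolding reach_def
    by (rule exI[of _ "w @ w'"], rule exI[of _ "\<lambda>j. u j @ u' j"])
      (use w w' in \<open>auto simp: fold_append\<close>)
qed

lemma reach_sym:
  assumes "reach N p q"
  shows "reach N q p"
proof -
  obtain w u where w: "set w \<subseteq> {..<4}" "\<And>x. agree N x p \<longleftrightarrow> agree N (act w x) q"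
    "\<And>x j. agree N x p \<Longrightarrow> N \<le> j \<Longrightarrow> ptype (act w x) j = ptype x j \<and>
       act w x j = (if ptype x j then fold (L j) (u j) (x j) else x j)"
    using assms unfolding reach_def by blast
  have 1: "agree N x q \<longleftrightarrow> agree N (act (rev w) x) p" for x
    using w(2)[of "act (rev w) x"] by simp
  have 2: "ptype (act (rev w) x) j = ptype x j"
    "act (rev w) x j = (if ptype x j then fold (L j) (rev (u j)) (x j) else x j)"
    if "agree N x q" "N \<le> j" for x j
  proof -
    have *: "ptype x j = ptype (act (rev w) x) j"
       "x j = (if ptype (act (rev w) x) j then fold (L j) (u j) (act (rev w) x j) else act (rev w) x j)"
      using w(3)[of "act (rev w) x" j] that 1 by auto
    then show "ptype (act (rev w) x) j = ptype x j" by simp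
    show "act (rev w) x j = (if ptype x j then fold (L j) (rev (u j)) (x j) else x j)"
      using * fold_invol_rev(1)[of "L j", OF L_invol] by auto
  qed
  show ?thesis
    unfolding reach_def
    by (rule exI[of _ "rev w"], rule exI[of _ "\<lambda>j. rev (u j)"]) (use w(1) 1 2 in auto)
qed

lemma agree_cong: "agree N p p' \<Longrightarrow> agree N x p \<longleftrightarrow> agree N x p'"
  by (auto simp: agree_def)

lemma reach_cong: "agree N p p' \<Longrightarrow> agree N q q' \<Longrightarrow> reach N p q \<longleftrightarrow> reach N p' q'"
  using agree_cong[of N p p'] agree_cong[of N q q'] by (simp add: reach_def)

lemma agree_Suc: "agree (Suc N) x y \<longleftrightarrow> agree N x y \<and> x N = y N"
  by (auto simp: agree_def less_Suc_eq)

lemma agree_upd [simp]: "agree N x (y(N := f)) \<longleftrightarrow> agree N x y" "agree N (y(N := f)) x \<longleftrightarrow> agree N y x"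
  by (auto simp: agree_def)

text \<open>
  The same element \<open>v\<close> multiplies the coordinate \<open>N\<close> for all \<open>f\<close> simultaneously.
\<close>

lemma reach_lift:
  assumes "reach N p q" "1 \<le> N"
  obtains v where "\<And>f. reach (Suc N) (p(N := f)) (q(N := if ptype p N then fold (L N) v f else f))"
proof -
  obtain w u where w: "set w \<subseteq> {..<4}" "\<And>x. agree N x p \<longleftrightarrow> agree N (act w x) q"
    "\<And>x j. agree N x p \<Longrightarrow> N \<le> j \<Longrightarrow> ptype (act w x) j = ptype x j \<and>
       act w x j = (if ptype x j then fold (L j) (u j) (x j) else x j)"
    using assms unfolding reach_def by blast
  have "reach (Suc N) (p(N := f)) (q(N := if ptype p N then fold (L N) (u N) f else f))" for f
    unfolding reach_def
  proof (intro exI[of _ w] exI[of _ u] conjI allI impI)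
    fix x
    have "act w x N = (if ptype p N then fold (L N) (u N) (x N) else x N)" if "agree N x p"
      using w(3)[OF that, of N] ptype_agree[OF that assms(2), of N] by simp
    moreover have "fold (L N) (u N) a = fold (L N) (u N) b \<longleftrightarrow> a = b" for a b
      using fold_invol_rev(1)[of "L N", OF L_invol] by metis
    ultimately show "agree (Suc N) x (p(N := f)) \<longleftrightarrow>
        agree (Suc N) (act w x) (q(N := if ptype p N then fold (L N) (u N) f else f))"
      using w(2)[of x] by (auto simp: agree_Suc)
  qed (use w in \<open>auto simp: agree_Suc\<close>)
  then show thesis by (rule that)
qed

lemma reach_gen_rot:
  assumes "s < 3" "2 \<le> N"
  shows "reach N p (gen s p)"
proof -
  have 1: "agree N (gen s x) (gen s y)" if "agree N x y" for x y
    using that ptype_agree[OF that] assms by (auto simp: gen_def agree_def)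
  show ?thesis
    unfolding reach_def
  proof (intro exI[of _ "[s]"] exI[of _ "\<lambda>_. [s]"] conjI allI impI)
    show "agree N x p \<longleftrightarrow> agree N (act [s] x) (gen s p)" for x
      using 1[of x p] 1[of "gen s x" "gen s p"] by (auto simp: gen_invol)
    show "act [s] x j = (if ptype x j then fold (L j) [s] (x j) else x j)" if "N \<le> j" for x j
      using assms that by (auto simp: gen_def)
  qed (use assms in \<open>auto simp: ptype_gen_rot\<close>)
qed

text \<open>
  Only the exchange of a switch with its neighbour involves the coordinate \<open>m + 2\<close>; all other
  instructions are already determined one level earlier.
\<close>

lemma local_move_cong_not5:
  assumes "1 \<le> m" "agree (m + 2) x y" "j < m + 2" "x m \<noteq> 5"
  shows "local_move m x j = local_move m y j"
proof -
  have eq: "x i = y i" if "i < m + 2" for i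
    using assms that by (auto simp: agree_def)
  have app: "(if b then f else g) j = (if b then f j else g j)" for b and f g :: "nat \<Rightarrow> nat"
    by simp
  show ?thesis
  proof (cases "m = 1")
    case True
    have "x j = y j" "x 0 = y 0" "x 1 = y 1" "x (Suc 1) = y (Suc 1)" "x 2 = y 2" "y 1 = 5 \<longleftrightarrow> False"
      using True assms(3,4) eq[of 1] by (auto intro!: eq)
    then show ?thesis
      unfolding local_move_def Let_def True fun_upd_def app by (simp only: if_False)
  next
    case False
    have "x j = y j" "x m = y m" "x (Suc m) = y (Suc m)" "y m = 5 \<longleftrightarrow> False"
      using assms(3,4) eq[of m] by (auto intro!: eq)
    then show ?thesis
      unfolding local_move_def Let_def fun_upd_def app by (simp only: False simp_thms if_False)
  qed
qed

lemma ptype_local_move_not5: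
  assumes "1 \<le> m" "x m \<noteq> 5"
  shows "ptype (local_move m x) (m + 2) = ptype x (m + 2)"
proof -
  have "local_move m x (m + 2) = x (m + 2)"
    using assms by (auto simp: local_move_def Let_def)
  moreover have "ptype z (m + 3) = (ptype z (m + 2) \<noteq> (z (m + 2) = k (m + 2)))" for z
    by (simp add: numeral_eq_Suc)
  ultimately show ?thesis
    using ptype_local_move[OF assms(1), of x] by auto
qed

lemma reach_gen_spinal_aux:
  assumes p: "\<not> ray p" and N: "control p + 3 \<le> N \<or> control p + 2 \<le> N \<and> p (control p) \<noteq> 5"
    and x: "agree N x p"
  shows "control x = control p" "\<not> ray x" "agree N (gen 3 x) (gen 3 p)"
proof -
  let ?m = "control p"
  note c = control[OF p]
  have s: "\<not> (3::nat) < 3" by simp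
  show *: "control x = ?m" "\<not> ray x"
    using control_eqI[of ?m x] c x N by (auto simp: agree_def)
  have "gen 3 x j = gen 3 p j" if j: "j < N" for j
  proof (cases "?m + 3 \<le> j")
    case True
    then show ?thesis
      using gen_spinal(2)[OF s, of _ j] * p ptype_agree[OF x, of j] x j by (auto simp: agree_def)
  next
    case False
    have "local_move ?m x j = local_move ?m p j"
    proof (cases "?m + 3 \<le> N")
      case True
      then show ?thesis using local_move_cong[OF c(1) agree_mono[OF x]] False by simp
    next
      case m: False
      then have "x ?m \<noteq> 5" "N = ?m + 2" using N x by (auto simp: agree_def)
      then show ?thesis using x j local_move_cong_not5[OF c(1)] by simp
    qed
    then show ?thesis
      using gen_spinal(1)[OF s, of _ j] * p False by simp
  qed
  then show "agree N (gen 3 x) (gen 3 p)" by (simp add: agree_def)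
qed

lemma reach_gen_spinal:
  assumes p: "\<not> ray p" and N: "control p + 3 \<le> N \<or> control p + 2 \<le> N \<and> p (control p) \<noteq> 5"
  shows "reach N p (gen 3 p)"
proof -
  let ?m = "control p"
  note c = control[OF p]
  have s: "\<not> (3::nat) < 3" by simp
  note x = reach_gen_spinal_aux[OF p N]
  have tail: "\<not> ?m + 3 \<le> j \<Longrightarrow> j = ?m + 2 \<and> x ?m \<noteq> 5" if "agree N x p" "N \<le> j" for x j
    using N that by (auto simp: agree_def)
  have gen_tail: "gen 3 x j = (if ptype x j then fold (L j) (if ?m + 3 \<le> j then [3] else []) (x j) else x j)"
    if a: "agree N x p" and j: "N \<le> j" for x j
  proof (cases "?m + 3 \<le> j")
    case False
    then have "local_move ?m x j = x j"
      using tail[OF a j] c(1) by (auto simp: local_move_def Let_def)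
    then show ?thesis using False gen_spinal(1)[OF s, of x j] x[OF a] by simp
  qed (use gen_spinal(2)[OF s, of x j] x[OF a] in auto)
  have pt: "ptype (gen 3 x) j = ptype x j" if a: "agree N x p" and j: "N \<le> j" for x j
  proof (cases "?m + 3 \<le> j")
    case True
    then show ?thesis using ptype_gen_spinal[OF s] x[OF a] by simp
  next
    case False
    have "ptype (gen 3 x) j = ptype (local_move ?m x) j"
      by (rule ptype_agree[of j]) (use False tail[OF a j] x[OF a] gen_spinal(1)[OF s, of x] in \<open>auto simp: agree_def\<close>)
    then show ?thesis
      using tail[OF a j] False ptype_local_move_not5[OF c(1), of x] by simp
  qed
  show ?thesis
    unfolding reach_def
  proof (intro exI[of _ "[3]"] exI[of _ "\<lambda>j. if ?m + 3 \<le> j then [3] else []"] conjI allI impI)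
    fix y
    have e: "control (gen 3 p) = ?m" "\<not> ray (gen 3 p)" "gen 3 p ?m = p ?m"
      using control_gen_spinal[OF s p] gen_spinal(3)[OF s p, of ?m] c(1) by auto
    have "agree N (gen 3 (gen 3 y)) (gen 3 (gen 3 p))" if "agree N (gen 3 y) (gen 3 p)"
      by (rule reach_gen_spinal_aux(3)[OF e(2) _ that]) (use e N in simp)
    then show "agree N y p \<longleftrightarrow> agree N (act [3] y) (gen 3 p)"
      using x(3) by (auto simp: gen_invol)
  qed (use gen_tail pt in auto)
qed

definition ray_point :: "bool \<Rightarrow> nat \<Rightarrow> nat"
  where "ray_point b j = (if j = 0 \<and> \<not> b then 1 else 0)"

lemma ray_point_Suc [simp]: "1 \<le> j \<Longrightarrow> ray_point b j = 0"
  by (simp add: ray_point_def)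

lemma ptype_ray_point [simp]: "ptype (ray_point b) j = b"
  by (induction j) (auto simp: ray_point_def k0)

lemma ray_point_paths: "ray_point b \<in> paths"
  by (auto simp: paths_def admissible_def ray_point_def k0)

lemma ray_point_upd_paths: "admissible j v \<Longrightarrow> x \<in> paths \<Longrightarrow> x(j := v) \<in> paths"
  by (auto simp: paths_def)

lemma ptype_upd: "1 \<le> i \<Longrightarrow> j \<le> i \<Longrightarrow> ptype (x(i := v)) j = ptype x j"
  by (induction j) auto

lemma ptype_ray_point_upd: "1 \<le> i \<Longrightarrow> v \<noteq> k i \<Longrightarrow> ptype ((ray_point b)(i := v)) j = b"
  by (induction j) (auto simp: ray_point_def k0)

lemma reach_ray_point_2:
  assumes "p \<in> paths"
  shows "reach 2 p (ray_point (ptype p 2))"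
proof -
  have p: "p 0 < 2" "p 1 < 7"
    using assms k0 by (auto simp: paths_def admissible_def dest: spec[of _ 0] spec[of _ 1])
  define b where "b = ptype p 2"
  have b: "b \<longleftrightarrow> p 0 = 0"
    using p k0 by (auto simp: b_def numeral_2_eq_2)
  have step: "reach 2 ((ray_point b)(1 := r)) ((ray_point b)(1 := Suc r))" if r: "r < 6" for r
  proof -
    let ?s = "r mod 2"
    have s: "?s < 3" "?s < 2" by (simp_all add: less_trans[OF mod_less_divisor])
    have "root_move ?s r = Suc r"
      using r s by (simp add: root_move_def)
    then have "agree 2 (gen ?s ((ray_point b)(1 := r))) ((ray_point b)(1 := Suc r))"
      using s by (auto simp: agree_def gen_def less_2_cases_iff)
    then show ?thesis
      using reach_gen_rot[OF s(1), of 2] reach_cong[OF agree_refl] by blast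
  qed
  have "r < 7 \<Longrightarrow> reach 2 (ray_point b) ((ray_point b)(1 := r))" for r
  proof (induction r)
    case 0
    have "(ray_point b)(1 := 0) = ray_point b" by (auto simp: ray_point_def)
    then show ?case using reach_refl by simp
  next
    case (Suc r)
    show ?case by (rule reach_trans[OF Suc.IH step]) (use Suc.prems in auto)
  qed
  from reach_sym[OF this[OF p(2)]] have "reach 2 ((ray_point b)(1 := p 1)) (ray_point b)" .
  moreover have "agree 2 ((ray_point b)(1 := p 1)) p"
    using p b by (auto simp: agree_def less_2_cases_iff ray_point_def)
  ultimately show ?thesis
    using reach_cong[OF _ agree_refl] b_def by blast
qed

lemma reach_spinal_step:
  assumes "1 \<le> m" "p m \<noteq> 0" "\<And>j. 1 \<le> j \<Longrightarrow> j < m \<Longrightarrow> p j = 0"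
    and "m + 3 \<le> N \<or> m + 2 \<le> N \<and> p m \<noteq> 5"
    and "\<And>j. j < N \<Longrightarrow> local_move m p j = q j" and "N \<le> m + 3"
  shows "reach N p q"
proof -
  have m: "control p = m" "\<not> ray p"
    using control_eqI[of m p, OF assms(1-3)] by auto
  have "reach N p (gen 3 p)"
    by (rule reach_gen_spinal) (use m assms in auto)
  moreover have "agree N (gen 3 p) q"
    using gen_spinal(1)[of 3 p] m assms by (auto simp: agree_def)
  ultimately show ?thesis
    using reach_cong[OF agree_refl] by blast
qed

text \<open>
  By induction on \<open>N\<close>. If the coordinate \<open>N\<close> is an ordinary edge, the induction hypothesis leads to the
  ray but multiplies this coordinate from the left in an uncontrolled way. Instructions multiply it from
  the right by any generator; going to the instruction and back with the same word cancels the left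
  multiplication, since the two commute. So the coordinate can be brought to \<open>0\<close>. If it is a switch, an
  instruction moves the switch one level down, or at the bottom removes it by changing the
  initial type, and the first case applies.
\<close>

lemma reach_ray_point:
  assumes "2 \<le> N" "p \<in> paths"
  shows "reach N p (ray_point (ptype p N))"
  using assms
proof (induction N arbitrary: p rule: dec_induct)
  case base
  then show ?case by (rule reach_ray_point_2)
next
  case (step N)
  have reach_eq: "reach N p q" if "p \<in> paths" "q \<in> paths" "ptype p N = ptype q N" for p q
    using step.IH[OF that(1)] reach_sym[OF step.IH[OF that(2)]] that(3) by (auto intro: reach_trans)
  \<comment> \<open>Right multiplication by a generator, at the price of visiting the control path ?c.\<close>
  have digit: "reach (Suc N) ((ray_point b)(N := f)) ((ray_point b)(N := R N s f))" if s: "s < 4" for b f s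
  proof -
    let ?c = "(ray_point b)(N - 1 := Suc s)"
    have kN: "7 \<le> k (N - 1)" using k_ge7 step.hyps by simp
    have "?c \<in> paths"
      by (rule ray_point_upd_paths[OF _ ray_point_paths]) (use kN s in \<open>auto simp: admissible_def\<close>)
    moreover have "ptype ?c N = b"
      by (rule ptype_ray_point_upd) (use kN s step.hyps in auto)
    ultimately have "reach N (ray_point b) ?c"
      by (intro reach_eq ray_point_paths) auto
    from reach_lift[OF this] step.hyps obtain v where
      v: "\<And>f. reach (Suc N) ((ray_point b)(N := f)) (?c(N := if b then fold (L N) v f else f))"
      by auto
    define F where "F f = (if b then fold (L N) v f else f)" for f
    have "reach (Suc N) (?c(N := F f)) (?c(N := R N s (F f)))"
    proof (rule reach_spinal_step[of "N - 1"])
      fix j assume "j < Suc N"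
      have val: "(?c(N := F f)) (N - 1) = Suc s" "Suc (N - 1) = N"
        using step.hyps by auto
      have "local_move (N - 1) (?c(N := F f)) = ?c(N := R N s (F f))"
        unfolding local_move_def Let_def val by (use s in simp)
      then show "local_move (N - 1) (?c(N := F f)) j = (?c(N := R N s (F f))) j" by simp
    qed (use step.hyps s in auto)
    moreover have "F (R N s f) = R N s (F f)"
      by (simp add: F_def fold_L_R)
    ultimately have 1: "reach (Suc N) (?c(N := F f)) (?c(N := F (R N s f)))"
      by simp
    have 2: "reach (Suc N) ((ray_point b)(N := f)) (?c(N := F f))" for f
      unfolding F_def by (rule v)
    show ?thesis
      by (rule reach_trans[OF 2 reach_trans[OF 1 reach_sym[OF 2]]])
  qed
  have word_ray_point: "reach (Suc N) ((ray_point b)(N := f)) (ray_point b)" if f: "f < k N" for b f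
  proof -
    obtain v where v: "set v \<subseteq> {..<4}" "fold (R N) v 0 = f"
      using R_transitive[OF step.hyps(1) f] by blast
    have "set v \<subseteq> {..<4} \<Longrightarrow> reach (Suc N) (ray_point b) ((ray_point b)(N := fold (R N) v 0))" for v
    proof (induction v rule: rev_induct)
      case Nil
      have "(ray_point b)(N := 0) = ray_point b"
        using step.hyps by (auto simp: ray_point_def)
      then show ?case by (simp add: reach_refl)
    next
      case (snoc s v)
      have "fold (R N) (v @ [s]) 0 = R N s (fold (R N) v 0)" by simp
      with reach_trans[OF snoc.IH digit] snoc.prems show ?case by (metis in_set_conv_decomp lessThan_iff set_append subset_iff Un_subset_iff)
    qed
    from reach_sym[OF this[OF v(1)]] v(2) show ?thesis by simp
  qed
  have word: "reach (Suc N) p (ray_point (ptype p N))" if p: "p \<in> paths" "p N < k N" for p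
  proof -
    have "1 \<le> N" using step.hyps by simp
    then obtain v where "\<And>f. reach (Suc N) (p(N := f))
        ((ray_point (ptype p N))(N := if ptype p N then fold (L N) v f else f))"
      using reach_lift[OF step.IH[OF p(1)]] by blast
    from this[of "p N"] show ?thesis
      using word_ray_point[of "if ptype p N then fold (L N) v (p N) else p N" "ptype p N"] p(2) reach_trans
      by auto
  qed
  show ?case
  proof (cases "p N = k N")
    case False
    then have "p N < k N"
      using step by (auto simp: paths_def admissible_def dest: spec[of _ N])
    then show ?thesis
      using word[OF step.prems] False by simp
  next
    case sw: True
    define b where "b = ptype p N"
    have "\<exists>r. r \<in> paths \<and> r N = 0 \<and> ptype r N = (\<not> b) \<and> reach (Suc N) p r"
    proof (cases "N = 2")
      case True
      \<comment> \<open>At the bottom the switch is traded for the opposite initial type.\<close>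
      let ?c = "(ray_point b)(1 := 6)" and ?r = "(ray_point (\<not> b))(1 := 6)"
      have c: "?c \<in> paths" "?r \<in> paths"
        by (auto intro!: ray_point_upd_paths ray_point_paths simp: admissible_def)
      have "reach N p ?c"
        by (rule reach_eq[OF step.prems c(1)]) (simp add: ptype_ray_point_upd b_def)
      then obtain v where "reach (Suc N) (p(N := k N)) (?c(N := if ptype p N then fold (L N) v (k N) else k N))"
        using reach_lift step.hyps by (metis One_nat_def Suc_1 Suc_leD)
      moreover have "p(N := k N) = p" using sw by auto
      ultimately have "reach (Suc N) p (?c(N := k N))" by (simp add: fold_L_switch[THEN iffD2] split: if_splits)
      moreover have "reach (Suc N) (?c(N := k N)) ?r"
      proof (rule reach_spinal_step[of 1])
        fix j assume "j < Suc N"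
        then have "j = 0 \<or> j = 1 \<or> j = 2" using True by auto
        then show "local_move 1 (?c(N := k N)) j = ?r j"
          using True by (auto simp: local_move_def ray_point_def)
      qed (use True in auto)
      ultimately show ?thesis
        using c(2) True reach_trans by (intro exI[of _ ?r]) (auto simp: ptype_ray_point_upd)
    next
      case False
      then have N: "3 \<le> N" using step.hyps by simp
      \<comment> \<open>Higher up the switch moves from level N to level N - 1.\<close>
      let ?c = "(ray_point b)(N - 2 := 5)" let ?r = "?c(N - 1 := k (N - 1))"
      have kN: "7 \<le> k (N - 2)" using k_ge7 N by simp
      have c: "?c \<in> paths" "?r \<in> paths"
        using kN N by (auto intro!: ray_point_upd_paths ray_point_paths simp: admissible_def)
      have pc: "ptype ?c j = b" for j
        by (rule ptype_ray_point_upd) (use kN N in auto)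
      have "ptype ?r (Suc (N - 1)) = (\<not> b)"
        unfolding ptype.simps using pc[of "N - 1"] N by (simp add: ptype_upd)
      then have pr: "ptype ?r N = (\<not> b)" using N by simp
      have "reach N p ?c"
        by (rule reach_eq[OF step.prems c(1)]) (unfold pc, simp add: b_def)
      then obtain v where "reach (Suc N) (p(N := k N)) (?c(N := if ptype p N then fold (L N) v (k N) else k N))"
        using reach_lift step.hyps by (metis One_nat_def Suc_1 Suc_leD)
      moreover have "p(N := k N) = p" using sw by auto
      ultimately have "reach (Suc N) p (?c(N := k N))" by (simp add: fold_L_switch[THEN iffD2] split: if_splits)
      moreover have "reach (Suc N) (?c(N := k N)) ?r"
      proof (rule reach_spinal_step[of "N - 2"])
        fix j assume j: "j < Suc N"
        have idx: "Suc (N - 2) = N - 1" "N - 2 + 2 = N" using N by auto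
        have val: "(?c(N := k N)) (N - 2) = 5" "(?c(N := k N)) (N - 1) = 0" "(?c(N := k N)) N = k N"
          using N by auto
        have "local_move (N - 2) (?c(N := k N)) = (?c(N := k N))(N - 1 := k (N - 1), N := 0)"
          using local_move_5[of "?c(N := k N)" "N - 2", unfolded idx] val by (simp del: One_nat_def fun_upd_apply)
        moreover have "N \<noteq> N - 2" "N \<noteq> N - 1" "1 \<le> N" using N by auto
        ultimately show "local_move (N - 2) (?c(N := k N)) j = ?r j"
          by (cases "j = N") (simp_all del: One_nat_def)
      qed (use N in auto)
      ultimately have "reach (Suc N) p ?r" by (rule reach_trans)
      moreover have "?r N = 0" using N by auto
      ultimately show ?thesis
        using c(2) pr by blast
    qed
    then obtain r where r: "r \<in> paths" "r N = 0" "ptype r N = (\<not> b)" "reach (Suc N) p r" by blast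
    then have "reach (Suc N) p (ray_point (\<not> b))"
      using word[of r] reach_trans by auto
    then show ?thesis using sw by (simp add: b_def)
  qed
qed

lemma reach_paths:
  assumes "2 \<le> N" "p \<in> paths" "q \<in> paths" "ptype p N = ptype q N"
  shows "\<exists>w. set w \<subseteq> {..<4} \<and> (\<forall>x. agree N x p \<longleftrightarrow> agree N (act w x) q)"
proof -
  have "reach N p q"
    using reach_ray_point[OF assms(1,2)] reach_sym[OF reach_ray_point[OF assms(1,3)]] assms(4) by (auto intro: reach_trans)
  then show ?thesis unfolding reach_def by blast
qed

lemma ex_switch_to:
  assumes "p \<in> paths" "2 \<le> M"
  shows "\<exists>q\<in>paths. agree M q p \<and> ptype q (Suc M) = b"
proof -
  have "ptype (p(M := 0)) M = ptype p M" "ptype (p(M := k M)) M = ptype p M"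
    by (rule ptype_upd; use assms(2) in simp)+
  then show ?thesis
    using assms by (intro bexI[of _ "p(M := if ptype p M = b then 0 else k M)"])
      (auto simp: ray_point_upd_paths)
qed

text \<open>
  One coordinate after the required prefix is reserved for a switch, in case the types disagree.
\<close>

lemma act_dense:
  assumes "x \<in> paths" "p \<in> paths"
  shows "\<exists>w. set w \<subseteq> {..<4} \<and> agree M (act w x) p"
proof -
  let ?M = "max M 2"
  obtain q where q: "q \<in> paths" "agree ?M q p" "ptype q (Suc ?M) = ptype x (Suc ?M)"
    using ex_switch_to[OF assms(2), of ?M "ptype x (Suc ?M)"] by auto
  then obtain w where "set w \<subseteq> {..<4}" "agree (Suc ?M) (act w x) q"
    using reach_paths[OF _ assms(1) q(1) q(3)[symmetric]] agree_refl[of "Suc ?M" x] by (metis le_SucI max.cobounded2)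
  then show ?thesis
    using q(2) agree_mono[of _ _ _ M] agree_trans by (intro exI[of _ w]) (meson le_SucI max.cobounded1)
qed

end

section \<open>Free actions and tail equivalence\<close>

lemma pred_nat_rel:
  fixes f h :: "'a \<Rightarrow> nat"
  assumes "f \<in> M \<rightarrow>\<^sub>M count_space UNIV" "h \<in> M \<rightarrow>\<^sub>M count_space UNIV"
  shows "Measurable.pred M (\<lambda>x. P (f x) (h x))"
proof -
  note assms [measurable]
  have "Measurable.pred M (\<lambda>x. \<exists>a b. P a b \<and> f x = a \<and> h x = b)"
    by measurable
  then show ?thesis by simp
qed

locale pmp_involutions = prob_space M for M :: "'a measure" +
  fixes g :: "nat \<Rightarrow> 'a \<Rightarrow> 'a"
  assumes g_meas: "g s \<in> M \<rightarrow>\<^sub>M M"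
    and g_distr: "distr M M (g s) = M"
    and g_invol: "x \<in> space M \<Longrightarrow> g s (g s x) = x"
begin

lemma fold_g_meas: "fold g w \<in> M \<rightarrow>\<^sub>M M"
proof (induction w)
  case (Cons s w)
  show ?case using measurable_comp[OF g_meas Cons.IH] by (simp add: comp_def)
qed simp

lemma fold_g_space: "x \<in> space M \<Longrightarrow> fold g w x \<in> space M"
  using fold_g_meas[of w] by (rule measurable_space)

lemma g_space: "x \<in> space M \<Longrightarrow> g s x \<in> space M"
  using g_meas[of s] by (rule measurable_space)

lemma fold_g_rev: "x \<in> space M \<Longrightarrow> fold g (rev w) (fold g w x) = x"
  by (induction w arbitrary: x) (auto simp: g_invol g_space)

lemma AE_g: "AE x in M. P x \<Longrightarrow> AE x in M. P (g s x)"
  by (rule AE_distrD[OF g_meas]) (simp only: g_distr)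

lemma AE_fold_g: "AE x in M. P x \<Longrightarrow> AE x in M. \<forall>w. P (fold g w x)"
proof -
  assume P: "AE x in M. P x"
  have "AE x in M. P (fold g w x)" for w
  proof (induction w)
    case (Cons s w)
    show ?case using AE_g[OF Cons.IH, of s] by simp
  qed (use P in simp)
  then show ?thesis by (simp add: AE_all_countable)
qed

lemma prob_g_vimage: "A \<in> sets M \<Longrightarrow> prob (g s -` A \<inter> space M) = prob A"
  using measure_distr[OF g_meas[of s], of A] g_distr[of s] by simp

text \<open>
  If two reduced words agree at a point, cancelling their common end makes one followed by the
  inverse of the other a reduced word that fixes the point.
\<close>

lemma reduced_word_inj:
  assumes x: "x \<in> space M"
    and free: "\<And>w. set w \<subseteq> {..<4} \<Longrightarrow> distinct_adj w \<Longrightarrow> w \<noteq> [] \<Longrightarrow> fold g w x \<noteq> x"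
    and "set v \<subseteq> {..<4}" "distinct_adj v" "set w \<subseteq> {..<4}" "distinct_adj w" "fold g v x = fold g w x"
  shows "v = w"
  using assms(3-)
proof (induction v arbitrary: w rule: rev_induct)
  case Nil
  then show ?case using free[of w] by auto
next
  case (snoc s v)
  show ?case
  proof (cases w rule: rev_cases)
    case Nil
    then show ?thesis using free[of "v @ [s]"] snoc.prems by auto
  next
    case (snoc w' s')
    show ?thesis
    proof (cases "s = s'")
      case True
      have "fold g v x = fold g w' x"
        using snoc snoc.prems(5) True g_invol[OF fold_g_space[OF x]] by (metis fold_Cons fold_Nil fold_append comp_apply id_apply)
      then show ?thesis
        using snoc.IH[of w'] snoc snoc.prems True by (auto simp: distinct_adj_append_iff)
    next
      case False
      let ?u = "(v @ [s]) @ rev (w' @ [s'])"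
      have "distinct_adj ?u"
        using snoc.prems(2,4) False unfolding snoc
        by (auto simp: distinct_adj_append_iff distinct_adj_Cons hd_rev last_rev)
      moreover have "fold g ?u x = x"
        using snoc.prems(5) fold_g_rev[OF x, of w] unfolding snoc by simp
      ultimately show ?thesis
        using free[of ?u] snoc.prems(1,3) snoc by auto
    qed
  qed
qed

end

text \<open>
  Fix \<open>n\<close> and let \<open>E n\<close> relate points whose images agree from \<open>n\<close>
  on. The first \<open>n\<close> coordinates of the image, numbered by \<open>r n\<close>, well-order every class. In the forest of
  generator edges inside the classes, take the \<open>r n\<close>-minimal point of a component as its root. An edge
  labelled \<open>s\<close> from \<open>x\<close> to \<open>g s x\<close> is then the first step to the root from one of its two ends, so
  the points that keep their \<open>s\<close>-edge have at most twice the measure of the set \<open>Q n s\<close> of points whose first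
  step is \<open>s\<close>. These four sets are disjoint, whence the bound 2 on the expected degree, while by
  assumption the degree tends to 4. In other words, a free action of the free product is not
  hyperfinite.
\<close>

lemma no_tail_embedding:
  fixes M :: "'a measure" and \<theta> :: "'a \<Rightarrow> nat \<Rightarrow> nat"
  assumes "pmp_involutions M g"
    and \<theta>[measurable]: "\<theta> \<in> M \<rightarrow>\<^sub>M PiM UNIV (\<lambda>_. count_space UNIV)"
    and free: "AE x in M. \<forall>w. set w \<subseteq> {..<4} \<longrightarrow> distinct_adj w \<longrightarrow> w \<noteq> [] \<longrightarrow> fold g w x \<noteq> x"
    and inj: "AE x in M. \<forall>w. set w \<subseteq> {..<4} \<longrightarrow> \<theta> (fold g w x) = \<theta> x \<longrightarrow> fold g w x = x"
    and tail: "AE x in M. \<forall>s<4. \<exists>n. \<forall>j\<ge>n. \<theta> (g s x) j = \<theta> x j"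
  shows False
proof -
  interpret pmp_involutions M g by fact
  define E where "E n x y \<longleftrightarrow> (\<forall>j\<ge>n. \<theta> x j = \<theta> y j)" for n x y
  have \<theta>_nth: "(\<lambda>x. \<theta> x j) \<in> M \<rightarrow>\<^sub>M count_space UNIV" for j
    by measurable
  define path where "path n = rec_list (\<lambda>x. True) (\<lambda>s w P x. E n (g s x) x \<and> P (g s x))" for n
  have path_simps [simp]: "path n [] x" "path n (s # w) x \<longleftrightarrow> E n (g s x) x \<and> path n w (g s x)" for n s w x
    by (simp_all add: path_def)
  have E_refl: "E n x x" and E_sym: "E n x y \<Longrightarrow> E n y x" and E_trans: "E n x y \<Longrightarrow> E n y z \<Longrightarrow> E n x z"
    for n x y z by (simp_all add: E_def)
  have path_E: "path n w x \<Longrightarrow> E n (fold g w x) x" for n w x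
    by (induction w arbitrary: x) (auto intro: E_refl E_trans)
  define r where "r n x = to_nat (map (\<theta> x) [0..<n])" for n x
  have r_inj: "\<theta> x = \<theta> y" if "r n x = r n y" "E n x y" for n x y
  proof
    fix j
    show "\<theta> x j = \<theta> y j"
      using that by (cases "j < n") (auto simp: r_def E_def map_eq_conv)
  qed
  define Min where "Min n x w \<longleftrightarrow> path n w x \<and> set w \<subseteq> {..<4} \<and> distinct_adj w \<and>
      (\<forall>w'. path n w' x \<longrightarrow> set w' \<subseteq> {..<4} \<longrightarrow> r n (fold g w x) \<le> r n (fold g w' x))" for n x w
  \<comment> \<open>Deleting a step that is immediately undone keeps the walk within its class.\<close>
  have reduce: "\<exists>w'. path n w' x \<and> set w' \<subseteq> {..<4} \<and> distinct_adj w' \<and> fold g w' x = fold g w x"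
    if "path n w x" "set w \<subseteq> {..<4}" "x \<in> space M" for n w x
    using that
  proof (induction w arbitrary: x)
    case Nil
    then show ?case by (intro exI[of _ "[]"]) auto
  next
    case (Cons s w)
    then obtain w' where w': "path n w' (g s x)" "set w' \<subseteq> {..<4}" "distinct_adj w'"
      "fold g w' (g s x) = fold g w (g s x)"
      using Cons.IH[of "g s x"] g_space[OF Cons.prems(3), of s] Cons.prems(1,2)
      by (simp del: fold_simps) blast
    show ?case
    proof (cases "w' \<noteq> [] \<and> hd w' = s")
      case True
      then obtain w'' where "w' = s # w''" by (cases w') auto
      then show ?thesis
        using w' g_invol[OF Cons.prems(3)] Cons.prems by (intro exI[of _ w'']) (auto simp: distinct_adj_Cons)
    next
      case False
      then show ?thesis
        using w' Cons.prems by (intro exI[of _ "s # w'"]) (auto simp: distinct_adj_Cons)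
    qed
  qed
  have ex_Min: "\<exists>w. Min n x w" if x: "x \<in> space M" for n x
  proof -
    let ?P = "\<lambda>w. path n w x \<and> set w \<subseteq> {..<4}"
    have "?P []" by simp
    from ex_has_least_nat[of ?P, OF this, of "\<lambda>w. r n (fold g w x)"]
    obtain w where w: "?P w" "\<And>w'. ?P w' \<Longrightarrow> r n (fold g w x) \<le> r n (fold g w' x)" by blast
    from reduce[of n w x] w(1) x obtain v where
      "path n v x \<and> set v \<subseteq> {..<4} \<and> distinct_adj v \<and> fold g v x = fold g w x" by blast
    then have "Min n x v" using w(2) by (auto simp: Min_def)
    then show ?thesis ..
  qed
  define Q where "Q n s = {x \<in> space M. \<exists>w. Min n x (s # w)}" for n s
  \<comment> \<open>The first step towards the root is s either at x or at g s x.\<close>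
  have cover: "x \<in> Q n s \<or> g s x \<in> Q n s" if x: "x \<in> space M" and s: "s < 4" and E: "E n (g s x) x" for n s x
  proof -
    obtain w where w: "Min n x w" using ex_Min[OF x] by blast
    show ?thesis
    proof (cases "w \<noteq> [] \<and> hd w = s")
      case True
      then obtain w' where "w = s # w'" by (cases w) auto
      then show ?thesis using w x by (auto simp: Q_def)
    next
      case False
      have inv: "g s (g s x) = x" by (rule g_invol[OF x])
      have mw: "r n (fold g w x) \<le> r n (fold g w' x)" if "path n w' x" "set w' \<subseteq> {..<4}" for w'
        using w that by (simp add: Min_def)
      have "Min n (g s x) (s # w)"
        unfolding Min_def
      proof (intro conjI allI impI)
        fix w' assume "path n w' (g s x)" "set w' \<subseteq> {..<4}"
        then have "r n (fold g w x) \<le> r n (fold g (s # w') x)"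
          using mw[of "s # w'"] E s by simp
        then show "r n (fold g (s # w) (g s x)) \<le> r n (fold g w' (g s x))"
          by (simp add: inv)
      qed (use w False s E inv E_sym in \<open>auto simp: Min_def distinct_adj_Cons\<close>)
      then show ?thesis using g_space[OF x] by (auto simp: Q_def)
    qed
  qed
  have disjoint: "AE x in M. \<forall>n s s'. x \<in> Q n s \<longrightarrow> x \<in> Q n s' \<longrightarrow> s = s'"
    using AE_fold_g[OF inj] free AE_space
  proof eventually_elim
    case (elim x)
    show ?case
    proof (intro allI impI)
      fix n s s' assume "x \<in> Q n s" "x \<in> Q n s'"
      then obtain v v' where v: "Min n x (s # v)" and v': "Min n x (s' # v')"
        by (auto simp: Q_def)
      let ?w = "s # v" and ?w' = "s' # v'"
      have "r n (fold g ?w x) = r n (fold g ?w' x)"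
        using v v' unfolding Min_def by (meson antisym)
      moreover have "E n (fold g ?w x) (fold g ?w' x)"
        using path_E[of n ?w x] path_E[of n ?w' x] v v' E_sym E_trans unfolding Min_def by blast
      ultimately have eq: "\<theta> (fold g ?w x) = \<theta> (fold g ?w' x)" by (rule r_inj)
      have to: "fold g (rev ?w @ ?w') (fold g ?w x) = fold g ?w' x"
        using fold_g_rev[OF elim(3), of ?w] by (simp del: fold_simps rev.simps)
      have letters: "set (rev ?w @ ?w') \<subseteq> {..<4}"
        using v v' by (auto simp: Min_def)
      have ret: "set v \<subseteq> {..<4} \<Longrightarrow> \<theta> (fold g v (fold g ?w x)) = \<theta> (fold g ?w x)
          \<Longrightarrow> fold g v (fold g ?w x) = fold g ?w x" for v
        using elim(1)[THEN spec[of _ ?w]] by blast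
      have "\<theta> (fold g (rev ?w @ ?w') (fold g ?w x)) = \<theta> (fold g ?w x)"
        by (simp only: to eq)
      from ret[OF letters this] have "fold g ?w' x = fold g ?w x"
        by (simp only: to)
      have "?w' = ?w"
      proof (rule reduced_word_inj[OF elim(3)])
        show "fold g ?w' x = fold g ?w x" by fact
        show "fold g u x \<noteq> x" if "set u \<subseteq> {..<4}" "distinct_adj u" "u \<noteq> []" for u
          using elim(2)[THEN spec[of _ u]] that by blast
      qed (use v v' in \<open>simp_all only: Min_def\<close>)
      then show "s = s'" by simp
    qed
  qed
  have E_meas: "Measurable.pred M (\<lambda>x. E n (g s x) x)" for n s
  proof -
    have "Measurable.pred M (\<lambda>x. \<theta> (g s x) j = \<theta> x j)" for j
      by (rule pred_nat_rel[OF measurable_compose[OF g_meas \<theta>_nth] \<theta>_nth])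
    then show ?thesis
      unfolding E_def by (intro pred_intros_countable(1) pred_intros_logic) auto
  qed
  have path_meas: "Measurable.pred M (path n w)" for n w
  proof (induction w)
    case (Cons s w)
    have "Measurable.pred M (\<lambda>x. path n w (g s x))"
      using measurable_compose[OF g_meas Cons.IH] .
    then have "Measurable.pred M (\<lambda>x. E n (g s x) x \<and> path n w (g s x))"
      using E_meas by (intro pred_intros_logic)
    then show ?case by simp
  qed simp
  have r_meas: "(\<lambda>x. r n (fold g w x)) \<in> M \<rightarrow>\<^sub>M count_space UNIV" for n w
  proof -
    have "Measurable.pred M (\<lambda>x. r n x = v)" for v
    proof -
      have "r n x = v \<longleftrightarrow> (\<exists>l::nat list. to_nat l = v \<and> length l = n \<and> (\<forall>i<n. \<theta> x i = l ! i))" for x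
        unfolding r_def by (auto intro!: exI[of _ "map (\<theta> x) [0..<n]"] arg_cong[where f = to_nat] nth_equalityI)
      moreover have "Measurable.pred M (\<lambda>x. \<theta> x i = c)" for i c
        by (rule pred_nat_rel[OF \<theta>_nth measurable_const]) simp
      ultimately show ?thesis
        by (simp only:) (intro pred_intros_countable pred_intros_logic pred_intros_finite, auto)
    qed
    then have "r n \<in> M \<rightarrow>\<^sub>M count_space UNIV"
      by (subst measurable_count_space_eq2_countable) (auto simp: vimage_def Measurable.pred_def Int_def conj_commute)
    from measurable_compose[OF fold_g_meas this] show ?thesis .
  qed
  have Q_meas [measurable]: "Q n s \<in> sets M" for n s
  proof -
    have cmp: "Measurable.pred M (\<lambda>x. r n (fold g w x) \<le> r n (fold g w' x))" for w w'
      by (rule pred_nat_rel[OF r_meas r_meas])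
    have "Measurable.pred M (\<lambda>x. \<exists>w. Min n x (s # w))"
      unfolding Min_def by (intro pred_intros_countable pred_intros_logic path_meas cmp) simp_all
    then show ?thesis by (simp add: Q_def Measurable.pred_def)
  qed
  have bound: "(\<Sum>s<4. prob {x \<in> space M. E n (g s x) x}) \<le> 2" for n
  proof -
    have "prob {x \<in> space M. E n (g s x) x} \<le> 2 * prob (Q n s)" if "s < 4" for s
    proof -
      have "prob {x \<in> space M. E n (g s x) x} \<le> prob (Q n s \<union> (g s -` Q n s \<inter> space M))"
      proof (rule finite_measure_mono)
        show "{x \<in> space M. E n (g s x) x} \<subseteq> Q n s \<union> (g s -` Q n s \<inter> space M)"
          using cover[OF _ that, of _ n] by blast
        show "Q n s \<union> (g s -` Q n s \<inter> space M) \<in> events"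
          by (rule sets.Un[OF Q_meas measurable_sets[OF g_meas Q_meas]])
      qed
      also have "\<dots> \<le> prob (Q n s) + prob (g s -` Q n s \<inter> space M)"
        by (rule measure_Un_le[OF Q_meas measurable_sets[OF g_meas Q_meas]])
      finally show ?thesis by (simp add: prob_g_vimage)
    qed
    then have "(\<Sum>s<4. prob {x \<in> space M. E n (g s x) x}) \<le> (\<Sum>s<4. 2 * prob (Q n s))"
      by (intro sum_mono) auto
    also have "\<dots> = 2 * (\<Sum>s<4. prob (Q n s))"
      by (simp add: sum_distrib_left)
    also have "(\<Sum>s<4. prob (Q n s)) = (\<Sum>s<4. \<integral>x. indicator (Q n s) x \<partial>M)"
      by simp
    also have "\<dots> = (\<integral>x. (\<Sum>s<4. indicator (Q n s) x) \<partial>M)"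
      by (rule Bochner_Integration.integral_sum[symmetric])
        (simp add: Q_meas emeasure_finite less_top[symmetric])
    also have "\<dots> \<le> (\<integral>x. 1 \<partial>M)"
    proof (rule integral_mono_AE)
      show "AE x in M. (\<Sum>s<4::nat. indicator (Q n s) x) \<le> (1::real)"
        using disjoint
      proof eventually_elim
        case (elim x)
        have "(\<Sum>s<4::nat. indicator (Q n s) x :: real) = card {s \<in> {..<4}. x \<in> Q n s}"
          by (simp add: indicator_def sum.If_cases Int_def)
        also have "card {s \<in> {..<4}. x \<in> Q n s} \<le> Suc 0"
          by (subst card_le_Suc0_iff_eq) (use elim in auto)
        finally show ?case by simp
      qed
      show "integrable M (\<lambda>x. \<Sum>s<4::nat. indicator (Q n s) x :: real)"
        by (rule Bochner_Integration.integrable_sum) (simp add: Q_meas emeasure_finite less_top[symmetric])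
    qed simp
    finally show ?thesis by (simp add: prob_space)
  qed
  have E_sets: "{x \<in> space M. E n (g s x) x} \<in> sets M" for n s
    using E_meas by (simp add: Measurable.pred_def)
  have lim: "(\<lambda>n. prob {x \<in> space M. E n (g s x) x}) \<longlonglongrightarrow> 1" if s: "s < 4" for s
  proof -
    let ?A = "\<lambda>n. {x \<in> space M. E n (g s x) x}"
    have "(\<lambda>n. prob (?A n)) \<longlonglongrightarrow> prob (\<Union>n. ?A n)"
      proof (rule finite_Lim_measure_incseq)
      show "range ?A \<subseteq> events" using E_sets by blast
      show "incseq ?A"
        unfolding incseq_def E_def by (auto intro: le_trans)
    qed
    moreover have "prob (\<Union>n. ?A n) = 1"
    proof (rule prob_eq_1[THEN iffD2])
      show "(\<Union>n. ?A n) \<in> events"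
        using E_sets by blast
      show "AE x in M. x \<in> (\<Union>n. ?A n)"
        using tail AE_space
      proof eventually_elim
        case (elim x)
        then obtain n where "E n (g s x) x" using s unfolding E_def by blast
        then show ?case using elim(2) by blast
      qed
    qed
    ultimately show ?thesis by simp
  qed
  have "(\<lambda>n. \<Sum>s<4. prob {x \<in> space M. E n (g s x) x}) \<longlonglongrightarrow> (\<Sum>s<(4::nat). 1)"
    by (intro tendsto_sum lim) simp
  then have "(\<Sum>s<(4::nat). 1) \<le> (2::real)"
    by (rule LIMSEQ_le_const2) (use bound in auto)
  then show False by simp
qed

section \<open>Cylinder sets\<close>

abbreviation seq_algebra :: "(nat \<Rightarrow> nat) measure"
  where "seq_algebra \<equiv> PiM UNIV (\<lambda>_. count_space UNIV)"

definition cyl :: "nat \<Rightarrow> (nat \<Rightarrow> nat) \<Rightarrow> (nat \<Rightarrow> nat) set"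
  where "cyl N x = {y. \<forall>j<N. y j = x j}"

lemma space_seq_algebra [simp]: "space seq_algebra = UNIV"
  by (simp add: space_PiM)

lemma nth_measurable: "(\<lambda>x. x j) \<in> seq_algebra \<rightarrow>\<^sub>M count_space UNIV"
  by (rule measurable_component_singleton) simp

lemma pred_nth_eq: "Measurable.pred seq_algebra (\<lambda>x. x j = v)"
  by (rule measurable_compose[OF nth_measurable]) simp

lemma cyl_sets: "cyl N x \<in> sets seq_algebra"
proof -
  have "Measurable.pred seq_algebra (\<lambda>y. \<forall>j<N. y j = x j)"
    by (intro pred_intros_finite pred_intros_countable pred_intros_logic pred_nth_eq) auto
  then show ?thesis by (simp add: cyl_def Measurable.pred_def)
qed

lemma countable_cyl: "countable (\<Union>N. range (cyl N))"
proof (rule countable_subset)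
  show "(\<Union>N. range (cyl N)) \<subseteq> (\<lambda>l. {y. \<forall>j<length l. y j = l ! j}) ` (UNIV :: nat list set)"
  proof clarify
    fix N x
    have "cyl N x = {y. \<forall>j<length (map x [0..<N]). y j = map x [0..<N] ! j}"
      by (simp add: cyl_def)
    then show "cyl N x \<in> (\<lambda>l. {y. \<forall>j<length l. y j = l ! j}) ` UNIV" by blast
  qed
qed auto

text \<open>
  Two cylinders are nested or disjoint, so any collection of cylinders containing all small cylinders
  around each point is both a basis and closed under intersections. This allows testing measures only on
  those cylinders that a given transformation maps to cylinders.
\<close>

lemma cyl_basis:
  assumes sub: "B \<subseteq> (\<Union>N. range (cyl N))" and deep: "\<And>x. \<exists>N0. \<forall>N\<ge>N0. cyl N x \<in> B"
  shows "Int_stable (insert {} B)" "sets seq_algebra = sigma_sets UNIV (insert {} B)" "countable B" "\<Union>B = UNIV"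
proof -
  show "Int_stable (insert {} B)"
  proof (rule Int_stableI)
    fix C D assume CD: "C \<in> insert {} B" "D \<in> insert {} B"
    show "C \<inter> D \<in> insert {} B"
    proof (cases "C \<inter> D = {}")
      case False
      then obtain z where z: "z \<in> C" "z \<in> D" by blast
      obtain N x M y where "C = cyl N x" "D = cyl M y" using CD sub False by blast
      with z have "C = cyl N z" "D = cyl M z" by (auto simp: cyl_def)
      then have "C \<subseteq> D \<or> D \<subseteq> C"
        by (cases "N \<le> M") (auto simp: cyl_def)
      then show ?thesis using CD by (metis Int_absorb1 Int_absorb2)
    qed simp
  qed
  show cB: "countable B" using sub countable_cyl countable_subset by blast
  have open_sets: "A \<in> sigma_sets UNIV (insert {} B)" if A: "\<And>x. x \<in> A \<Longrightarrow> \<exists>N. cyl N x \<subseteq> A" for A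
  proof -
    have "A \<subseteq> \<Union>{C \<in> B. C \<subseteq> A}"
    proof
      fix x assume "x \<in> A"
      then obtain N where N: "cyl N x \<subseteq> A" using A by blast
      obtain N0 where "\<forall>N\<ge>N0. cyl N x \<in> B" using deep by blast
      then have "cyl (max N N0) x \<in> B" by simp
      moreover have "cyl (max N N0) x \<subseteq> cyl N x" "x \<in> cyl (max N N0) x" by (auto simp: cyl_def)
      ultimately show "x \<in> \<Union>{C \<in> B. C \<subseteq> A}" using N by blast
    qed
    then have "A = \<Union>{C \<in> B. C \<subseteq> A}" by blast
    moreover have "\<Union>{C \<in> B. C \<subseteq> A} \<in> sigma_sets UNIV (insert {} B)"
      by (rule sigma_sets_UNION) (use cB in \<open>auto intro: countable_subset[OF _ cB]\<close>)
    ultimately show ?thesis by simp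
  qed
  show "\<Union>B = UNIV"
  proof -
    have "x \<in> \<Union>B" for x
    proof -
    obtain N0 where "\<forall>N\<ge>N0. cyl N x \<in> B" using deep by blast
    then have "cyl N0 x \<in> B" by simp
    moreover have "x \<in> cyl N0 x" by (simp add: cyl_def)
    ultimately show "x \<in> \<Union>B" by blast
    qed
    then show ?thesis by blast
  qed
  show "sets seq_algebra = sigma_sets UNIV (insert {} B)"
  proof
    show "sigma_sets UNIV (insert {} B) \<subseteq> sets seq_algebra"
      using sub cyl_sets by (intro sets.sigma_sets_subset[of _ seq_algebra, simplified]) auto
    have "{f. f i \<in> A} \<in> sigma_sets UNIV (insert {} B)" for i :: nat and A :: "nat set"
    proof (rule open_sets)
      fix x assume "x \<in> {f. f i \<in> A}"
      then show "\<exists>N. cyl N x \<subseteq> {f. f i \<in> A}" by (intro exI[of _ "Suc i"]) (auto simp: cyl_def)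
    qed
    moreover have all: "(UNIV :: nat set) \<rightarrow>\<^sub>E space (count_space (UNIV :: nat set)) = UNIV"
      by (simp add: PiE_UNIV_domain)
    ultimately show "sets seq_algebra \<subseteq> sigma_sets UNIV (insert {} B)"
      unfolding sets_PiM_single all by (intro sigma_sets_mono) auto
  qed
qed

lemma open_in_seq_algebra:
  assumes "\<And>x. x \<in> A \<Longrightarrow> \<exists>N. cyl N x \<subseteq> A"
  shows "A \<in> sets seq_algebra"
proof -
  have "A \<subseteq> \<Union>{C \<in> (\<Union>N. range (cyl N)). C \<subseteq> A}"
  proof
    fix x assume "x \<in> A"
    then obtain N where "cyl N x \<subseteq> A" using assms by blast
    moreover have "x \<in> cyl N x" by (simp add: cyl_def)
    ultimately show "x \<in> \<Union>{C \<in> (\<Union>N. range (cyl N)). C \<subseteq> A}" by blast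
  qed
  then have "A = \<Union>{C \<in> (\<Union>N. range (cyl N)). C \<subseteq> A}" by blast
  moreover have "\<Union>{C \<in> (\<Union>N. range (cyl N)). C \<subseteq> A} \<in> sets seq_algebra"
    by (rule sets.countable_Union) (use cyl_sets in \<open>auto intro: countable_subset[OF _ countable_cyl]\<close>)
  ultimately show ?thesis by simp
qed

context switching_system
begin

lemma agree_cyl: "agree N y x \<longleftrightarrow> y \<in> cyl N x"
  by (simp add: agree_def cyl_def)

lemma gen_continuous: "\<exists>M. \<forall>y. agree M y x \<longrightarrow> agree N (gen s y) (gen s x)"
proof -
  obtain N0 where "\<forall>K\<ge>N0. (\<forall>y. agree K y x \<longleftrightarrow> agree K (gen s y) (gen s x)) \<and> ptype (gen s x) K = ptype x K"
    using gen_local by blast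
  then show ?thesis
    by (intro exI[of _ "max N0 N"]) (auto intro: agree_mono)
qed

lemma gen_measurable: "gen s \<in> seq_algebra \<rightarrow>\<^sub>M seq_algebra"
proof (rule measurable_PiM_single')
  fix j :: nat
  show "(\<lambda>x. gen s x j) \<in> seq_algebra \<rightarrow>\<^sub>M count_space UNIV"
  proof -
    have "(\<lambda>x. gen s x j) -` {v} \<inter> space seq_algebra \<in> sets seq_algebra" for v
    proof (rule open_in_seq_algebra)
      fix x assume x: "x \<in> (\<lambda>x. gen s x j) -` {v} \<inter> space seq_algebra"
      obtain M where M: "\<And>y. agree M y x \<Longrightarrow> agree (Suc j) (gen s y) (gen s x)"
        using gen_continuous by blast
      have "gen s y j = gen s x j" if "y \<in> cyl M x" for y
      proof -
        have "agree (Suc j) (gen s y) (gen s x)"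
          by (rule M) (simp only: agree_cyl that)
        then show ?thesis by (simp add: agree_def)
      qed
      then have "cyl M x \<subseteq> (\<lambda>x. gen s x j) -` {v} \<inter> space seq_algebra"
        using x by auto
      then show "\<exists>N. cyl N x \<subseteq> (\<lambda>x. gen s x j) -` {v} \<inter> space seq_algebra" ..
    qed
    then show ?thesis by (subst measurable_count_space_eq2_countable) auto
  qed
qed auto

section \<open>The two measures\<close>

definition digits :: "nat \<Rightarrow> nat set"
  where "digits j = {v. admissible j v}"

lemma digits_eq: "digits j = (if j < 2 then {..<k j} else {..k j})"
  by (auto simp: digits_def admissible_def)

lemma digits_finite: "finite (digits j)" "digits j \<noteq> {}"
  using admissible_zero[of j] by (simp_all add: digits_eq, auto simp: admissible_def lessThan_empty_iff k_pos)

definition digit_measure :: "(nat \<Rightarrow> nat) measure"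
  where "digit_measure = PiM UNIV (\<lambda>j. measure_pmf (pmf_of_set (digits j)))"

sublocale D: product_prob_space "\<lambda>j. measure_pmf (pmf_of_set (digits j))" UNIV
  by unfold_locales

lemma sets_digit_measure [measurable_cong]: "sets digit_measure = sets seq_algebra"
  unfolding digit_measure_def by (rule sets_PiM_cong) auto

lemma space_digit_measure [simp]: "space digit_measure = UNIV"
  by (simp add: digit_measure_def space_PiM)

lemma prob_space_digit_measure: "prob_space digit_measure"
  unfolding digit_measure_def by (rule D.P.prob_space_axioms)

definition settles :: "bool \<Rightarrow> (nat \<Rightarrow> nat) \<Rightarrow> bool"
  where "settles b x \<longleftrightarrow> (\<exists>N. \<forall>n\<ge>N. ptype x n = b)"

text \<open>
  The random edges determine at which levels the type changes; the initial type is then chosen so that the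
  final type is \<open>b\<close>.
\<close>

definition choose_type :: "bool \<Rightarrow> (nat \<Rightarrow> nat) \<Rightarrow> nat \<Rightarrow> nat"
  where "choose_type b z = z(0 := (if settles b (z(0 := 0)) then 0 else 1))"

definition type_measure :: "bool \<Rightarrow> (nat \<Rightarrow> nat) measure"
  where "type_measure b = distr digit_measure seq_algebra (choose_type b)"

lemma ptype_flip: "ptype (z(0 := 1)) n = (\<not> ptype (z(0 := 0)) n)"
  by (induction n) (auto simp: k0)

lemma not_settles_both: "settles b x \<Longrightarrow> \<not> settles (\<not> b) x"
  unfolding settles_def by (metis nle_le)

lemma settles_flip: "settles b (z(0 := 1)) \<longleftrightarrow> settles (\<not> b) (z(0 := 0))"
  unfolding settles_def ptype_flip by auto

text \<open>
  Changing the initial type changes the type on every level, so at most one of the two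
  initial types leads to the final type \<open>b\<close>.
\<close>

lemma choose_type_unique:
  assumes "x 0 \<le> 1" "\<And>j. 1 \<le> j \<Longrightarrow> x j = z j" "settles b x"
  shows "choose_type b z = x"
proof (cases "x 0 = 0")
  case True
  then have "x = z(0 := 0)" using assms(2) by (auto simp: fun_eq_iff)
  then show ?thesis using assms(3) by (simp add: choose_type_def)
next
  case False
  then have "x = z(0 := 1)" using assms(1,2) by (auto simp: fun_eq_iff)
  then show ?thesis
    using assms(3) not_settles_both[of "\<not> b" "z(0 := 0)"] unfolding choose_type_def
    by (auto simp: settles_flip simp del: One_nat_def)
qed

lemma settles_choose_type:
  assumes "\<exists>N. \<forall>n\<ge>N. z n \<noteq> k n"
  shows "settles b (choose_type b z)"
proof -
  obtain N where N: "\<And>n. N \<le> n \<Longrightarrow> z n \<noteq> k n" using assms by blast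
  let ?z = "z(0 := 0)"
  have "ptype ?z n = ptype ?z (Suc N)" if "Suc N \<le> n" for n
    using that by (induction n rule: dec_induct) (use N in auto)
  then have "settles (ptype ?z (Suc N)) ?z"
    unfolding settles_def by blast
  then have "settles b ?z \<or> settles (\<not> b) ?z"
    by (cases "ptype ?z (Suc N) = b") auto
  then show ?thesis
    using settles_flip[of b z] by (auto simp: choose_type_def)
qed

lemma pred_ptype: "Measurable.pred seq_algebra (\<lambda>x. ptype x n)"
proof (induction n)
  case 0
  then show ?case by (simp add: pred_nth_eq)
next
  case (Suc n)
  have "Measurable.pred seq_algebra (\<lambda>x. \<not> (ptype x n \<longleftrightarrow> x n = k n))"
    using Suc pred_nth_eq by (intro pred_intros_logic)
  then show ?case by simp
qed

lemma pred_settles: "Measurable.pred seq_algebra (settles b)"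
proof -
  have "Measurable.pred seq_algebra (\<lambda>x. ptype x n \<longleftrightarrow> b)" for n
    using pred_ptype[of n] by (cases b) (auto intro: pred_intros_logic)
  then have "Measurable.pred seq_algebra (\<lambda>x. \<exists>N. \<forall>n. N \<le> n \<longrightarrow> (ptype x n \<longleftrightarrow> b))"
    by (intro pred_intros_countable pred_intros_logic pred_ptype) auto
  then show ?thesis unfolding settles_def .
qed

lemma upd_0_measurable: "(\<lambda>x. x(0 := c)) \<in> seq_algebra \<rightarrow>\<^sub>M seq_algebra"
proof (rule measurable_PiM_single')
  show "(\<lambda>x. (x(0 := c)) j) \<in> seq_algebra \<rightarrow>\<^sub>M count_space UNIV" for j :: nat
    by (cases "j = 0") (auto simp: nth_measurable)
qed auto

lemma choose_type_measurable: "choose_type b \<in> seq_algebra \<rightarrow>\<^sub>M seq_algebra"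
proof (rule measurable_PiM_single')
  fix j :: nat
  have "Measurable.pred seq_algebra (\<lambda>x. settles b (x(0 := 0)))"
    by (rule measurable_compose[OF upd_0_measurable pred_settles])
  then have "(\<lambda>x. if settles b (x(0 := 0)) then 0 else 1 :: nat) \<in> seq_algebra \<rightarrow>\<^sub>M count_space UNIV"
    by (intro measurable_If) (auto simp: Measurable.pred_def)
  then show "(\<lambda>x. choose_type b x j) \<in> seq_algebra \<rightarrow>\<^sub>M count_space UNIV"
    by (cases "j = 0") (auto simp: choose_type_def nth_measurable)
qed auto

lemma choose_type_measurable': "choose_type b \<in> digit_measure \<rightarrow>\<^sub>M seq_algebra"
  using choose_type_measurable measurable_cong_sets[OF sets_digit_measure HOL.refl] by blast

lemma sets_type_measure [simp]: "sets (type_measure b) = sets seq_algebra"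
  and space_type_measure [simp]: "space (type_measure b) = UNIV"
  by (simp_all add: type_measure_def)

sublocale T: prob_space "type_measure b" for b
  unfolding type_measure_def
  by (rule prob_space.prob_space_distr[OF prob_space_digit_measure choose_type_measurable'])

lemma AE_digit:
  assumes "\<And>v. v \<in> digits j \<Longrightarrow> P v"
  shows "AE z in digit_measure. P (z j)"
  unfolding digit_measure_def
  by (rule D.AE_component) (use assms digits_finite in \<open>auto simp: AE_measure_pmf_iff\<close>)

lemma prob_digit_eq: "measure digit_measure {z. z j = v} \<le> 1 / 2 ^ j"
proof -
  have "measure digit_measure {z. z j = v} = measure (distr digit_measure (measure_pmf (pmf_of_set (digits j))) (\<lambda>z. z j)) {v}"
    unfolding digit_measure_def by (subst measure_distr) (auto simp: vimage_def space_PiM intro: measurable_component_singleton)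
  also have "distr digit_measure (measure_pmf (pmf_of_set (digits j))) (\<lambda>z. z j) = measure_pmf (pmf_of_set (digits j))"
    unfolding digit_measure_def by (rule D.PiM_component) simp
  also have "measure (measure_pmf (pmf_of_set (digits j))) {v} \<le> 1 / card (digits j)"
    using digits_finite card_mono[of "{v}" "digits j \<inter> {v}"]
    by (subst measure_pmf_of_set) (auto simp: divide_simps card_gt_0_iff)
  also have "\<dots> \<le> 1 / 2 ^ j"
  proof -
    have "2 ^ j \<le> card (digits j)"
    proof (cases "j < 2")
      case True
      then have "j = 0 \<or> j = 1" by auto
      then show ?thesis by (auto simp: digits_eq k0)
    qed (use k_large[of j] in \<open>simp add: digits_eq\<close>)
    then have "(2::real) ^ j \<le> real (card (digits j))"
      by (metis of_nat_le_iff of_nat_numeral of_nat_power)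
    then show ?thesis by (intro frac_le) auto
  qed
  finally show ?thesis .
qed

text \<open>
  By the Borel--Cantelli lemma, as the probabilities are at most \<open>1 / 2 ^ n\<close>. For \<open>c = k\<close> this bounds
  the switches, for \<open>c = 0\<close> it excludes the rays.
\<close>

lemma AE_eventually_digit_neq: "AE z in digit_measure. \<exists>N. \<forall>n\<ge>N. z n \<noteq> c n"
proof -
  interpret P: prob_space digit_measure by (rule prob_space_digit_measure)
  have "{z. z n = c n} \<in> sets digit_measure" for n
    using pred_nth_eq[of n "c n"] by (simp add: sets_digit_measure Measurable.pred_def)
  moreover have "summable (\<lambda>n. measure digit_measure {z. z n = c n})"
  proof (rule summable_comparison_test'[of "\<lambda>n. (1/2) ^ n" 0])
    show "summable (\<lambda>n. (1/2 :: real) ^ n)"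
      by (rule summable_geometric) simp
  qed (use prob_digit_eq in \<open>simp add: power_one_over\<close>)
  ultimately have "AE z in digit_measure. eventually (\<lambda>n. z \<in> space digit_measure - {z. z n = c n}) sequentially"
    by (intro borel_cantelli_AE1) (auto simp: P.emeasure_eq_measure)
  then show ?thesis by eventually_elim (simp add: eventually_sequentially)
qed

lemma AE_type_measure: "AE x in type_measure b. x \<in> paths \<and> settles b x \<and> \<not> ray x"
proof -
  have "AE x in digit_measure. \<forall>j. admissible j (x j)"
    using AE_digit[of _ "admissible _"] by (simp add: AE_all_countable digits_def)
  then have "AE x in digit_measure. choose_type b x \<in> paths \<and> settles b (choose_type b x) \<and> \<not> ray (choose_type b x)"
    using AE_eventually_digit_neq[of k] AE_eventually_digit_neq[of "\<lambda>_. 0"]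
  proof eventually_elim
    case (elim x)
    have "choose_type b x \<in> paths"
      using elim(1) by (auto simp: paths_def choose_type_def admissible_def k0)
    moreover have "\<not> ray (choose_type b x)"
    proof -
      obtain N where "\<forall>n\<ge>N. x n \<noteq> 0" using elim(3) by blast
      then have "choose_type b x (Suc N) \<noteq> 0" by (simp add: choose_type_def)
      then show ?thesis unfolding ray_def by force
    qed
    ultimately show ?case using settles_choose_type[OF elim(2)] by simp
  qed
  moreover have "{x \<in> space seq_algebra. x \<in> paths \<and> settles b x \<and> \<not> ray x} \<in> sets seq_algebra"
  proof -
    have "Measurable.pred seq_algebra (\<lambda>x. admissible j (x j))" for j
      by (rule measurable_compose[OF nth_measurable]) simp
    then have "Measurable.pred seq_algebra (\<lambda>x. (\<forall>j. admissible j (x j)) \<and> settles b x \<and> \<not> (\<forall>j. 1 \<le> j \<longrightarrow> x j = 0))"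
      by (intro pred_intros_countable pred_intros_logic pred_settles pred_nth_eq) auto
    then show ?thesis by (simp add: Measurable.pred_def paths_def ray_def)
  qed
  ultimately show ?thesis
    unfolding type_measure_def by (subst AE_distr_iff[OF choose_type_measurable']) auto
qed

section \<open>Invariance\<close>

lemma bij_pmf_of_set:
  assumes "finite D" "D \<noteq> {}" "bij_betw f D D"
  shows "distr (measure_pmf (pmf_of_set D)) (measure_pmf (pmf_of_set D)) f = measure_pmf (pmf_of_set D)"
proof -
  have "map_pmf f (pmf_of_set D) = pmf_of_set D"
    by (rule map_pmf_of_set_bij_betw[OF assms(3,2,1)])
  moreover have "distr (measure_pmf (pmf_of_set D)) (measure_pmf (pmf_of_set D)) f
      = distr (measure_pmf (pmf_of_set D)) (count_space UNIV) f"
    by (rule distr_cong) auto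
  ultimately show ?thesis
    by (simp add: map_pmf_rep_eq[symmetric])
qed

lemma digit_measure_permute:
  assumes "\<And>j. bij_betw (f j) (digits j) (digits j)"
  shows "distr digit_measure digit_measure (\<lambda>z j. f j (z j)) = digit_measure"
proof -
  let ?g = "\<lambda>(z :: nat \<Rightarrow> nat) j. f j (z j)" and ?m = "\<lambda>j. measure_pmf (pmf_of_set (digits j))"
  have meas: "?g \<in> digit_measure \<rightarrow>\<^sub>M digit_measure"
    unfolding digit_measure_def
    by (rule measurable_PiM_single')
      (auto intro!: measurable_compose[OF measurable_component_singleton] simp: space_PiM)
  have "distr digit_measure digit_measure ?g = PiM UNIV ?m"
  proof (rule D.PiM_eq)
    show "sets (distr digit_measure digit_measure ?g) = sets (PiM UNIV ?m)"
      by (simp add: digit_measure_def)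
  next
    fix J :: "nat set" and F assume J: "finite J" "J \<subseteq> UNIV" and F: "\<And>j. j \<in> J \<Longrightarrow> F j \<in> sets (?m j)"
    have emb: "prod_emb UNIV ?m J (Pi\<^sub>E J G) = {z \<in> space digit_measure. \<forall>j\<in>J. z j \<in> G j}" for G
      by (auto simp: prod_emb_def PiE_def Pi_def extensional_def restrict_def)
    have set: "{z \<in> space digit_measure. \<forall>j\<in>J. z j \<in> G j} \<in> sets digit_measure" for G
    proof -
      have "prod_emb UNIV ?m J (Pi\<^sub>E J G) \<in> sets (PiM UNIV ?m)"
        by (rule sets_PiM_I) (use J in auto)
      then show ?thesis unfolding emb digit_measure_def .
    qed
    have "emeasure (distr digit_measure digit_measure ?g) (prod_emb UNIV ?m J (Pi\<^sub>E J F)) =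
        emeasure digit_measure (?g -` {z \<in> space digit_measure. \<forall>j\<in>J. z j \<in> F j} \<inter> space digit_measure)"
      unfolding emb by (rule emeasure_distr[OF meas set])
    also have "?g -` {z \<in> space digit_measure. \<forall>j\<in>J. z j \<in> F j} \<inter> space digit_measure =
        {z \<in> space (PiM UNIV ?m). \<forall>j\<in>J. z j \<in> f j -` F j}"
      by (auto simp: space_PiM)
    also have "emeasure digit_measure \<dots> = (\<Prod>j\<in>J. emeasure (?m j) (f j -` F j))"
      unfolding digit_measure_def by (rule D.emeasure_PiM_Collect) (use J in auto)
    also have "\<dots> = (\<Prod>j\<in>J. emeasure (distr (?m j) (?m j) (f j)) (F j))"
      by (intro prod.cong HOL.refl) (simp add: emeasure_distr)
    also have "\<dots> = (\<Prod>j\<in>J. emeasure (?m j) (F j))"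
      using bij_pmf_of_set[OF digits_finite assms] by simp
    finally show "emeasure (distr digit_measure digit_measure ?g) (prod_emb UNIV ?m J (Pi\<^sub>E J F)) =
      (\<Prod>j\<in>J. emeasure (?m j) (F j))" .
  qed
  then show ?thesis by (simp add: digit_measure_def)
qed

text \<open>
  Exchanging the values of \<open>p\<close> and \<open>q\<close> on the levels below \<open>N\<close> preserves the distribution of the
  edges. Since both prefixes end with the same type and the later switches are unaffected, it
  takes the paths of final type \<open>b\<close> through \<open>p\<close> to those through \<open>q\<close>.
\<close>

lemma cyl_measure_le:
  assumes N: "1 \<le> N" and t: "ptype p N = ptype q N" and pq: "\<And>j. j < N \<Longrightarrow> admissible j (p j)" "\<And>j. j < N \<Longrightarrow> admissible j (q j)"
  shows "measure (type_measure b) (cyl N p) \<le> measure (type_measure b) (cyl N q)"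
proof -
  interpret P: prob_space digit_measure by (rule prob_space_digit_measure)
  define f where "f j = (if j < N then Transposition.transpose (p j) (q j) else id)" for j
  let ?g = "\<lambda>(z :: nat \<Rightarrow> nat) j. f j (z j)"
  have bij: "bij_betw (f j) (digits j) (digits j)" for j
    using pq by (cases "j < N") (auto simp: f_def digits_def intro!: bij_betw_transpose_iff)
  have inv: "distr digit_measure digit_measure ?g = digit_measure"
    by (rule digit_measure_permute[OF bij])
  have gm: "?g \<in> digit_measure \<rightarrow>\<^sub>M digit_measure"
    unfolding digit_measure_def
    by (rule measurable_PiM_single')
      (auto intro!: measurable_compose[OF measurable_component_singleton] simp: space_PiM)
  let ?c = "choose_type b"
  have cs: "?c -` cyl N x \<in> sets digit_measure" for x
    using measurable_sets[OF choose_type_measurable' cyl_sets, of b N x] by simp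
  have "measure (type_measure b) (cyl N p) = P.prob (?c -` cyl N p)"
    unfolding type_measure_def by (subst measure_distr[OF choose_type_measurable' cyl_sets]) simp
  also have "\<dots> \<le> P.prob (?g -` (?c -` cyl N q) \<inter> space digit_measure)"
  proof (rule P.finite_measure_mono_AE)
    show "AE z in digit_measure. z \<in> ?c -` cyl N p \<longrightarrow> z \<in> ?g -` (?c -` cyl N q) \<inter> space digit_measure"
      using AE_eventually_digit_neq[of k]
    proof eventually_elim
      case (elim z)
      show ?case
      proof
        assume z: "z \<in> ?c -` cyl N p"
        define x where "x = ?c z"
        define y where "y = (\<lambda>j. if j < N then q j else x j)"
        have x: "x j = p j" if "j < N" for j
          using z that by (simp add: cyl_def x_def)
        have x': "x j = z j" if "1 \<le> j" for j
          using that by (simp add: x_def choose_type_def)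
        have "ptype y N = ptype q N" "ptype x N = ptype p N"
          by (rule ptype_agree[OF _ N]; simp add: agree_def y_def x)+
        then have "ptype y n = ptype x n" if "N \<le> n" for n
          using that t by (intro ptype_cong[of N n]) (auto simp: y_def)
        moreover have "settles b x"
          unfolding x_def by (rule settles_choose_type[OF elim])
        ultimately have "settles b y"
          unfolding settles_def by (metis nat_le_linear order_trans)
        moreover have "y 0 \<le> 1"
          using pq(2)[of 0] N by (simp add: y_def admissible_def k0)
        moreover have "y j = ?g z j" if "1 \<le> j" for j
          using x[of j] x'[OF that] by (simp add: y_def f_def)
        ultimately have "?c (?g z) = y"
          by (intro choose_type_unique)
        then show "z \<in> ?g -` (?c -` cyl N q) \<inter> space digit_measure"
          by (simp add: cyl_def y_def)
      qed
    qed
    show "?g -` (?c -` cyl N q) \<inter> space digit_measure \<in> P.events"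
      by (rule measurable_sets[OF gm cs])
  qed
  also have "\<dots> = measure (distr digit_measure digit_measure ?g) (?c -` cyl N q)"
    by (rule measure_distr[OF gm cs, symmetric])
  also have "\<dots> = measure (type_measure b) (cyl N q)"
    unfolding inv type_measure_def by (subst measure_distr[OF choose_type_measurable' cyl_sets]) simp
  finally show ?thesis .
qed

lemma cyl_measure_bad:
  assumes "j < N" "\<not> admissible j (x j)"
  shows "measure (type_measure b) (cyl N x) = 0"
proof -
  have "AE y in type_measure b. y \<notin> cyl N x"
    using AE_type_measure
  proof eventually_elim
    case (elim y)
    then have "admissible j (y j)" by (simp add: paths_def)
    then have "y j \<noteq> x j" using assms(2) by metis
    then show ?case using assms(1) by (auto simp: cyl_def)
  qed
  then show ?thesis
    by (simp add: T.prob_eq_0 cyl_sets)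
qed

lemma cyl_measure_eq:
  assumes N: "1 \<le> N" and t: "ptype p N = ptype q N" and pq: "\<And>j. j < N \<Longrightarrow> admissible j (p j) \<longleftrightarrow> admissible j (q j)"
  shows "measure (type_measure b) (cyl N p) = measure (type_measure b) (cyl N q)"
proof (cases "\<forall>j<N. admissible j (p j)")
  case True
  then show ?thesis
    using cyl_measure_le[OF N t] cyl_measure_le[OF N t[symmetric]] pq by (intro antisym) auto
next
  case False
  then obtain j where "j < N" "\<not> admissible j (p j)" "\<not> admissible j (q j)" using pq by blast
  then show ?thesis using cyl_measure_bad[of j N p b] cyl_measure_bad[of j N q b] by simp
qed

lemma gen_measurable_type: "gen s \<in> type_measure b \<rightarrow>\<^sub>M type_measure b"
  using gen_measurable measurable_cong_sets[OF sets_type_measure sets_type_measure] by blast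

text \<open>
  A generator maps small cylinders onto cylinders with the same length and final type, hence of the same
  measure.
\<close>

lemma gen_preserves: "distr (type_measure b) (type_measure b) (gen s) = type_measure b"
proof -
  let ?m = "type_measure b"
  define B where "B = {cyl N x | N x. 1 \<le> N \<and> ptype (gen s x) N = ptype x N \<and>
    gen s -` cyl N x = cyl N (gen s x)}"
  have sub: "B \<subseteq> (\<Union>N. range (cyl N))"
    by (auto simp: B_def)
  have deep: "\<exists>N0. \<forall>N\<ge>N0. cyl N x \<in> B" for x
  proof -
    obtain N0 where N0: "\<forall>N\<ge>N0. (\<forall>y. agree N y (gen s x) \<longleftrightarrow> agree N (gen s y) (gen s (gen s x)))
        \<and> ptype (gen s (gen s x)) N = ptype (gen s x) N"
      using gen_local by blast
    have "cyl N x \<in> B" if "max N0 1 \<le> N" for N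
    proof -
      have "gen s -` cyl N x = cyl N (gen s x)"
        using N0 that by (auto simp: agree_cyl[symmetric] gen_invol)
      moreover have "ptype (gen s x) N = ptype x N"
        using N0 that by (auto simp: gen_invol)
      ultimately show ?thesis using that unfolding B_def by auto
    qed
    then show ?thesis by blast
  qed
  note basis = cyl_basis[OF sub deep]
  show ?thesis
  proof (rule measure_eqI_generator_eq_countable[where \<Omega> = UNIV and E = "insert {} B" and A = B])
    fix C assume C: "C \<in> insert {} B"
    show "emeasure (distr ?m ?m (gen s)) C = emeasure ?m C"
    proof (cases "C = {}")
      case False
      then obtain N x where x: "C = cyl N x" "1 \<le> N" "ptype (gen s x) N = ptype x N"
          "gen s -` cyl N x = cyl N (gen s x)"
        using C unfolding B_def by blast
      have "emeasure (distr ?m ?m (gen s)) C = emeasure ?m (cyl N (gen s x))"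
        using x by (subst emeasure_distr[OF gen_measurable_type]) (auto simp: cyl_sets)
      also have "\<dots> = emeasure ?m (cyl N x)"
        using cyl_measure_eq[OF x(2,3)] by (simp add: T.emeasure_eq_measure admissible_gen)
      finally show ?thesis by (simp add: x(1))
    qed simp
  next
    fix C
    show "emeasure (distr ?m ?m (gen s)) C \<noteq> \<infinity>"
      using finite_measure.emeasure_finite[OF prob_space.finite_measure[OF T.prob_space_distr[OF gen_measurable_type]]]
      by simp
  qed (use basis in auto)
qed

sublocale I: pmp_involutions "type_measure b" gen for b
  by unfold_locales (auto simp: gen_measurable_type gen_preserves gen_invol)

lemma act_measurable: "act w \<in> seq_algebra \<rightarrow>\<^sub>M seq_algebra"
  using I.fold_g_meas[of w True] measurable_cong_sets[OF sets_type_measure sets_type_measure]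
  unfolding act_def by blast

lemma act_prob: "A \<in> sets seq_algebra \<Longrightarrow> measure (type_measure b) (act w -` A) = measure (type_measure b) A"
proof (induction w)
  case (Cons s w)
  have "act (s # w) -` A = gen s -` (act w -` A) \<inter> space (type_measure b)"
    by auto
  moreover have "act w -` A \<in> sets (type_measure b)"
    using measurable_sets[OF act_measurable Cons.prems, of w] by simp
  ultimately have "measure (type_measure b) (act (s # w) -` A) = measure (type_measure b) (act w -` A)"
    by (simp only: I.prob_g_vimage)
  then show ?case
    by (simp only: Cons.IH[OF Cons.prems])
qed (simp add: vimage_def)

section \<open>Generic paths\<close>

definition generic :: "bool \<Rightarrow> (nat \<Rightarrow> nat) set"
  where "generic b = {x \<in> paths. settles b x \<and> (\<forall>w. \<not> ray (act w x))}"

lemma AE_generic: "AE x in type_measure b. x \<in> generic b"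
proof -
  have "AE x in type_measure b. \<forall>w. \<not> ray (act w x)"
    unfolding act_def by (rule I.AE_fold_g) (use AE_type_measure in eventually_elim, simp)
  with AE_type_measure show ?thesis
    by eventually_elim (simp add: generic_def)
qed

text \<open>
  Once the path has settled on \<open>True\<close>, a word acts on far coordinates by left multiplication with a nontrivial
  element of a finite group.
\<close>

lemma generic_True_free:
  assumes "x \<in> generic True" "set w \<subseteq> {..<4}" "distinct_adj w" "w \<noteq> []"
  shows "act w x \<noteq> x"
proof -
  obtain N where N: "\<And>j. N \<le> j \<Longrightarrow> act w x j = (if ptype x j then fold (L j) w (x j) else x j)"
    using act_asymptotic[of x w] assms by (auto simp: generic_def)
  obtain M where M: "\<And>j. M \<le> j \<Longrightarrow> ptype x j"
    using assms(1) by (auto simp: generic_def settles_def)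
  define j where "j = max (max N M) (max 2 (length w))"
  have "M \<le> j" by (simp add: j_def)
  then have "ptype x j" "ptype x (Suc j)" using M[of j] M[of "Suc j"] by (simp_all del: ptype.simps)
  then have "x j \<noteq> k j" by simp
  moreover have "admissible j (x j)"
    using assms(1) by (simp add: generic_def paths_def)
  ultimately have "x j < k j"
    by (simp add: admissible_def split: if_splits)
  have "length w \<le> j" "2 \<le> j" by (simp_all add: j_def)
  then have "fold (L j) w (x j) \<noteq> x j"
    using assms \<open>length w \<le> j\<close> \<open>2 \<le> j\<close> \<open>x j < k j\<close> by (intro L_free)
  moreover have "act w x j = fold (L j) w (x j)"
    using N[of j] \<open>ptype x j\<close> by (simp add: j_def)
  ultimately show ?thesis by auto
qed

text \<open>
  Once the path has settled on \<open>False\<close>, no left multiplications occur any more.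
\<close>

lemma generic_False_tail:
  assumes "x \<in> generic False" "set w \<subseteq> {..<4}"
  shows "\<exists>N. \<forall>j\<ge>N. act w x j = x j"
proof -
  obtain N where N: "\<And>j. N \<le> j \<Longrightarrow> act w x j = (if ptype x j then fold (L j) w (x j) else x j)"
    using act_asymptotic[of x w] assms by (auto simp: generic_def)
  obtain M where M: "\<And>j. M \<le> j \<Longrightarrow> \<not> ptype x j"
    using assms(1) by (auto simp: generic_def settles_def)
  show ?thesis
    by (rule exI[of _ "max N M"]) (use N M in auto)
qed

section \<open>Ergodicity\<close>

lemma invariant_cyl_measure_eq:
  assumes A: "A \<in> sets seq_algebra" "\<And>s. s < 4 \<Longrightarrow> gen s -` A = A"
    and N: "2 \<le> N" and pq: "p \<in> paths" "q \<in> paths" "ptype p N = ptype q N"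
  shows "measure (type_measure b) (A \<inter> cyl N p) = measure (type_measure b) (A \<inter> cyl N q)"
proof -
  obtain w where w: "set w \<subseteq> {..<4}" "\<And>x. agree N x p \<longleftrightarrow> agree N (act w x) q"
    using reach_paths[OF N pq] by blast
  have "set v \<subseteq> {..<4} \<Longrightarrow> act v -` A = A" for v
  proof (induction v)
    case (Cons s v)
    have "act (s # v) -` A = gen s -` (act v -` A)" by auto
    then show ?case using Cons A(2)[of s] by (simp del: act_Cons)
  qed (simp add: vimage_def)
  then have "act w -` (A \<inter> cyl N q) = A \<inter> cyl N p"
    using w by (auto simp: vimage_Int agree_cyl)
  then show ?thesis
    using act_prob[of "A \<inter> cyl N q" b w] A(1) cyl_sets by simp
qed

text \<open>
  One path for each prefix of length \<open>N\<close> that ends with type \<open>b\<close>.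
\<close>

definition reps :: "nat \<Rightarrow> bool \<Rightarrow> (nat \<Rightarrow> nat) set"
  where "reps N b = {p \<in> paths. (\<forall>j\<ge>N. p j = 0) \<and> ptype p N = b}"

lemma finite_reps: "finite (reps N b)"
proof (rule finite_subset)
  show "reps N b \<subseteq> {p. \<forall>j. (j \<in> {..<N} \<longrightarrow> p j \<in> {..Max (k ` {..<N})}) \<and> (j \<notin> {..<N} \<longrightarrow> p j = 0)}"
  proof clarify
    fix p j assume p: "p \<in> reps N b"
    then have "admissible j (p j)" by (simp add: reps_def paths_def)
    then have "p j \<le> k j" by (simp add: admissible_def split: if_splits)
    then show "(j \<in> {..<N} \<longrightarrow> p j \<in> {..Max (k ` {..<N})}) \<and> (j \<notin> {..<N} \<longrightarrow> p j = 0)"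
      using p by (auto simp: reps_def intro: order_trans[OF _ Max_ge])
  qed
qed (rule finite_set_of_finite_funs; simp)

lemma measure_split_reps:
  assumes B: "B \<in> sets seq_algebra" and N: "1 \<le> N" and MN: "M \<le> N"
  shows "measure (type_measure b) (B \<inter> {x. ptype x N = b} \<inter> cyl M c)
    = (\<Sum>p\<in>{p \<in> reps N b. p \<in> cyl M c}. measure (type_measure b) (B \<inter> cyl N p))"
proof -
  let ?V = "{p \<in> reps N b. p \<in> cyl M c}"
  have fin: "finite ?V" using finite_reps by simp
  have types: "{x. ptype x N = b} \<in> sets seq_algebra"
  proof -
    have "Measurable.pred seq_algebra (\<lambda>x. ptype x N \<longleftrightarrow> b)"
      by (intro pred_intros_logic pred_ptype) auto
    then show ?thesis by (simp add: Measurable.pred_def)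
  qed
  have "measure (type_measure b) (B \<inter> {x. ptype x N = b} \<inter> cyl M c)
      = measure (type_measure b) (\<Union>p\<in>?V. B \<inter> cyl N p)"
  proof (rule T.finite_measure_eq_AE)
    show "AE x in type_measure b. x \<in> B \<inter> {x. ptype x N = b} \<inter> cyl M c \<longleftrightarrow> x \<in> (\<Union>p\<in>?V. B \<inter> cyl N p)"
      using AE_type_measure[of b]
    proof eventually_elim
      case (elim x)
      show ?case
      proof
        assume x: "x \<in> B \<inter> {x. ptype x N = b} \<inter> cyl M c"
        define p where "p = (\<lambda>j. if j < N then x j else 0)"
        have a: "agree N x p" by (simp add: agree_def p_def)
        have "p \<in> reps N b"
          using elim x ptype_agree[OF a N, of N] by (auto simp: reps_def paths_def p_def)
        moreover have "p \<in> cyl M c" using x MN by (auto simp: cyl_def p_def)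
        ultimately show "x \<in> (\<Union>p\<in>?V. B \<inter> cyl N p)"
          using x a by (auto simp: agree_cyl)
      next
        assume "x \<in> (\<Union>p\<in>?V. B \<inter> cyl N p)"
        then obtain p where p: "p \<in> reps N b" "p \<in> cyl M c" "x \<in> B" "x \<in> cyl N p" by auto
        have "ptype x N = b"
          using p ptype_agree[of N x p N] N by (auto simp: agree_cyl reps_def)
        moreover have "x \<in> cyl M c" using p(2,4) MN by (auto simp: cyl_def)
        ultimately show "x \<in> B \<inter> {x. ptype x N = b} \<inter> cyl M c" using p(3) by simp
      qed
    qed
  qed (use B types cyl_sets fin in auto)
  also have "\<dots> = (\<Sum>p\<in>?V. measure (type_measure b) (B \<inter> cyl N p))"
  proof (rule T.finite_measure_finite_Union[OF fin])
    show "disjoint_family_on (\<lambda>p. B \<inter> cyl N p) ?V"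
      unfolding disjoint_family_on_def
    proof (intro ballI impI)
      fix p q assume pq: "p \<in> ?V" "q \<in> ?V" "p \<noteq> q"
      have "False" if "x \<in> cyl N p" "x \<in> cyl N q" for x
      proof -
        have "p j = q j" for j
        proof (cases "j < N")
          case True
          then show ?thesis using that by (auto simp: cyl_def)
        qed (use pq in \<open>simp add: reps_def\<close>)
        then show False using pq(3) by auto
      qed
      then show "B \<inter> cyl N p \<inter> (B \<inter> cyl N q) = {}" by blast
    qed
  qed (use B cyl_sets in auto)
  finally show ?thesis .
qed

lemma prob_type_tendsto: 
  assumes B: "B \<in> sets seq_algebra"
  shows "(\<lambda>N. measure (type_measure b) (B \<inter> {x. ptype x N = b})) \<longlonglongrightarrow> measure (type_measure b) B"
proof -
  have types: "{x. ptype x N = b} \<in> sets seq_algebra" for N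
  proof -
    have "Measurable.pred seq_algebra (\<lambda>x. ptype x N \<longleftrightarrow> b)"
      by (intro pred_intros_logic pred_ptype) auto
    then show ?thesis by (simp add: Measurable.pred_def)
  qed
  let ?m = "type_measure b"
  \<comment> \<open>G n collects the paths that have type b from level n on.\<close>
  define G where "G n = (\<Inter>j\<in>{n..}. {x. ptype x j = b})" for n
  have G: "G n \<in> sets seq_algebra" for n
    unfolding G_def by (rule sets.countable_INT') (use types in auto)
  have "(\<lambda>n. measure ?m (B \<inter> G n)) \<longlonglongrightarrow> measure ?m (\<Union>n. B \<inter> G n)"
  proof (rule T.finite_Lim_measure_incseq)
    show "incseq (\<lambda>n. B \<inter> G n)"
      unfolding incseq_def G_def by fastforce
  qed (use B G in auto)
  also have "measure ?m (\<Union>n. B \<inter> G n) = measure ?m B"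
  proof (rule T.finite_measure_eq_AE)
    show "AE x in ?m. x \<in> (\<Union>n. B \<inter> G n) \<longleftrightarrow> x \<in> B"
      using AE_type_measure[of b] by eventually_elim (auto simp: settles_def G_def)
  qed (use B G in auto)
  finally have lim: "(\<lambda>n. measure ?m (B \<inter> G n)) \<longlonglongrightarrow> measure ?m B" .
  show ?thesis
  proof (rule tendsto_sandwich[OF _ _ lim tendsto_const])
    show "\<forall>\<^sub>F n in sequentially. measure ?m (B \<inter> G n) \<le> measure ?m (B \<inter> {x. ptype x n = b})"
      by (intro always_eventually allI T.finite_measure_mono) (use B types in \<open>auto simp: G_def\<close>)
    show "\<forall>\<^sub>F n in sequentially. measure ?m (B \<inter> {x. ptype x n = b}) \<le> measure ?m B"
      by (intro always_eventually allI T.finite_measure_mono) (use B in auto)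
  qed
qed

text \<open>
  On the prefixes of length \<open>N\<close> with final type \<open>b\<close>, the measure of the cylinder and its intersection
  with \<open>A\<close> are constant, so restricted to the event that level \<open>N\<close> has type \<open>b\<close> the set \<open>A\<close>
  is independent of any cylinder of length at most \<open>N\<close>. The probability of this event tends to 1.
\<close>

lemma invariant_indep_cyl:
  assumes A: "A \<in> sets seq_algebra" "\<And>s. s < 4 \<Longrightarrow> gen s -` A = A"
  shows "measure (type_measure b) (A \<inter> cyl M c) = measure (type_measure b) A * measure (type_measure b) (cyl M c)"
proof -
  let ?P = "measure (type_measure b)" and ?H = "\<lambda>N. {x. ptype x N = b}"
  have UNIV_sets: "UNIV \<in> sets seq_algebra"
    using sets.top[of seq_algebra] by simp
  have eq: "?P (A \<inter> cyl M c \<inter> ?H N) * ?P (UNIV \<inter> ?H N) = ?P (A \<inter> ?H N) * ?P (cyl M c \<inter> ?H N)"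
    if N: "max 2 M \<le> N" for N
  proof (cases "reps N b = {}")
    case True
    then show ?thesis
      using measure_split_reps[OF UNIV_sets, of N 0 b c] measure_split_reps[OF A(1), of N 0 b c] N by (simp add: cyl_def)
  next
    case False
    then obtain r where r: "r \<in> reps N b" by blast
    have same: "?P (B \<inter> cyl N p) = ?P (B \<inter> cyl N r)" if "p \<in> reps N b"
      "B \<in> sets seq_algebra" "\<And>s. s < 4 \<Longrightarrow> gen s -` B = B" for p B
      by (rule invariant_cyl_measure_eq) (use that r N in \<open>auto simp: reps_def\<close>)
    have split: "?P (B \<inter> ?H N \<inter> cyl K c) = card {p \<in> reps N b. p \<in> cyl K c} * ?P (B \<inter> cyl N r)"
      if "B \<in> sets seq_algebra" "\<And>s. s < 4 \<Longrightarrow> gen s -` B = B" "K \<le> N" for B K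
      using measure_split_reps[OF that(1), of N K b c] that(3) N same[OF _ that(1,2)] by simp
    have cyl0: "cyl 0 c = UNIV" by (simp add: cyl_def)
    have "?P (A \<inter> ?H N \<inter> cyl M c) * ?P (UNIV \<inter> ?H N \<inter> cyl 0 c)
        = ?P (A \<inter> ?H N \<inter> cyl 0 c) * ?P (UNIV \<inter> ?H N \<inter> cyl M c)"
      using split[OF A, of M] split[OF A, of 0] split[OF UNIV_sets, of M] split[OF UNIV_sets, of 0] N by simp
    then show ?thesis by (simp add: cyl0 Int_ac)
  qed
  have lim1: "(\<lambda>N. ?P (A \<inter> cyl M c \<inter> ?H N) * ?P (UNIV \<inter> ?H N)) \<longlonglongrightarrow> ?P (A \<inter> cyl M c) * ?P UNIV"
    by (intro tendsto_mult prob_type_tendsto) (use A cyl_sets UNIV_sets in auto)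
  have lim2: "(\<lambda>N. ?P (A \<inter> ?H N) * ?P (cyl M c \<inter> ?H N)) \<longlonglongrightarrow> ?P A * ?P (cyl M c)"
    by (intro tendsto_mult prob_type_tendsto) (use A cyl_sets in auto)
  have ev: "\<forall>\<^sub>F N in sequentially. ?P (A \<inter> cyl M c \<inter> ?H N) * ?P (UNIV \<inter> ?H N) = ?P (A \<inter> ?H N) * ?P (cyl M c \<inter> ?H N)"
    using eventually_ge_at_top[of "max 2 M"] by eventually_elim (rule eq)
  have "?P (A \<inter> cyl M c) * ?P UNIV = ?P A * ?P (cyl M c)"
    by (rule LIMSEQ_unique[OF Lim_transform_eventually[OF lim1 ev] lim2])
  then show ?thesis using T.prob_space[of b] by simp
qed

text \<open>
  An invariant set is independent of all cylinders, hence of itself.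
\<close>

lemma gen_ergodic:
  assumes A: "A \<in> sets seq_algebra" "\<And>s. s < 4 \<Longrightarrow> gen s -` A = A"
  shows "measure (type_measure b) A = 0 \<or> measure (type_measure b) A = 1"
proof -
  let ?B = "\<Union>N. range (cyl N)"
  have basis: "Int_stable (insert {} ?B)" "sets seq_algebra = sigma_sets UNIV (insert {} ?B)"
    using cyl_basis[of ?B] by blast+
  have "T.indep_set b {A} (insert {} ?B)"
    by (rule T.indep_setI) (use A cyl_sets invariant_indep_cyl[OF A] in auto)
  then have "T.indep_set b (sigma_sets (space (type_measure b)) {A}) (sigma_sets (space (type_measure b)) (insert {} ?B))"
    by (rule T.indep_set_sigma_sets) (use basis in \<open>auto simp: Int_stable_def\<close>)
  then have "measure (type_measure b) (A \<inter> A) = measure (type_measure b) A * measure (type_measure b) A"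
    by (rule T.indep_setD) (use A basis in auto)
  then show ?thesis by auto
qed

end

section \<open>The compact space\<close>

lemma fun_nbhd_cyl:
  fixes V :: "(nat \<Rightarrow> real) set"
  assumes "open V" "y \<in> V"
  shows "\<exists>M. \<forall>z. (\<forall>j<M. z j = y j) \<longrightarrow> z \<in> V"
proof -
  have "openin (product_topology (\<lambda>i. euclidean) UNIV) V"
    using assms(1) by (simp add: euclidean_product_topology)
  then obtain X where X: "y \<in> Pi\<^sub>E UNIV X" "finite {i. X i \<noteq> topspace euclidean}" "Pi\<^sub>E UNIV X \<subseteq> V"
    using product_topology_open_contains_basis[of "\<lambda>i. euclidean" UNIV V y] assms(2) by blast
  obtain M where M: "\<forall>i\<in>{i. X i \<noteq> topspace euclidean}. i < M"
    using X(2) by (meson finite_nat_set_iff_bounded)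
  have "z \<in> V" if "\<forall>j<M. z j = y j" for z
  proof -
    have "z i \<in> X i" for i
    proof (cases "i < M")
      case True
      then show ?thesis using that X(1) by (auto simp: PiE_def Pi_def)
    next
      case False
      then have "X i = UNIV" using M by auto
      then show ?thesis by simp
    qed
    then show ?thesis using X(3) by (auto simp: PiE_def)
  qed
  then show ?thesis by blast
qed

lemma open_unit_box: "open {z :: nat \<Rightarrow> real. \<forall>i<M. \<bar>z i - y i\<bar> < 1}"
proof -
  have "open {f :: nat \<Rightarrow> real. \<forall>i\<in>{..<M}. f i \<in> ball (y i) 1}"
    by (rule product_topology_basis') auto
  then show ?thesis by (simp add: dist_real_def abs_minus_commute Ball_def)
qed

context switching_system
begin

definition emb :: "(nat \<Rightarrow> nat) \<Rightarrow> nat \<Rightarrow> real"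
  where "emb x = (\<lambda>n. real (x n))"

definition dec :: "(nat \<Rightarrow> real) \<Rightarrow> nat \<Rightarrow> nat"
  where "dec y = (\<lambda>n. nat \<lfloor>y n\<rfloor>)"

lemma dec_emb [simp]: "dec (emb x) = x"
  by (simp add: dec_def emb_def)

lemma emb_inj [simp]: "emb x = emb y \<longleftrightarrow> x = y"
  by (metis dec_emb)

definition seq_space :: "(nat \<Rightarrow> real) set"
  where "seq_space = emb ` paths"

lemma emb_seq_space [simp]: "emb x \<in> seq_space \<longleftrightarrow> x \<in> paths"
  by (auto simp: seq_space_def)

lemma dec_seq_space [simp]: "y \<in> seq_space \<Longrightarrow> dec y \<in> paths" "y \<in> seq_space \<Longrightarrow> emb (dec y) = y"
  by (auto simp: seq_space_def)

definition space_metric :: "(nat \<Rightarrow> real) metric"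
  where "space_metric = submetric euclidean_metric seq_space"

lemma mspace_space_metric [simp]: "mspace space_metric = seq_space"
  by (simp add: space_metric_def)

lemma mtopology_space_metric [simp]: "mtopology_of space_metric = top_of_set seq_space"
  by (simp add: space_metric_def mtopology_of_submetric)

lemma compact_seq_space: "compact seq_space"
proof -
  have "seq_space = Pi\<^sub>E UNIV (\<lambda>j. real ` digits j)"
  proof (intro equalityI subsetI)
    fix y assume "y \<in> Pi\<^sub>E UNIV (\<lambda>j. real ` digits j)"
    then have "\<forall>j. \<exists>v. y j = real v \<and> admissible j v" by (auto simp: PiE_def Pi_def digits_def)
    then obtain x where "\<And>j. y j = real (x j) \<and> admissible j (x j)" by metis
    then have "y = emb x" "x \<in> paths" by (auto simp: emb_def paths_def)
    then show "y \<in> seq_space" by simp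
  qed (auto simp: seq_space_def emb_def paths_def digits_def)
  moreover have "compactin (product_topology (\<lambda>i. euclidean) UNIV) (Pi\<^sub>E UNIV (\<lambda>j. real ` digits j))"
    using digits_finite by (subst compactin_PiE) (auto intro: finite_imp_compact)
  ultimately show ?thesis by (simp add: euclidean_product_topology)
qed

lemma dec_agree_box:
  assumes "y \<in> seq_space" "z \<in> seq_space" "\<forall>i<M. \<bar>z i - y i\<bar> < 1"
  shows "agree M (dec z) (dec y)"
proof -
  obtain a b where "y = emb a" "z = emb b" using assms by (auto simp: seq_space_def)
  moreover have "b i = a i" if "i < M" for i
    using assms(3) that calculation by (auto simp: emb_def)
  ultimately show ?thesis by (simp add: agree_def)
qed

lemma seq_space_nbhd:
  assumes "openin (top_of_set seq_space) U" "y \<in> U"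
  shows "\<exists>M. \<forall>z\<in>seq_space. agree M (dec z) (dec y) \<longrightarrow> z \<in> U"
proof -
  obtain V where V: "open V" "U = seq_space \<inter> V"
    using assms(1) by (auto simp: openin_open)
  then obtain M where M: "\<forall>z. (\<forall>j<M. z j = y j) \<longrightarrow> z \<in> V"
    using fun_nbhd_cyl[of V y] assms(2) by blast
  have "z \<in> U" if "z \<in> seq_space" "agree M (dec z) (dec y)" for z
  proof -
    have "z j = y j" if "j < M" for j
    proof -
      have "emb (dec z) j = emb (dec y) j"
        using that \<open>agree M (dec z) (dec y)\<close> by (simp add: emb_def agree_def)
      then show ?thesis using \<open>z \<in> seq_space\<close> assms(2) V by simp
    qed
    then show ?thesis using M V that by simp
  qed
  then show ?thesis by blast
qed

lemma seq_space_open: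
  assumes "U \<subseteq> seq_space" "\<And>y. y \<in> U \<Longrightarrow> \<exists>M. \<forall>z\<in>seq_space. agree M (dec z) (dec y) \<longrightarrow> z \<in> U"
  shows "openin (top_of_set seq_space) U"
proof (subst openin_subopen, intro ballI)
  fix y assume y: "y \<in> U"
  obtain M where M: "\<forall>z\<in>seq_space. agree M (dec z) (dec y) \<longrightarrow> z \<in> U"
    using assms(2)[OF y] by blast
  let ?W = "seq_space \<inter> {z. \<forall>i<M. \<bar>z i - y i\<bar> < 1}"
  have "openin (top_of_set seq_space) ?W"
    by (rule openin_open_Int) (rule open_unit_box)
  moreover have "?W \<subseteq> U"
    using M dec_agree_box assms(1) y by blast
  moreover have "y \<in> ?W" using y assms(1) by auto
  ultimately show "\<exists>T. openin (top_of_set seq_space) T \<and> y \<in> T \<and> T \<subseteq> U" by blast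
qed

definition move :: "nat list \<Rightarrow> (nat \<Rightarrow> real) \<Rightarrow> nat \<Rightarrow> real"
  where "move w = restrict (\<lambda>y. emb (act w (dec y))) seq_space"

lemma move_emb: "x \<in> paths \<Longrightarrow> move w (emb x) = emb (act w x)"
  by (simp add: move_def)

lemma move_seq_space: "y \<in> seq_space \<Longrightarrow> move w y \<in> seq_space"
  by (simp add: move_def act_paths)

lemma dec_move: "y \<in> seq_space \<Longrightarrow> dec (move w y) = act w (dec y)"
  by (simp add: move_def)

lemma move_append: "y \<in> seq_space \<Longrightarrow> move (v @ w) y = move w (move v y)"
  by (simp add: move_def act_paths)

lemma move_rev: "y \<in> seq_space \<Longrightarrow> move (rev w) (move w y) = y" "y \<in> seq_space \<Longrightarrow> move w (move (rev w) y) = y"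
  by (simp_all add: move_def act_paths)

lemma act_continuous: "\<exists>M. \<forall>y. agree M y x \<longrightarrow> agree N (act w y) (act w x)"
proof (induction w arbitrary: x)
  case (Cons s w)
  obtain K where K: "\<And>y. agree K y (gen s x) \<Longrightarrow> agree N (act w y) (act w (gen s x))"
    using Cons by blast
  obtain M where "\<And>y. agree M y x \<Longrightarrow> agree K (gen s y) (gen s x)"
    using gen_continuous by blast
  then show ?case using K by (intro exI[of _ M]) auto
qed auto

lemma continuous_move: "continuous_map (top_of_set seq_space) (top_of_set seq_space) (move w)"
  unfolding continuous_map_def
proof (intro conjI allI impI)
  show "move w \<in> topspace (top_of_set seq_space) \<rightarrow> topspace (top_of_set seq_space)"
    by (auto simp: move_seq_space)
  fix U assume U: "openin (top_of_set seq_space) U"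
  show "openin (top_of_set seq_space) {y \<in> topspace (top_of_set seq_space). move w y \<in> U}"
  proof (rule seq_space_open)
    fix y assume "y \<in> {y \<in> topspace (top_of_set seq_space). move w y \<in> U}"
    then have y: "y \<in> seq_space" "move w y \<in> U" by auto
    obtain N where N: "\<forall>z\<in>seq_space. agree N (dec z) (dec (move w y)) \<longrightarrow> z \<in> U"
      using seq_space_nbhd[OF U y(2)] by blast
    obtain M where M: "\<And>z. agree M z (dec y) \<Longrightarrow> agree N (act w z) (act w (dec y))"
      using act_continuous by blast
    have "move w z \<in> U" if "z \<in> seq_space" "agree M (dec z) (dec y)" for z
      using N move_seq_space[OF that(1)] M[OF that(2)] dec_move y(1) that(1) by simp
    then show "\<exists>M. \<forall>z\<in>seq_space. agree M (dec z) (dec y) \<longrightarrow> z \<in> {y \<in> topspace (top_of_set seq_space). move w y \<in> U}"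
      by (intro exI[of _ M]) simp
  qed auto
qed

lemma move_homeo: "move w \<in> carrier (homeo_group (top_of_set seq_space))"
proof -
  have "bij_betw (move w) seq_space seq_space"
    by (rule bij_betw_byWitness[where f' = "move (rev w)"]) (auto simp: move_rev move_seq_space)
  then have "move w \<in> Bij seq_space"
    by (simp add: Bij_def move_def)
  moreover have "homeomorphic_maps (top_of_set seq_space) (top_of_set seq_space) (move w) (move (rev w))"
    unfolding homeomorphic_maps_def by (intro conjI ballI continuous_move) (auto simp: move_rev)
  then have "homeomorphic_map (top_of_set seq_space) (top_of_set seq_space) (move w)"
    using homeomorphic_map_maps by blast
  ultimately show ?thesis by (simp add: homeo_group_def)
qed

lemma move_mult: "move w \<otimes>\<^bsub>homeo_group (top_of_set seq_space)\<^esub> move v = move (v @ w)"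
proof -
  have "move w \<in> Bij seq_space" "move v \<in> Bij seq_space"
    using move_homeo by (auto simp: homeo_group_def)
  then have "move w \<otimes>\<^bsub>homeo_group (top_of_set seq_space)\<^esub> move v = compose seq_space (move w) (move v)"
    by (simp add: homeo_group_def BijGroup_def)
  also have "\<dots> = move (v @ w)"
    by (rule ext) (auto simp: compose_def move_append, simp add: move_def)
  finally show ?thesis .
qed

section \<open>The action of the free product\<close>

abbreviation letter_group :: "nat \<Rightarrow> int monoid"
  where "letter_group \<equiv> \<lambda>_. integer_mod_group 2"

abbreviation words where "words \<equiv> free_product_words {..<4} letter_group"
abbreviation cong where "cong \<equiv> free_product_cong {..<4} letter_group"
abbreviation cls where "cls u \<equiv> free_product_rel {..<4} letter_group `` {u}"

definition letters :: "(nat \<times> int) list \<Rightarrow> nat list"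
  where "letters u = map fst (filter (\<lambda>a. snd a = 1) u)"

definition spell :: "nat list \<Rightarrow> (nat \<times> int) list"
  where "spell w = map (\<lambda>s. (s, 1)) w"

lemma letters_append [simp]: "letters (u @ v) = letters u @ letters v"
  by (simp add: letters_def)

lemma letters_spell [simp]: "letters (spell w) = w"
  by (induction w) (auto simp: letters_def spell_def)

lemma words_iff: "u \<in> words \<longleftrightarrow> (\<forall>a\<in>set u. fst a < 4 \<and> (snd a = 0 \<or> snd a = 1))"
proof -
  have "x \<in> {0..<2} \<longleftrightarrow> x = 0 \<or> x = 1" for x :: int by auto
  then show ?thesis
    by (auto simp: free_product_words_def carrier_integer_mod_group lists_eq_set subset_iff mem_Times_iff Ball_def
        simp del: atLeastLessThan_iff)
qed

lemma set_letters: "u \<in> words \<Longrightarrow> set (letters u) \<subseteq> {..<4}"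
  by (auto simp: words_iff letters_def)

lemma spell_words: "set w \<subseteq> {..<4} \<Longrightarrow> spell w \<in> words"
  by (auto simp: words_iff spell_def)

lemma cong_act: "cong u v \<Longrightarrow> act (rev (letters u)) x = act (rev (letters v)) x"
proof (induction arbitrary: x rule: free_product_cong.induct)
  case (mult i a b)
  then have "a = 0 \<or> a = 1" "b = 0 \<or> b = 1"
    by (auto simp: carrier_integer_mod_group)
  then show ?case
    by (auto simp: letters_def gen_invol)
qed (auto simp: letters_def)

lemma equiv_cls: "equiv words (free_product_rel {..<4} letter_group)"
  by (rule equiv_free_product_rel) auto

lemma carrier_eq: "carrier free_product_four_Z2 = {cls u | u. u \<in> words}"
  by (auto simp: free_product_four_Z2_def free_product_def quotient_def)

text \<open>
  Words of the free product are composed as functions, from right to left, whereas \<open>act\<close> applies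
  its letters from left to right.
\<close>

definition group_act :: "(nat \<times> int) list set \<Rightarrow> (nat \<Rightarrow> real) \<Rightarrow> nat \<Rightarrow> real"
  where "group_act C = move (rev (letters (SOME u. u \<in> C)))"

lemma group_act_cls:
  assumes "u \<in> words"
  shows "group_act (cls u) = move (rev (letters u))"
proof -
  have "(SOME v. v \<in> cls u) \<in> cls u"
    by (rule someI[of _ u]) (use equiv_class_self[OF equiv_cls assms] in simp)
  then have "cong u (SOME v. v \<in> cls u)"
    by (simp add: free_product_rel_def)
  from cong_act[OF this] show ?thesis
    by (simp add: group_act_def move_def)
qed

lemma group_act_range: "group_act ` carrier free_product_four_Z2 = {move w | w. set w \<subseteq> {..<4}}"
proof (intro equalityI subsetI)
  fix f assume "f \<in> group_act ` carrier free_product_four_Z2"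
  then obtain u where "u \<in> words" "f = move (rev (letters u))"
    by (auto simp: carrier_eq group_act_cls)
  then show "f \<in> {move w | w. set w \<subseteq> {..<4}}"
    using set_letters[of u] by (intro CollectI exI[of _ "rev (letters u)"]) auto
next
  fix f assume "f \<in> {move w | w. set w \<subseteq> {..<4}}"
  then obtain w where w: "set w \<subseteq> {..<4}" "f = move w" by blast
  then have u: "spell (rev w) \<in> words" by (simp add: spell_words)
  then have "f = group_act (cls (spell (rev w)))"
    using w by (simp add: group_act_cls)
  then show "f \<in> group_act ` carrier free_product_four_Z2"
    using u by (auto simp: carrier_eq)
qed

lemma orbit_group_act: "orbit free_product_four_Z2 group_act y = {move w y | w. set w \<subseteq> {..<4}}"
  using group_act_range unfolding orbit_def by (auto simp: set_eq_iff image_iff) metis+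

lemma group_act_topological: "topological_action free_product_four_Z2 (top_of_set seq_space) group_act"
  unfolding topological_action_def
proof (rule group_hom.intro)
  show G: "group free_product_four_Z2"
    unfolding free_product_four_Z2_def by (rule group_free_product) simp
  show "group (homeo_group (top_of_set seq_space))"
    by (rule group_homeo_group)
  show "group_hom_axioms free_product_four_Z2 (homeo_group (top_of_set seq_space)) group_act"
  proof (rule group_hom_axioms.intro, rule homI)
    fix C assume "C \<in> carrier free_product_four_Z2"
    then have "group_act C \<in> {move w | w. set w \<subseteq> {..<4}}" using group_act_range by blast
    then show "group_act C \<in> carrier (homeo_group (top_of_set seq_space))" using move_homeo by auto
  next
    fix C D assume "C \<in> carrier free_product_four_Z2" "D \<in> carrier free_product_four_Z2"
    then obtain u v where uv: "u \<in> words" "v \<in> words" "C = cls u" "D = cls v"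
      by (auto simp: carrier_eq)
    have "C \<otimes>\<^bsub>free_product_four_Z2\<^esub> D = cls (u @ v)"
      unfolding uv(3,4) free_product_four_Z2_def by (rule free_product_mult_class) (use uv in auto)
    moreover have "u @ v \<in> words" using uv by (auto simp: words_iff)
    ultimately show "group_act (C \<otimes>\<^bsub>free_product_four_Z2\<^esub> D)
        = group_act C \<otimes>\<^bsub>homeo_group (top_of_set seq_space)\<^esub> group_act D"
      using uv by (simp add: group_act_cls move_mult)
  qed
qed

lemma ex_generic: "\<exists>x. x \<in> generic b"
proof (rule ccontr)
  assume "\<nexists>x. x \<in> generic b"
  then have "AE x in type_measure b. False"
    using AE_generic[of b] by simp
  then show False by simp
qed

text \<open>
  Reduction from the front, one letter at a time. The uniqueness of the reduced word is a consequence of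
  the freeness of the action, see \<open>group_act_faithful\<close>.
\<close>

lemma cong_reduced: "u \<in> words \<Longrightarrow> \<exists>w. set w \<subseteq> {..<4} \<and> distinct_adj w \<and> cong u (spell w)"
proof (induction u)
  case Nil
  have "cong [] []"
    by (rule free_product_cong.refl) (simp add: words_iff)
  then show ?case by (intro exI[of _ "[]"]) (simp add: spell_def)
next
  case (Cons a u)
  then obtain i x where a: "a = (i, x)" "i < 4" "x = 0 \<or> x = 1" and u: "u \<in> words"
    by (cases a) (auto simp: words_iff)
  from Cons.IH[OF u] obtain w where w: "set w \<subseteq> {..<4}" "distinct_adj w" "cong u (spell w)" by blast
  have unit: "cong [(i, 0)] []"
    using free_product_cong.unit[of i "{..<4}" letter_group] a(2) by simp
  have refl1: "cong [(i, x)] [(i, x)]"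
    by (rule free_product_cong.refl) (use a in \<open>auto simp: words_iff\<close>)
  have aw: "cong (a # u) ((i, x) # spell w)"
    using free_product_cong.append[OF refl1 w(3)] a by simp
  show ?case
  proof (cases "x = 0")
    case True
    have "cong ([(i, 0)] @ u) ([] @ spell w)"
      by (rule free_product_cong.append[OF unit w(3)])
    then show ?thesis using w a True by (intro exI[of _ w]) auto
  next
    case False
    then have x: "x = 1" using a by simp
    show ?thesis
    proof (cases "w \<noteq> [] \<and> hd w = i")
      case True
      then obtain w' where w': "w = i # w'" by (cases w) auto
      have "cong [(i, 1), (i, 1)] [(i, 1 \<otimes>\<^bsub>letter_group i\<^esub> 1)]"
        by (rule free_product_cong.mult) (use a in \<open>auto simp: carrier_integer_mod_group\<close>)
      then have "cong [(i, 1), (i, 1)] []"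
        using unit free_product_cong.trans by simp
      moreover have "cong (spell w') (spell w')"
        by (rule free_product_cong.refl) (use w w' in \<open>auto intro: spell_words\<close>)
      ultimately have "cong ([(i, 1), (i, 1)] @ spell w') ([] @ spell w')"
        by (rule free_product_cong.append)
      then have "cong (a # u) (spell w')"
        using aw x w' free_product_cong.trans by (simp add: spell_def) blast
      then show ?thesis using w w' by (intro exI[of _ w']) (auto simp: distinct_adj_Cons)
    next
      case False
      then show ?thesis using aw w x a
        by (intro exI[of _ "i # w"]) (auto simp: spell_def distinct_adj_Cons)
    qed
  qed
qed

text \<open>
  Reduced words are separated by their action on a generic path of type \<open>True\<close>.
\<close>

lemma group_act_faithful: "inj_on group_act (carrier free_product_four_Z2)"
proof (rule inj_onI)
  fix C D assume "C \<in> carrier free_product_four_Z2" "D \<in> carrier free_product_four_Z2"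
    and eq: "group_act C = group_act D"
  then obtain u v where uv: "u \<in> words" "v \<in> words" "C = cls u" "D = cls v"
    by (auto simp: carrier_eq)
  obtain w where w: "set w \<subseteq> {..<4}" "distinct_adj w" "cong u (spell w)"
    using cong_reduced[OF uv(1)] by blast
  obtain w' where w': "set w' \<subseteq> {..<4}" "distinct_adj w'" "cong v (spell w')"
    using cong_reduced[OF uv(2)] by blast
  obtain x where x: "x \<in> generic True" using ex_generic by blast
  then have xp: "emb x \<in> seq_space" by (simp add: generic_def)
  have "move (rev (letters u)) (emb x) = move (rev (letters v)) (emb x)"
    using eq uv by (simp add: group_act_cls)
  then have "act (rev (letters u)) x = act (rev (letters v)) x"
    using xp by (simp add: move_emb)
  then have "act (rev w) x = act (rev w') x"
    using cong_act[OF w(3), of x] cong_act[OF w'(3), of x] by simp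
  then have "rev w = rev w'"
    using I.reduced_word_inj[of x True "rev w" "rev w'"] generic_True_free[OF x] w w'
    by (simp add: act_def)
  then have "cong u v"
    using w(3) w'(3) free_product_cong.trans free_product_cong.sym by fastforce
  then show "C = D"
    unfolding uv(3,4) by (intro equiv_class_eq[OF equiv_cls]) (simp add: free_product_rel_def)
qed

lemma group_act_minimal: "minimal_action free_product_four_Z2 (top_of_set seq_space) group_act"
  unfolding minimal_action_def
proof
  fix z assume "z \<in> topspace (top_of_set seq_space)"
  then have z: "z \<in> seq_space" by simp
  have "y \<in> top_of_set seq_space closure_of orbit free_product_four_Z2 group_act z" if y: "y \<in> seq_space" for y
    unfolding in_closure_of
  proof (intro conjI allI impI)
    show "y \<in> topspace (top_of_set seq_space)" using y by simp
    fix U assume "y \<in> U \<and> openin (top_of_set seq_space) U"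
    then obtain M where M: "\<forall>z\<in>seq_space. agree M (dec z) (dec y) \<longrightarrow> z \<in> U"
      using seq_space_nbhd by blast
    obtain w where w: "set w \<subseteq> {..<4}" "agree M (act w (dec z)) (dec y)"
      using act_dense[of "dec z" "dec y" M] y z by auto
    then have "move w z \<in> U"
      using M move_seq_space[OF z] dec_move[OF z] by simp
    then show "\<exists>x. x \<in> orbit free_product_four_Z2 group_act z \<and> x \<in> U"
      using w by (auto simp: orbit_group_act)
  qed
  then show "top_of_set seq_space closure_of orbit free_product_four_Z2 group_act z = topspace (top_of_set seq_space)"
    using closure_of_subset_topspace[of "top_of_set seq_space"] by auto
qed

section \<open>Transport of the measures\<close>

abbreviation borel_seq_space where "borel_seq_space \<equiv> borel_of (top_of_set seq_space)"

lemma space_borel_seq_space [simp]: "space borel_seq_space = seq_space"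
  by (simp add: borel_of_def space_measure_of_conv)

lemma sets_borel_seq_space: "sets borel_seq_space = sigma_sets seq_space {U. openin (top_of_set seq_space) U}"
  unfolding borel_of_def by (subst sets_measure_of) (auto dest: openin_imp_subset)

lemma paths_sets: "paths \<in> sets seq_algebra"
proof -
  have "Measurable.pred seq_algebra (\<lambda>x. admissible j (x j))" for j
    by (rule measurable_compose[OF nth_measurable]) simp
  then have "Measurable.pred seq_algebra (\<lambda>x. \<forall>j. admissible j (x j))"
    by (intro pred_intros_countable)
  then show ?thesis by (simp add: Measurable.pred_def paths_def)
qed

text \<open>
  Sequences that are not paths form a null set; they are sent to an arbitrary point of the space.
\<close>

definition emb_total :: "(nat \<Rightarrow> nat) \<Rightarrow> nat \<Rightarrow> real"
  where "emb_total x = (if x \<in> paths then emb x else emb (ray_point True))"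

lemma emb_total_seq_space: "emb_total x \<in> seq_space"
  by (simp add: emb_total_def ray_point_paths)

lemma emb_total_measurable: "emb_total \<in> seq_algebra \<rightarrow>\<^sub>M borel_seq_space"
  unfolding borel_of_def
proof (rule measurable_measure_of)
  show "emb_total \<in> space seq_algebra \<rightarrow> topspace (top_of_set seq_space)"
    using emb_total_seq_space by simp
  fix U assume "U \<in> {U. openin (top_of_set seq_space) U}"
  then have U: "openin (top_of_set seq_space) U" by simp
  define A where "A = {x. \<exists>N. \<forall>y\<in>cyl N x \<inter> paths. emb y \<in> U}"
  have "A \<in> sets seq_algebra"
  proof (rule open_in_seq_algebra)
    fix x assume "x \<in> A"
    then obtain N where N: "\<forall>y\<in>cyl N x \<inter> paths. emb y \<in> U" unfolding A_def by blast
    have "cyl N z = cyl N x" if "z \<in> cyl N x" for z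
      using that by (auto simp: cyl_def)
    then have "cyl N x \<subseteq> A" using N unfolding A_def by blast
    then show "\<exists>N. cyl N x \<subseteq> A" ..
  qed
  moreover have "emb_total -` U \<inter> space seq_algebra
      = (A \<inter> paths) \<union> (if emb (ray_point True) \<in> U then - paths else {})"
  proof -
    have "emb x \<in> U \<longleftrightarrow> x \<in> A" if x: "x \<in> paths" for x
    proof
      assume "emb x \<in> U"
      then obtain M where M: "\<forall>z\<in>seq_space. agree M (dec z) (dec (emb x)) \<longrightarrow> z \<in> U"
        using seq_space_nbhd[OF U] by blast
      have "\<forall>y\<in>cyl M x \<inter> paths. emb y \<in> U"
        using M by (auto simp: agree_cyl)
      then show "x \<in> A" unfolding A_def by blast
    qed (use x in \<open>auto simp: cyl_def A_def\<close>)
    then show ?thesis by (auto simp: emb_total_def split: if_splits)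
  qed
  ultimately show "emb_total -` U \<inter> space seq_algebra \<in> sets seq_algebra"
    using paths_sets sets.compl_sets[OF paths_sets] by (auto simp: Compl_eq_Diff_UNIV)
qed (auto dest: openin_imp_subset)

lemma dec_measurable: "dec \<in> borel_seq_space \<rightarrow>\<^sub>M seq_algebra"
proof (rule measurable_PiM_single')
  fix j :: nat
  have "(\<lambda>y. dec y j) -` {v} \<inter> space borel_seq_space \<in> sets borel_seq_space" for v
  proof -
    have "openin (top_of_set seq_space) ((\<lambda>y. dec y j) -` {v} \<inter> seq_space)"
    proof (rule seq_space_open)
      fix y assume y: "y \<in> (\<lambda>y. dec y j) -` {v} \<inter> seq_space"
      have "\<forall>z\<in>seq_space. agree (Suc j) (dec z) (dec y) \<longrightarrow> z \<in> (\<lambda>y. dec y j) -` {v} \<inter> seq_space"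
        using y by (auto simp: agree_def)
      then show "\<exists>M. \<forall>z\<in>seq_space. agree M (dec z) (dec y) \<longrightarrow> z \<in> (\<lambda>y. dec y j) -` {v} \<inter> seq_space" ..
    qed auto
    then show ?thesis by (auto simp: sets_borel_seq_space)
  qed
  then show "(\<lambda>y. dec y j) \<in> borel_seq_space \<rightarrow>\<^sub>M count_space UNIV"
    by (subst measurable_count_space_eq2_countable) auto
qed auto

lemma move_measurable: "move w \<in> borel_seq_space \<rightarrow>\<^sub>M borel_seq_space"
proof -
  have "(\<lambda>y. emb_total (act w (dec y))) \<in> borel_seq_space \<rightarrow>\<^sub>M borel_seq_space"
    by (rule measurable_compose[OF dec_measurable measurable_compose[OF act_measurable emb_total_measurable]])
  moreover have "move w y = emb_total (act w (dec y))" if "y \<in> space borel_seq_space" for y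
    using that by (simp add: move_def emb_total_def act_paths)
  ultimately show ?thesis
    using measurable_cong[of borel_seq_space "move w" "\<lambda>y. emb_total (act w (dec y))" borel_seq_space] by blast
qed

definition seq_space_measure :: "bool \<Rightarrow> (nat \<Rightarrow> real) measure"
  where "seq_space_measure b = distr (type_measure b) borel_seq_space emb_total"

lemma sets_seq_space_measure [simp]: "sets (seq_space_measure b) = sets borel_seq_space"
  and space_seq_space_measure [simp]: "space (seq_space_measure b) = seq_space"
  by (simp_all add: seq_space_measure_def)

lemma emb_total_measurable_type: "emb_total \<in> type_measure b \<rightarrow>\<^sub>M borel_seq_space"
  using emb_total_measurable measurable_cong_sets[OF sets_type_measure HOL.refl] by blast

lemma act_measurable_type: "act w \<in> type_measure b \<rightarrow>\<^sub>M type_measure b"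
  using I.fold_g_meas[of w] unfolding act_def .

lemma prob_space_seq_space_measure: "prob_space (seq_space_measure b)"
  unfolding seq_space_measure_def by (rule T.prob_space_distr[OF emb_total_measurable_type])

lemma AE_paths: "AE x in type_measure b. x \<in> paths"
  using AE_type_measure by eventually_elim simp

lemma distr_act: "distr (type_measure b) (type_measure b) (act w) = type_measure b"
proof (rule measure_eqI)
  fix A assume "A \<in> sets (distr (type_measure b) (type_measure b) (act w))"
  then have A: "A \<in> sets seq_algebra" by simp
  then show "emeasure (distr (type_measure b) (type_measure b) (act w)) A = emeasure (type_measure b) A"
    using act_prob[OF A, of b w]
    by (subst emeasure_distr[OF act_measurable_type]) (auto simp: T.emeasure_eq_measure)
qed simp

lemma seq_space_measure_invariant: "distr (seq_space_measure b) (seq_space_measure b) (move w) = seq_space_measure b"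
proof -
  let ?m = "type_measure b"
  have "distr (seq_space_measure b) (seq_space_measure b) (move w) = distr (seq_space_measure b) borel_seq_space (move w)"
    by (rule distr_cong) auto
  also have "\<dots> = distr ?m borel_seq_space (move w \<circ> emb_total)"
    unfolding seq_space_measure_def by (rule distr_distr[OF move_measurable emb_total_measurable_type])
  also have "\<dots> = distr ?m borel_seq_space (emb_total \<circ> act w)"
  proof (rule distr_cong_AE)
    show "AE x in ?m. (move w \<circ> emb_total) x = (emb_total \<circ> act w) x"
      using AE_paths by eventually_elim (simp add: emb_total_def move_emb act_paths)
    show "move w \<circ> emb_total \<in> ?m \<rightarrow>\<^sub>M borel_seq_space"
      by (rule measurable_comp[OF emb_total_measurable_type move_measurable])
    show "emb_total \<circ> act w \<in> ?m \<rightarrow>\<^sub>M borel_seq_space"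
      by (rule measurable_comp[OF act_measurable_type emb_total_measurable_type])
  qed auto
  also have "\<dots> = distr (distr ?m ?m (act w)) borel_seq_space emb_total"
    by (rule distr_distr[OF emb_total_measurable_type act_measurable_type, symmetric])
  also have "\<dots> = seq_space_measure b"
    by (simp add: distr_act seq_space_measure_def)
  finally show ?thesis .
qed

lemma seq_space_measure_invariant_borel_prob:
  "invariant_borel_prob free_product_four_Z2 (top_of_set seq_space) group_act (seq_space_measure b)"
proof -
  have "distr (seq_space_measure b) (seq_space_measure b) (group_act C) = seq_space_measure b"
    if C: "C \<in> carrier free_product_four_Z2" for C
  proof -
    obtain w where "group_act C = move w"
      using group_act_range C by blast
    then show ?thesis by (simp only: seq_space_measure_invariant)
  qed
  then show ?thesis
    by (simp add: invariant_borel_prob_def prob_space_seq_space_measure)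
qed

lemma seq_space_measure_ergodic: "ergodic_action free_product_four_Z2 group_act (seq_space_measure b)"
  unfolding ergodic_action_def
proof (intro ballI impI)
  fix A assume A: "A \<in> sets (seq_space_measure b)" and inv: "\<forall>C\<in>carrier free_product_four_Z2. group_act C ` A = A"
  have sub: "A \<subseteq> seq_space" using sets.sets_into_space[OF A] by simp
  have move_A: "move w ` A = A" if "set w \<subseteq> {..<4}" for w
  proof -
    have "move w \<in> group_act ` carrier free_product_four_Z2"
      unfolding group_act_range using that by blast
    then obtain C where "C \<in> carrier free_product_four_Z2" "move w = group_act C" by blast
    then show ?thesis using inv by simp
  qed
  define A' where "A' = emb_total -` A \<inter> paths"
  have A': "A' \<in> sets seq_algebra"
    using measurable_sets[OF emb_total_measurable, of A] A paths_sets by (auto simp: A'_def)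
  have iff: "x \<in> A' \<longleftrightarrow> x \<in> paths \<and> emb x \<in> A" for x
    by (auto simp: A'_def emb_total_def)
  have imp: "gen s x \<in> A'" if "x \<in> A'" "s < 4" for x s
  proof -
    have "move [s] (emb x) \<in> A"
      using move_A[of "[s]"] that by (auto simp: iff)
    then show ?thesis
      using that act_paths[of "[s]" x] by (simp add: iff move_emb)
  qed
  have "gen s -` A' = A'" if s: "s < 4" for s
  proof (intro equalityI subsetI)
    fix x assume "x \<in> gen s -` A'"
    then show "x \<in> A'" using imp[of "gen s x" s] s by (simp add: gen_invol)
  qed (use imp s in auto)
  then have "measure (type_measure b) A' = 0 \<or> measure (type_measure b) A' = 1"
    by (rule gen_ergodic[OF A'])
  moreover have "measure (seq_space_measure b) A = measure (type_measure b) A'"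
  proof -
    have "measure (seq_space_measure b) A = measure (type_measure b) (emb_total -` A \<inter> space (type_measure b))"
      unfolding seq_space_measure_def by (rule measure_distr[OF emb_total_measurable_type]) (use A in simp)
    also have "\<dots> = measure (type_measure b) A'"
    proof (rule T.finite_measure_eq_AE)
      show "AE x in type_measure b. x \<in> emb_total -` A \<inter> space (type_measure b) \<longleftrightarrow> x \<in> A'"
        using AE_paths by eventually_elim (simp add: A'_def)
    qed (use A' measurable_sets[OF emb_total_measurable, of A] A in auto)
    finally show ?thesis .
  qed
  ultimately show "measure (seq_space_measure b) A = 0 \<or> measure (seq_space_measure b) A = 1" by simp
qed

lemma distr_dec: "distr (seq_space_measure b) seq_algebra dec = type_measure b"
proof -
  have "distr (seq_space_measure b) seq_algebra dec = distr (type_measure b) seq_algebra (dec \<circ> emb_total)"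
    unfolding seq_space_measure_def by (rule distr_distr[OF dec_measurable emb_total_measurable_type])
  also have "\<dots> = distr (type_measure b) (type_measure b) (\<lambda>x. x)"
  proof (rule distr_cong_AE)
    show "AE x in type_measure b. (dec \<circ> emb_total) x = x"
      using AE_paths by eventually_elim (simp add: emb_total_def)
  qed (auto intro: measurable_comp[OF emb_total_measurable_type dec_measurable])
  also have "\<dots> = type_measure b" by (rule distr_id)
  finally show ?thesis .
qed

lemma AE_dec:
  assumes "AE x in type_measure b. P x"
  shows "AE y in seq_space_measure b. P (dec y)"
proof (rule AE_distrD[where f = dec and M' = seq_algebra])
  show "dec \<in> seq_space_measure b \<rightarrow>\<^sub>M seq_algebra"
    using dec_measurable measurable_cong_sets[OF sets_seq_space_measure HOL.refl] by blast
  show "AE x in distr (seq_space_measure b) seq_algebra dec. P x"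
    using assms by (simp only: distr_dec)
qed

lemma AE_emb_total:
  assumes "AE y in seq_space_measure b. P y"
  shows "AE x in type_measure b. P (emb_total x)"
  by (rule AE_distrD[OF emb_total_measurable_type]) (use assms in \<open>simp only: seq_space_measure_def\<close>)

section \<open>Failure of orbit equivalence\<close>

abbreviation orbits_rel where "orbits_rel \<equiv> orbit_rel free_product_four_Z2 seq_space group_act"

lemma orbits_rel_Image: "y \<in> seq_space \<Longrightarrow> orbits_rel `` {y} = {move w y | w. set w \<subseteq> {..<4}}"
  by (auto simp: orbit_rel_def orbit_group_act)

text \<open>
  Reading off the digits of the image under the isomorphism embeds the orbits of the first system into those of
  the second, which are contained in tail classes. The exceptional null sets are removed together with all
  their translates under the countable group.
\<close>

lemma not_orbit_equivalent: "\<not> orbit_equivalent (seq_space_measure True) orbits_rel (seq_space_measure False) orbits_rel"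
proof
  let ?M = "seq_space_measure True" and ?N = "seq_space_measure False"
  assume "orbit_equivalent ?M orbits_rel ?N orbits_rel"
  then obtain A B F where A: "A \<in> sets ?M" "space ?M - A \<in> null_sets ?M"
    and B: "B \<in> sets ?N" "space ?N - B \<in> null_sets ?N"
    and F: "measure_iso_on ?M A ?N B F"
    and classes: "AE z in ?M. z \<in> A \<longrightarrow> F ` (orbits_rel `` {z} \<inter> A) = orbits_rel `` {F z} \<inter> B"
    unfolding orbit_equivalent_def by blast
  have bij: "bij_betw F A B"
    and F_meas: "F \<in> restrict_space ?M A \<rightarrow>\<^sub>M restrict_space ?N B"
    and F_distr: "distr (restrict_space ?M A) (restrict_space ?N B) F = restrict_space ?N B"
    using F by (auto simp: measure_iso_on_def)
  have sub: "A \<subseteq> seq_space" "B \<subseteq> seq_space"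
    using sets.sets_into_space[OF A(1)] sets.sets_into_space[OF B(1)] by simp_all
  have A_space: "A \<inter> space ?M \<in> sets ?M" and B_space: "B \<inter> space ?N \<in> sets ?N"
    using A(1) B(1) sub by (simp_all add: Int_absorb2)
  define \<theta> where "\<theta> x = (if x \<in> emb_total -` A then dec (F (emb_total x)) else (\<lambda>_. 0))" for x
  have \<theta>_meas: "\<theta> \<in> type_measure True \<rightarrow>\<^sub>M seq_algebra"
    unfolding \<theta>_def
  proof (subst measurable_restrict_space_iff[symmetric])
    show "emb_total -` A \<inter> space (type_measure True) \<in> sets (type_measure True)"
      by (rule measurable_sets[OF emb_total_measurable_type]) (use A(1) in simp)
    have "emb_total \<in> restrict_space (type_measure True) (emb_total -` A) \<rightarrow>\<^sub>M restrict_space ?M A"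
    proof (rule measurable_restrict_space3)
      show "emb_total \<in> type_measure True \<rightarrow>\<^sub>M ?M"
        using emb_total_measurable_type measurable_cong_sets[OF HOL.refl sets_seq_space_measure] by blast
    qed auto
    moreover have "dec \<in> restrict_space ?N B \<rightarrow>\<^sub>M seq_algebra"
      using dec_measurable measurable_cong_sets[OF sets_seq_space_measure HOL.refl]
      by (intro measurable_restrict_space1) blast
    ultimately show "(\<lambda>x. dec (F (emb_total x))) \<in> restrict_space (type_measure True) (emb_total -` A) \<rightarrow>\<^sub>M seq_algebra"
      by (intro measurable_compose[OF _ measurable_compose[OF F_meas]])
  qed simp
  have "AE y in ?N. dec y \<in> generic False"
    by (rule AE_dec[OF AE_generic])
  then have "AE y in restrict_space ?N B. dec y \<in> generic False"
    unfolding AE_restrict_space_iff[OF B_space] by eventually_elim simp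
  then have "AE z in restrict_space ?M A. dec (F z) \<in> generic False"
    by (intro AE_distrD[OF F_meas]) (simp only: F_distr)
  then have F_generic: "AE z in ?M. z \<in> A \<longrightarrow> dec (F z) \<in> generic False"
    unfolding AE_restrict_space_iff[OF A_space] .
  have "AE z in ?M. z \<in> A"
    using AE_not_in[OF A(2)] AE_space by eventually_elim auto
  then have "AE z in ?M. z \<in> A \<and> dec (F z) \<in> generic False \<and>
      F ` (orbits_rel `` {z} \<inter> A) = orbits_rel `` {F z} \<inter> B"
    using F_generic classes by eventually_elim simp
  from AE_emb_total[OF this] AE_paths
  have "AE x in type_measure True. x \<in> paths \<and> emb x \<in> A \<and> dec (F (emb x)) \<in> generic False \<and>
      F ` (orbits_rel `` {emb x} \<inter> A) = orbits_rel `` {F (emb x)} \<inter> B"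
    by eventually_elim (simp add: emb_total_def)
  then have good: "AE x in type_measure True. \<forall>w. act w x \<in> paths \<and> emb (act w x) \<in> A
      \<and> dec (F (emb (act w x))) \<in> generic False \<and>
      F ` (orbits_rel `` {emb (act w x)} \<inter> A) = orbits_rel `` {F (emb (act w x))} \<inter> B"
    unfolding act_def by (rule I.AE_fold_g)
  have \<theta>_eq: "\<theta> x = dec (F (emb x))" if "x \<in> paths" "emb x \<in> A" for x
    using that by (simp add: \<theta>_def emb_total_def)
  have F_seq_space: "F z \<in> seq_space" if "z \<in> A" for z
    using bij that sub(2) by (auto simp: bij_betw_def)
  show False
  proof (rule no_tail_embedding[OF I.pmp_involutions_axioms \<theta>_meas, folded act_def])
    show "AE x in type_measure True. \<forall>w. set w \<subseteq> {..<4} \<longrightarrow> distinct_adj w \<longrightarrow> w \<noteq> [] \<longrightarrow> act w x \<noteq> x"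
      using AE_generic[of True] by eventually_elim (simp add: generic_True_free)
    show "AE x in type_measure True. \<forall>w. set w \<subseteq> {..<4} \<longrightarrow> \<theta> (act w x) = \<theta> x \<longrightarrow> act w x = x"
      using good
    proof eventually_elim
      case (elim x)
      show ?case
      proof (intro allI impI)
        fix w assume eq: "\<theta> (act w x) = \<theta> x"
        have x: "x \<in> paths" "emb x \<in> A" using elim[THEN spec[of _ "[]"]] by auto
        have wx: "act w x \<in> paths" "emb (act w x) \<in> A" using elim by auto
        have "dec (F (emb (act w x))) = dec (F (emb x))"
          using eq \<theta>_eq[OF x] \<theta>_eq[OF wx] by simp
        then have "F (emb (act w x)) = F (emb x)"
          using F_seq_space[OF x(2)] F_seq_space[OF wx(2)] dec_seq_space(2) by metis
        then have "emb (act w x) = emb x"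
          using inj_onD[OF bij_betw_imp_inj_on[OF bij] _ wx(2) x(2)] by blast
        then show "act w x = x" by simp
      qed
    qed
    show "AE x in type_measure True. \<forall>s<4. \<exists>n. \<forall>j\<ge>n. \<theta> (gen s x) j = \<theta> x j"
      using good
    proof eventually_elim
      case (elim x)
      show ?case
      proof (intro allI impI)
        fix s :: nat assume s: "s < 4"
        have x: "x \<in> paths" "emb x \<in> A" "dec (F (emb x)) \<in> generic False"
          "F ` (orbits_rel `` {emb x} \<inter> A) = orbits_rel `` {F (emb x)} \<inter> B"
          using elim[THEN spec[of _ "[]"]] by auto
        have sx: "gen s x \<in> paths" "emb (gen s x) \<in> A"
          using elim[THEN spec[of _ "[s]"]] by auto
        have "emb (gen s x) = move [s] (emb x)"
          using x(1) by (simp add: move_emb)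
        then have "emb (gen s x) \<in> orbits_rel `` {emb x}"
          using s x(1) by (subst orbits_rel_Image) (auto intro!: exI[of _ "[s]"])
        then have "F (emb (gen s x)) \<in> orbits_rel `` {F (emb x)}"
          using x(4) sx(2) by blast
        then obtain w where w: "set w \<subseteq> {..<4}" "F (emb (gen s x)) = move w (F (emb x))"
          unfolding orbits_rel_Image[OF F_seq_space[OF x(2)]] by blast
        then have "\<theta> (gen s x) = act w (\<theta> x)"
          using \<theta>_eq[OF x(1,2)] \<theta>_eq[OF sx] dec_move[OF F_seq_space[OF x(2)]] by simp
        moreover have "\<theta> x \<in> generic False"
          using \<theta>_eq[OF x(1,2)] x(3) by simp
        ultimately show "\<exists>n. \<forall>j\<ge>n. \<theta> (gen s x) j = \<theta> x j"
          using generic_False_tail w(1) by simp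
      qed
    qed
  qed
qed

end

text \<open>
  From level 2 on, the quotients that separate words of length \<open>2 ^ j + 7\<close> are used. The first summand
  makes the probabilities of a switch summable and reaches every word eventually, the second one
  leaves room for the instructions among the ordinary edges.
\<close>

lemma ex_switching_system: "\<exists>k L R. switching_system k L R"
proof -
  define good where "good r q \<longleftrightarrow> (case q of (k :: nat, L :: nat \<Rightarrow> nat \<Rightarrow> nat, R :: nat \<Rightarrow> nat \<Rightarrow> nat) \<Rightarrow> r < k \<and>
     (\<forall>s v. L s (L s v) = v \<and> R s (R s v) = v) \<and>
     (\<forall>s v. k \<le> v \<longrightarrow> L s v = v \<and> R s v = v) \<and>
     (\<forall>s s' v. L s (R s' v) = R s' (L s v)) \<and>
     (\<forall>v<k. \<exists>w. set w \<subseteq> {..<4} \<and> fold R w 0 = v) \<and>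
     (\<forall>w. distinct_adj w \<longrightarrow> set w \<subseteq> {..<4} \<longrightarrow> w \<noteq> [] \<longrightarrow> length w \<le> r \<longrightarrow>
        (\<forall>v<k. fold L w v \<noteq> v)))" for r :: nat and q
  have "\<forall>j. \<exists>q. good (2 ^ j + 7) q"
  proof
    fix j :: nat
    show "\<exists>q. good (2 ^ j + 7) q"
      using ex_finite_quotient[of "2 ^ j + 7"] unfolding good_def by auto
  qed
  then obtain q where q: "\<And>j. good (2 ^ j + 7) (q j)" by metis
  define k where "k j = (if j = 0 then 2 else if j = 1 then 7 else fst (q j))" for j
  define L where "L j = (if j < 2 then \<lambda>_ v. v else fst (snd (q j)))" for j
  define R where "R j = (if j < 2 then \<lambda>_ v. v else snd (snd (q j)))" for j
  have good: "good (2 ^ j + 7) (k j, L j, R j)" if "2 \<le> j" for j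
    using q[of j] that by (simp add: k_def L_def R_def)
  have "switching_system k L R"
  proof
    show "k 0 = 2" "k 1 = 7" by (simp_all add: k_def)
    show "2 ^ j + 7 \<le> k j" if "2 \<le> j" for j
      using good[OF that] by (simp add: good_def)
    have id: "L j = (\<lambda>_ v. v)" "R j = (\<lambda>_ v. v)" if "\<not> 2 \<le> j" for j
      using that by (simp_all add: L_def R_def)
    show "L j s (L j s v) = v" "R j s (R j s v) = v" "L j s (R j s' v) = R j s' (L j s v)" for j s s' v
      using good[of j] id[of j] unfolding good_def prod.case by (cases "2 \<le> j"; metis)+
    show "L j s v = v" "R j s v = v" if "k j \<le> v" for j s v
      using good[of j] id[of j] that unfolding good_def prod.case by (cases "2 \<le> j"; metis)+
    show "\<exists>w. set w \<subseteq> {..<4} \<and> fold (R j) w 0 = v" if "2 \<le> j" "v < k j" for j v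
      using good[OF that(1)] that(2) by (simp add: good_def)
    show "fold (L j) w v \<noteq> v" if "2 \<le> j" "distinct_adj w" "set w \<subseteq> {..<4}" "w \<noteq> []" "length w \<le> j" "v < k j" for j w v
    proof -
      have "j \<le> 2 ^ j + 7" using less_exp[of j] by linarith
      then show ?thesis
        using good[OF that(1)] that(2-) by (simp add: good_def)
    qed
  qed
  then show ?thesis by blast
qed

theorem theorem1:
  shows "\<exists>(Z :: (nat \<Rightarrow> real) metric) (\<Phi> :: (nat \<times> int) list set \<Rightarrow> (nat \<Rightarrow> real) \<Rightarrow> (nat \<Rightarrow> real)).
    compact_space (mtopology_of Z) \<and>
    topological_action free_product_four_Z2 (mtopology_of Z) \<Phi> \<and>
    inj_on \<Phi> (carrier free_product_four_Z2) \<and>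
    minimal_action free_product_four_Z2 (mtopology_of Z) \<Phi> \<and>
    (\<exists>\<mu>\<^sub>1 \<mu>\<^sub>2.
      invariant_borel_prob free_product_four_Z2 (mtopology_of Z) \<Phi> \<mu>\<^sub>1 \<and>
      ergodic_action free_product_four_Z2 \<Phi> \<mu>\<^sub>1 \<and>
      invariant_borel_prob free_product_four_Z2 (mtopology_of Z) \<Phi> \<mu>\<^sub>2 \<and>
      ergodic_action free_product_four_Z2 \<Phi> \<mu>\<^sub>2 \<and>
      \<not> orbit_equivalent \<mu>\<^sub>1 (orbit_rel free_product_four_Z2 (mspace Z) \<Phi>)
                         \<mu>\<^sub>2 (orbit_rel free_product_four_Z2 (mspace Z) \<Phi>))"
proof -
  obtain k L R where "switching_system k L R"
    using ex_switching_system by blast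
  then interpret switching_system k L R .
  have "compact_space (top_of_set seq_space)"
    using compact_seq_space by (simp add: compact_space_subtopology)
  then show ?thesis
    by (intro exI[of _ space_metric] exI[of _ group_act], unfold mtopology_space_metric mspace_space_metric,
        intro conjI exI[of _ "seq_space_measure True"] exI[of _ "seq_space_measure False"])
      (rule group_act_topological group_act_faithful group_act_minimal
        seq_space_measure_invariant_borel_prob seq_space_measure_ergodic not_orbit_equivalent | assumption)+
qed

end
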